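(* Let $\Gamma$ be a group of (orientation-preserving) $C^{1+bv}$ diffeomorphisms of the circle $\mathrm{S}^1$ that is isomorphic to $\mathbb{Z}^k$, whose action on $\mathrm{S}^1$ is free and all of whose elements have absolutely continuous derivative. Let $\{f_1,\ldots,f_k\}$ be a generating system of $\Gamma$. For each integer $n\ge 0$, let $B(n)$ be the set of elements of the form $f_1^{n_1}f_2^{n_2}\cdots f_k^{n_k}$ with $0\le n_i\le n$ for all $i$. For each $n\ge 1$, let $h_n$ be a circle diffeomorphism such that $$D h_n(x)=\frac{\left[\prod_{g\in B(n-1)}Dg(x)\right]^{1/|B(n-1)|}}{\int_{\mathrm{S}^1}\left[\prod_{g\in B(n-1)}Dg(z)\right]^{1/|B(n-1)|}dz}.$$ Then, for each $f\in\Gamma$, the conjugates $h_n f h_n^{-1}$ converge to the rotation $R_{\rho(f)}$ in the $C^{1+bv}$ sense as $n\to\infty$.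
   Context: All diffeomorphisms are orientation preserving. $\mathrm{S}^1=\mathbb{R}/\mathbb{Z}$, $\rho(f)\in\mathbb{R}/\mathbb{Z}$ is the rotation number of $f$, and $R_\rho(x)=x+\rho$. A $C^{1+bv}$ diffeomorphism is a $C^1$ diffeomorphism $f$ such that $\log(Df)$ has finite total variation; $\mathrm{var}$ denotes total variation on $\mathrm{S}^1$. The action of $\Gamma$ is free if no nontrivial element of $\Gamma$ has a fixed point. Circle diffeomorphisms $F_n$ converge to a rotation $R_\rho$ in the $C^{1+bv}$ sense if $F_n\to R_\rho$ uniformly, $DF_n\to 1$ uniformly, and $\mathrm{var}(\log(DF_n))\to 0$. *)

theory Defs
  imports
    "HOL-Analysis.Analysis"
    "HOL-Algebra.Product_Groups"
    "HOL-Algebra.Elementary_Groups"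
    "HOL-Algebra.Generated_Groups"
begin

section \<open>The circle \<open>\<real>/\<int>\<close>\<close>

definition circle_rel :: "real \<Rightarrow> real \<Rightarrow> bool" where
  "circle_rel x y \<longleftrightarrow> x - y \<in> \<int>"

lemma equivp_circle_rel: "equivp circle_rel"
proof (rule equivpI)
  show "reflp circle_rel"
    by (simp add: reflp_def circle_rel_def)
  show "symp circle_rel"
    by (metis Ints_minus circle_rel_def minus_diff_eq sympI)
  show "transp circle_rel"
  proof (rule transpI)
    fix x y z assume "circle_rel x y" "circle_rel y z"
    then have "(x - y) + (y - z) \<in> \<int>"
      unfolding circle_rel_def by (rule Ints_add)
    then show "circle_rel x z"
      by (simp add: circle_rel_def)
  qed
qed

quotient_type circle = real / circle_rel
  by (rule equivp_circle_rel)

lift_definition circ :: "real \<Rightarrow> circle" is "\<lambda>x. x" .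

lemma circ_eq_iff: "circ x = circ y \<longleftrightarrow> x - y \<in> \<int>"
  by transfer (simp add: circle_rel_def)

lemma circ_surj: "\<exists>t. circ t = x"
  by transfer (meson equivp_circle_rel equivp_reflp)

instantiation circle :: ab_group_add
begin

lift_definition zero_circle :: circle is 0 .

lift_definition plus_circle :: "circle \<Rightarrow> circle \<Rightarrow> circle" is "(+)"
  unfolding circle_rel_def by (metis Ints_add add_diff_add)

lift_definition uminus_circle :: "circle \<Rightarrow> circle" is uminus
  unfolding circle_rel_def by (metis Ints_minus minus_diff_minus)

lift_definition minus_circle :: "circle \<Rightarrow> circle \<Rightarrow> circle" is "(-)"
proof -
  fix a b c d :: real assume "circle_rel a b" "circle_rel c d"
  then have "(a - b) - (c - d) \<in> \<int>"
    unfolding circle_rel_def by (rule Ints_diff)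
  then show "circle_rel (a - c) (b - d)"
    by (simp add: circle_rel_def algebra_simps)
qed

instance
  by standard (transfer; simp add: circle_rel_def algebra_simps)+

end

lemma round_add_Int:
  fixes x :: real
  assumes "x - y \<in> \<int>"
  shows "\<bar>x - of_int (round x)\<bar> = \<bar>y - of_int (round y)\<bar>"
proof -
  obtain m where m: "x = y + of_int m"
    using assms by (metis Ints_cases add.commute diff_add_cancel)
  have "\<bar>x - of_int (round x)\<bar> \<le> \<bar>x - of_int (round y + m)\<bar>"
    by (rule round_diff_minimal)
  moreover have "\<bar>y - of_int (round y)\<bar> \<le> \<bar>y - of_int (round x - m)\<bar>"
    by (rule round_diff_minimal)
  ultimately show ?thesis
    by (simp add: m)
qed

text \<open>The distance on \<open>\<real>/\<int>\<close> is the distance of \<open>x - y\<close> to the nearest integer.\<close>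

instantiation circle :: metric_space
begin

lift_definition dist_circle :: "circle \<Rightarrow> circle \<Rightarrow> real"
  is "\<lambda>x y. \<bar>(x - y) - of_int (round (x - y))\<bar>"
proof -
  fix a b c d :: real assume "circle_rel a b" "circle_rel c d"
  then have "(a - b) - (c - d) \<in> \<int>"
    unfolding circle_rel_def by (rule Ints_diff)
  then have "(a - c) - (b - d) \<in> \<int>"
    by (simp add: algebra_simps)
  then show "\<bar>(a - c) - of_int (round (a - c))\<bar> = \<bar>(b - d) - of_int (round (b - d))\<bar>"
    by (rule round_add_Int)
qed

definition uniformity_circle :: "(circle \<times> circle) filter" where
  "uniformity_circle = (INF e\<in>{0<..}. principal {(x, y). dist x y < e})"

definition open_circle :: "circle set \<Rightarrow> bool" where
  "open_circle U \<longleftrightarrow> (\<forall>x\<in>U. eventually (\<lambda>(x', y). x' = x \<longrightarrow> y \<in> U) uniformity)"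

instance
proof
  fix x y z :: circle
  show "(dist x y = 0) = (x = y)"
  proof transfer
    fix x y :: real
    show "(\<bar>(x - y) - of_int (round (x - y))\<bar> = 0) = circle_rel x y"
      unfolding circle_rel_def by (metis Ints_cases Ints_of_int abs_zero eq_iff_diff_eq_0
          abs_eq_0 round_of_int)
  qed
  show "dist x y \<le> dist x z + dist y z"
  proof transfer
    fix x y z :: real
    have "\<bar>(x - y) - of_int (round (x - y))\<bar>
        \<le> \<bar>(x - y) - of_int (round (x - z) - round (y - z))\<bar>"
      by (rule round_diff_minimal)
    then show "\<bar>(x - y) - of_int (round (x - y))\<bar>
        \<le> \<bar>(x - z) - of_int (round (x - z))\<bar> + \<bar>(y - z) - of_int (round (y - z))\<bar>"
      by simp
  qed
qed (simp_all only: uniformity_circle_def open_circle_def)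

end

section \<open>Lifts, derivatives and diffeomorphisms\<close>

definition is_lift :: "(real \<Rightarrow> real) \<Rightarrow> (circle \<Rightarrow> circle) \<Rightarrow> bool" where
  "is_lift F f \<longleftrightarrow> continuous_on UNIV F \<and> (\<forall>t. circ (F t) = f (circ t))"

definition circle_has_deriv :: "(circle \<Rightarrow> circle) \<Rightarrow> real \<Rightarrow> circle \<Rightarrow> bool" where
  "circle_has_deriv f d x \<longleftrightarrow>
     (\<exists>F t. is_lift F f \<and> circ t = x \<and> (F has_real_derivative d) (at t))"

definition circle_deriv :: "(circle \<Rightarrow> circle) \<Rightarrow> circle \<Rightarrow> real" where
  "circle_deriv f x = (THE d. circle_has_deriv f d x)"

definition circle_C1 :: "(circle \<Rightarrow> circle) \<Rightarrow> bool" where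
  "circle_C1 f \<longleftrightarrow>
     (\<forall>x. \<exists>d. circle_has_deriv f d x) \<and> continuous_on UNIV (circle_deriv f)"

text \<open>Orientation preserving \<open>C\<^sup>1\<close> diffeomorphisms.\<close>

definition circle_diffeo :: "(circle \<Rightarrow> circle) \<Rightarrow> bool" where
  "circle_diffeo f \<longleftrightarrow>
     bij f \<and> circle_C1 f \<and> circle_C1 (inv_into UNIV f) \<and> (\<forall>x. 0 < circle_deriv f x)"

lemma is_lift_unique:
  assumes "is_lift F f" "is_lift G f"
  shows "\<exists>m::int. \<forall>t. G t = F t + of_int m"
proof -
  have Z: "G t - F t \<in> \<int>" for t
    using assms by (metis circ_eq_iff is_lift_def)
  have "continuous_on UNIV (\<lambda>t. G t - F t)"
    using assms by (auto simp: is_lift_def intro!: continuous_intros)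
  then have "(\<lambda>t. G t - F t) constant_on UNIV"
  proof (rule continuous_discrete_range_constant[OF connected_UNIV])
    fix s :: real
    have "1 \<le> norm ((G t - F t) - (G s - F s))" if "G t - F t \<noteq> G s - F s" for t
      using that Z[of t] Z[of s]
      by (metis Ints_diff Ints_nonzero_abs_ge1 eq_iff_diff_eq_0 real_norm_def)
    then show "\<exists>e>0. \<forall>t. t \<in> UNIV \<and> G t - F t \<noteq> G s - F s
        \<longrightarrow> e \<le> norm ((G t - F t) - (G s - F s))"
      by (intro exI[of _ 1]) auto
  qed
  then obtain c where c: "\<And>t. G t - F t = c"
    by (auto simp: constant_on_def)
  with Z[of 0] obtain m where "c = of_int m"
    by (auto elim: Ints_cases)
  with c show ?thesis
    by (metis add.commute diff_add_cancel)
qed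

lemma circle_has_deriv_unique:
  assumes "circle_has_deriv f d x" "circle_has_deriv f d' x"
  shows "d = d'"
proof -
  obtain F s where F: "is_lift F f" "circ s = x" "(F has_real_derivative d) (at s)"
    using assms(1) by (auto simp: circle_has_deriv_def)
  obtain G t where G: "is_lift G f" "circ t = x" "(G has_real_derivative d') (at t)"
    using assms(2) by (auto simp: circle_has_deriv_def)
  obtain j where j: "s = t + of_int j"
    using F(2) G(2) by (metis Ints_cases add.commute circ_eq_iff diff_add_cancel)
  have "circ (u + of_int j) = circ u" for u
    by (simp add: circ_eq_iff)
  then have "is_lift (\<lambda>u. F (u + of_int j)) f"
    using F(1) unfolding is_lift_def
    by (auto intro!: continuous_on_compose2[of UNIV F] continuous_intros)
  then obtain m where m: "\<And>u. G u = F (u + of_int j) + of_int m"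
    using is_lift_unique[OF _ G(1)] by blast
  have "((\<lambda>u. F (u + of_int j)) has_real_derivative d) (at t)"
    using F(3) by (simp add: j DERIV_shift)
  then have "((\<lambda>u. F (u + of_int j) + of_int m) has_real_derivative d + 0) (at t)"
    by (intro derivative_intros)
  moreover have "G = (\<lambda>u. F (u + of_int j) + of_int m)"
    using m by auto
  ultimately show ?thesis
    using G(3) by (simp add: DERIV_unique)
qed

lemma circle_deriv_eq:
  assumes "is_lift F f" "(F has_real_derivative d) (at t)"
  shows "circle_deriv f (circ t) = d"
proof -
  have "circle_has_deriv f d (circ t)"
    using assms by (auto simp: circle_has_deriv_def)
  then show ?thesis
    unfolding circle_deriv_def using circle_has_deriv_unique by blast
qed

section \<open>Total variation, absolute continuity, integration\<close>

definition circle_var :: "(circle \<Rightarrow> real) \<Rightarrow> ennreal" where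
  "circle_var \<phi> =
     (SUP (n, t) \<in> {(n::nat, t::nat \<Rightarrow> real). (\<forall>i<n. t i \<le> t (Suc i)) \<and> t n = t 0 + 1}.
        \<Sum>i<n. ennreal \<bar>\<phi> (circ (t (Suc i))) - \<phi> (circ (t i))\<bar>)"

definition circle_C1bv_diffeo :: "(circle \<Rightarrow> circle) \<Rightarrow> bool" where
  "circle_C1bv_diffeo f \<longleftrightarrow>
     circle_diffeo f \<and> circle_var (\<lambda>x. ln (circle_deriv f x)) < \<infinity>"

definition abs_cont_interval :: "real \<Rightarrow> real \<Rightarrow> (real \<Rightarrow> real) \<Rightarrow> bool" where
  "abs_cont_interval a b \<psi> \<longleftrightarrow>
     (\<forall>e>0. \<exists>d>0. \<forall>(n::nat) u v.
        (\<forall>i<n. a \<le> u i \<and> u i \<le> v i \<and> v i \<le> b) \<and>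
        (\<forall>i<n. \<forall>j<n. i \<noteq> j \<longrightarrow> {u i<..<v i} \<inter> {u j<..<v j} = {}) \<and>
        (\<Sum>i<n. v i - u i) < d
        \<longrightarrow> (\<Sum>i<n. \<bar>\<psi> (v i) - \<psi> (u i)\<bar>) < e)"

definition circle_abs_cont :: "(circle \<Rightarrow> real) \<Rightarrow> bool" where
  "circle_abs_cont \<phi> \<longleftrightarrow> (\<forall>a b. abs_cont_interval a b (\<lambda>t. \<phi> (circ t)))"

definition circle_integral :: "(circle \<Rightarrow> real) \<Rightarrow> real" where
  "circle_integral \<phi> = integral {0..1} (\<lambda>t. \<phi> (circ t))"

section \<open>Rotation number\<close>

definition circle_has_rotation_number :: "(circle \<Rightarrow> circle) \<Rightarrow> circle \<Rightarrow> bool" where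
  "circle_has_rotation_number f \<rho> \<longleftrightarrow>
     (\<exists>F r. is_lift F f \<and> (\<forall>t. (\<lambda>n. ((F ^^ n) t - t) / real n) \<longlonglongrightarrow> r) \<and> \<rho> = circ r)"

definition rotation_number :: "(circle \<Rightarrow> circle) \<Rightarrow> circle" where
  "rotation_number f = (THE \<rho>. circle_has_rotation_number f \<rho>)"

lemma rotation_number_eq:
  assumes F: "is_lift F f" and deg: "\<And>t. F (t + 1) = F t + 1"
    and lim: "\<And>t. (\<lambda>n. ((F ^^ n) t - t) / real n) \<longlonglongrightarrow> r"
  shows "rotation_number f = circ r"
  unfolding rotation_number_def
proof (rule the_equality)
  show "circle_has_rotation_number f (circ r)"
    using F lim by (auto simp: circle_has_rotation_number_def)
next
  fix \<rho> assume "circle_has_rotation_number f \<rho>"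
  then obtain G s where G: "is_lift G f"
    and limG: "\<And>t. (\<lambda>n. ((G ^^ n) t - t) / real n) \<longlonglongrightarrow> s" and \<rho>: "\<rho> = circ s"
    by (auto simp: circle_has_rotation_number_def)
  obtain m where m: "\<And>t. G t = F t + of_int m"
    using is_lift_unique[OF F G] by blast
  have nat: "F (t + real k) = F t + real k" for t k
  proof (induction k)
    case (Suc k)
    then show ?case using deg[of "t + real k"] by (simp add: algebra_simps)
  qed simp
  have int: "F (t + of_int k) = F t + of_int k" for t and k :: int
  proof (cases k)
    case (nonneg j)
    then show ?thesis using nat[of t j] by simp
  next
    case (neg j)
    then have k: "t + of_int k = t - real (Suc j)" "of_int k = - real (Suc j)" by simp_all
    have "F t = F (t - real (Suc j)) + real (Suc j)"
      using nat[of "t - real (Suc j)" "Suc j"] by (simp only: diff_add_cancel)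
    then show ?thesis unfolding k(1) unfolding k(2) by linarith
  qed
  have iter: "(G ^^ n) 0 = (F ^^ n) 0 + of_int (int n * m)" for n
  proof (induction n)
    case (Suc n)
    have "(G ^^ Suc n) 0 = F ((F ^^ n) 0 + of_int (int n * m)) + of_int m"
      by (simp only: funpow.simps comp_apply Suc m)
    also have "\<dots> = F ((F ^^ n) 0) + of_int (int n * m) + of_int m"
      by (simp only: int)
    finally show ?case by (simp add: algebra_simps)
  qed simp
  have "(\<lambda>n. ((F ^^ n) 0 - 0) / real n + of_int m) \<longlonglongrightarrow> r + of_int m"
    by (intro tendsto_intros lim)
  moreover have "eventually (\<lambda>n. ((F ^^ n) 0 - 0) / real n + of_int m = ((G ^^ n) 0 - 0) / real n)
      sequentially"
    using eventually_gt_at_top[of 0]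
    by eventually_elim (simp add: iter field_simps)
  ultimately have "(\<lambda>n. ((G ^^ n) 0 - 0) / real n) \<longlonglongrightarrow> r + of_int m"
    by (rule Lim_transform_eventually)
  then have "s = r + of_int m"
    using limG LIMSEQ_unique by blast
  then show "\<rho> = circ r"
    by (simp add: \<rho> circ_eq_iff)
qed

section \<open>Groups of circle diffeomorphisms\<close>

definition comp_group :: "(circle \<Rightarrow> circle) set \<Rightarrow> (circle \<Rightarrow> circle) monoid" where
  "comp_group \<Gamma> = \<lparr>carrier = \<Gamma>, monoid.mult = (\<circ>), one = id\<rparr>"

definition Zk :: "nat \<Rightarrow> (nat \<Rightarrow> int) monoid" where
  "Zk k = product_group {1..k} (\<lambda>_. integer_group)"

definition free_action :: "(circle \<Rightarrow> circle) set \<Rightarrow> bool" where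
  "free_action \<Gamma> \<longleftrightarrow> (\<forall>g\<in>\<Gamma>. g \<noteq> id \<longrightarrow> (\<forall>x. g x \<noteq> x))"

definition power_word :: "nat \<Rightarrow> (nat \<Rightarrow> circle \<Rightarrow> circle) \<Rightarrow> (nat \<Rightarrow> nat) \<Rightarrow> circle \<Rightarrow> circle" where
  "power_word k f m = foldr (\<circ>) (map (\<lambda>i. f i ^^ m i) [1..<Suc k]) id"

definition word_box :: "nat \<Rightarrow> (nat \<Rightarrow> circle \<Rightarrow> circle) \<Rightarrow> nat \<Rightarrow> (circle \<Rightarrow> circle) set" where
  "word_box k f n = {power_word k f m | m. \<forall>i\<in>{1..k}. m i \<le> n}"

definition geom_mean_deriv :: "(circle \<Rightarrow> circle) set \<Rightarrow> circle \<Rightarrow> real" where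
  "geom_mean_deriv B x = (\<Prod>g\<in>B. circle_deriv g x) powr (1 / real (card B))"

definition converges_C1bv_to_rotation :: "(nat \<Rightarrow> circle \<Rightarrow> circle) \<Rightarrow> circle \<Rightarrow> bool" where
  "converges_C1bv_to_rotation F \<rho> \<longleftrightarrow>
     uniform_limit UNIV F (\<lambda>x. x + \<rho>) sequentially \<and>
     uniform_limit UNIV (\<lambda>n. circle_deriv (F n)) (\<lambda>_. 1) sequentially \<and>
     (\<lambda>n. circle_var (\<lambda>x. ln (circle_deriv (F n) x))) \<longlonglongrightarrow> 0"

end

theory Submission
  imports Defs
begin

text \<open>Since \<open>\<Gamma>\<close> is abelian, \<open>ln D(h\<^sub>n g h\<^sub>n\<^sup>-\<^sup>1) \<circ> h\<^sub>n\<close> is the average of \<open>u \<circ> w\<close> over the words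
  \<open>w \<in> B(n-1)\<close>, where \<open>u = ln Dg\<close>. Variation is invariant under composition with homeomorphisms, so
  everything follows once the variation of these averages tends to \<open>0\<close>; the mean value theorem and
  the conjugacy invariance of the rotation number then give the uniform convergence.

  Let \<open>N(u)\<close> be the upper limit of the variation of the averages of an absolutely continuous \<open>u\<close>. The
  boxes form a Folner sequence, hence \<open>N(u) = N(u \<circ> w)\<close>, and \<open>N(u)\<close> equals \<open>N\<close> of every average of
  \<open>u\<close>. It therefore suffices to prove \<open>N(u) \<le> (1 - \<kappa>) var(u)\<close> with \<open>\<kappa> > 0\<close> independent of \<open>u\<close>: applied
  to the averages this gives \<open>N(u) \<le> (1 - \<kappa>) N(u)\<close>.

  Absolute continuity allows to replace \<open>u\<close> by a combination, with coefficients of sum \<open>0\<close> and absolute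
  sum at most \<open>var(u)\<close>, of ramps, i.e. of primitives of uniform densities on the intervals of a fine
  partition. Fix \<open>f \<in> \<Gamma>\<close> other than the identity; closest returns of an orbit of \<open>f\<close> give arbitrarily
  fine partitions whose intervals are images of a base interval under iterates of \<open>f\<close> with bounded
  distortion. Pulling all densities back to the base, they have a common part of mass \<open>\<kappa>\<close>, which
  cancels because the coefficients have sum \<open>0\<close>.\<close>

section \<open>Functions commuting with integer translations up to a degree\<close>

text \<open>Ramps have degree 1 and do not descend to the circle; only combinations with coefficient
  sum 0 do. Hence the work is done on lifts, with the degree carried along with the variation.
  Replacing a ramp T by T \<circ> F^i costs nothing in the limit, since averages of u - u \<circ> w
  telescope up to the boundary of the box. This allows each tile of a partition to be moved back to
  the base by its own iterate, however many iterates the given u requires. The obstacle is to keep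
  the common mass \<kappa> independent of the mesh. The common part lives on one side of the base,
  so the other side must not be much longer: Denjoy's inequality bounds the logarithmic derivative
  at a closest return time by 6 V, where V = var(ln Df), and leads to \<kappa> = exp(-V) / (1 +
  exp(6 V)). The same inequality makes the tiles small. The approximation by ramps is where absolute
  continuity is indispensable: the closure of the piecewise linear functions in variation consists
  of absolutely continuous functions.\<close>

definition deg :: "real \<Rightarrow> (real \<Rightarrow> real) \<Rightarrow> bool" where
  "deg d u \<longleftrightarrow> (\<forall>t. u (t + 1) = u t + d)"

lemma degD: "deg d u \<Longrightarrow> u (t + 1) = u t + d"
  by (simp add: deg_def)

lemma deg_int:
  assumes "deg d u"
  shows "u (t + of_int m) = u t + of_int m * d"
proof -
  have nat: "u (s + real n) = u s + real n * d" for s n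
  proof (induction n)
    case (Suc n)
    have "u (s + real (Suc n)) = u ((s + real n) + 1)" by (simp add: algebra_simps)
    also have "\<dots> = u (s + real n) + d" using assms by (simp only: deg_def)
    finally show ?case using Suc by (simp add: algebra_simps)
  qed simp
  show ?thesis
  proof (cases m)
    case (nonneg n)
    then show ?thesis using nat[of t n] by simp
  next
    case (neg n)
    have "u ((t - real (Suc n)) + real (Suc n)) = u (t - real (Suc n)) + real (Suc n) * d" by (rule nat)
    then have "u t = u (t - real (Suc n)) + real (Suc n) * d" by simp
    moreover have "of_int m = - real (Suc n)" using neg by simp
    ultimately show ?thesis by (simp only: add_uminus_conv_diff)
  qed
qed

lemma deg_frac:
  assumes "deg d u"
  shows "u t = u (frac t) + of_int \<lfloor>t\<rfloor> * d"
  using deg_int[OF assms, of "frac t" "\<lfloor>t\<rfloor>"] by (simp add: frac_def)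

lemma periodic_attains_min:
  assumes "deg 0 u" "continuous_on UNIV u"
  obtains t0 where "0 \<le> t0" "\<And>t. u t0 \<le> u t"
proof -
  obtain t0 where t0: "t0 \<in> {0..1}" "\<And>t. t \<in> {0..1} \<Longrightarrow> u t0 \<le> u t"
    using continuous_attains_inf[OF compact_Icc _ continuous_on_subset[OF assms(2)], of 0 1] by auto
  have "u t0 \<le> u t" for t
    using t0(2)[of "frac t"] deg_frac[OF assms(1), of t] by (simp add: frac_lt_1 less_imp_le)
  then show thesis using that[of t0] t0(1) by simp
qed

text \<open>On [0, 1] both t and F t - F 0 lie in [0, 1], and the displacement F t - t is
  periodic.\<close>

lemma deg_1_displacement:
  assumes "deg 1 F" "mono F"
  shows "\<bar>F t - t - F 0\<bar> \<le> 1"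
proof -
  have fr: "0 \<le> frac t" "frac t \<le> 1" by (simp_all add: frac_lt_1 less_imp_le)
  then have "F 0 \<le> F (frac t)" "F (frac t) \<le> F (0 + 1)" by (auto intro!: monoD[OF assms(2)])
  then show ?thesis
    using fr deg_frac[OF assms(1), of t] degD[OF assms(1), of 0] unfolding frac_def by linarith
qed

lemma deg_add: "deg c u \<Longrightarrow> deg d v \<Longrightarrow> deg (c + d) (\<lambda>t. u t + v t)"
  by (simp add: deg_def)

lemma deg_diff: "deg c u \<Longrightarrow> deg d v \<Longrightarrow> deg (c - d) (\<lambda>t. u t - v t)"
  by (simp add: deg_def)

lemma deg_mult: "deg d u \<Longrightarrow> deg (c * d) (\<lambda>t. c * u t)"
  by (simp add: deg_def algebra_simps)

lemma deg_sum: "(\<And>i. i \<in> I \<Longrightarrow> deg (d i) (u i)) \<Longrightarrow> deg (\<Sum>i\<in>I. d i) (\<lambda>t. \<Sum>i\<in>I. u i t)"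
  by (induction I rule: infinite_finite_induct) (auto simp: deg_def)

lemma deg_compose: "deg d u \<Longrightarrow> deg 1 F \<Longrightarrow> deg d (\<lambda>t. u (F t))"
  by (simp add: deg_def)

lemma deg_funpow: "deg 1 F \<Longrightarrow> deg 1 (F ^^ n)"
  by (induction n) (auto simp: deg_def)

lemma mono_funpow_real:
  fixes F :: "real \<Rightarrow> real"
  shows "mono F \<Longrightarrow> mono (F ^^ n)"
  by (induction n) (auto simp: mono_def)

section \<open>Variation over one period\<close>

definition var_le :: "(real \<Rightarrow> real) \<Rightarrow> real \<Rightarrow> bool" where
  "var_le u C \<longleftrightarrow> (\<forall>(n::nat) t. (\<forall>i<n. t i \<le> t (Suc i)) \<and> t n = t 0 + 1 \<longrightarrow>
     (\<Sum>i<n. \<bar>u (t (Suc i)) - u (t i)\<bar>) \<le> C)"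

lemma var_leD:
  assumes "var_le u C" "\<And>i. i < n \<Longrightarrow> t i \<le> t (Suc i)" "t n = t 0 + 1"
  shows "(\<Sum>i<n. \<bar>u (t (Suc i)) - u (t i)\<bar>) \<le> C"
  using assms unfolding var_le_def by blast

lemma var_le_mono: "var_le u C \<Longrightarrow> C \<le> D \<Longrightarrow> var_le u D"
  unfolding var_le_def by (meson order_trans)

lemma var_le_add:
  assumes "var_le u C" "var_le v D"
  shows "var_le (\<lambda>t. u t + v t) (C + D)"
  unfolding var_le_def
proof (intro allI impI)
  fix n and t :: "nat \<Rightarrow> real"
  assume t: "(\<forall>i<n. t i \<le> t (Suc i)) \<and> t n = t 0 + 1"
  have "(\<Sum>i<n. \<bar>u (t (Suc i)) + v (t (Suc i)) - (u (t i) + v (t i))\<bar>)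
      \<le> (\<Sum>i<n. \<bar>u (t (Suc i)) - u (t i)\<bar> + \<bar>v (t (Suc i)) - v (t i)\<bar>)"
    by (intro sum_mono) linarith
  also have "\<dots> \<le> C + D"
    unfolding sum.distrib using assms t by (intro add_mono var_leD) auto
  finally show "(\<Sum>i<n. \<bar>u (t (Suc i)) + v (t (Suc i)) - (u (t i) + v (t i))\<bar>) \<le> C + D" .
qed

lemma var_le_cmult:
  assumes "var_le u C"
  shows "var_le (\<lambda>t. c * u t) (\<bar>c\<bar> * C)"
  unfolding var_le_def
proof (intro allI impI)
  fix n and t :: "nat \<Rightarrow> real"
  assume t: "(\<forall>i<n. t i \<le> t (Suc i)) \<and> t n = t 0 + 1"
  have "(\<Sum>i<n. \<bar>c * u (t (Suc i)) - c * u (t i)\<bar>) = \<bar>c\<bar> * (\<Sum>i<n. \<bar>u (t (Suc i)) - u (t i)\<bar>)"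
    unfolding sum_distrib_left by (intro sum.cong) (auto simp: abs_mult right_diff_distrib[symmetric])
  also have "\<dots> \<le> \<bar>c\<bar> * C"
    using assms t by (intro mult_left_mono var_leD) auto
  finally show "(\<Sum>i<n. \<bar>c * u (t (Suc i)) - c * u (t i)\<bar>) \<le> \<bar>c\<bar> * C" .
qed

lemma var_le_diff_cong:
  assumes "var_le u C" "\<And>s t. v t - v s = u t - u s"
  shows "var_le v C"
  using assms unfolding var_le_def by simp

lemma var_le_diff:
  assumes "var_le u C" "var_le v D"
  shows "var_le (\<lambda>t. u t - v t) (C + D)"
  using var_le_add[OF assms(1) var_le_cmult[OF assms(2), of "-1"]] by simp

lemma var_le_const: "var_le (\<lambda>t. c) 0"
  by (simp add: var_le_def)

lemma var_le_sum:
  "(\<And>i. i \<in> I \<Longrightarrow> var_le (u i) (C i)) \<Longrightarrow> var_le (\<lambda>t. \<Sum>i\<in>I. u i t) (\<Sum>i\<in>I. C i)"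
  by (induction I rule: infinite_finite_induct) (auto simp: var_le_const var_le_add)

text \<open>F maps a subdivision of one period to a subdivision of one period. Its starting point
  moves, which is why \<open>var_le\<close> admits any \<open>t 0\<close>.\<close>

lemma var_le_compose:
  assumes "var_le u C" "mono F" "deg 1 F"
  shows "var_le (\<lambda>t. u (F t)) C"
  unfolding var_le_def
proof (intro allI impI)
  fix n and t :: "nat \<Rightarrow> real"
  assume t: "(\<forall>i<n. t i \<le> t (Suc i)) \<and> t n = t 0 + 1"
  show "(\<Sum>i<n. \<bar>u (F (t (Suc i))) - u (F (t i))\<bar>) \<le> C"
    using assms t by (intro var_leD[of u C n "\<lambda>i. F (t i)"]) (auto simp: mono_def deg_def)
qed

text \<open>The increments of v telescope over a period to its degree.\<close>

lemma var_le_majorant: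
  assumes "\<And>x y. x \<le> y \<Longrightarrow> \<bar>u y - u x\<bar> \<le> v y - v x" "deg d v"
  shows "var_le u d"
  unfolding var_le_def
proof (intro allI impI)
  fix n and t :: "nat \<Rightarrow> real"
  assume t: "(\<forall>i<n. t i \<le> t (Suc i)) \<and> t n = t 0 + 1"
  have "(\<Sum>i<n. \<bar>u (t (Suc i)) - u (t i)\<bar>) \<le> (\<Sum>i<n. v (t (Suc i)) - v (t i))"
    using assms(1) t by (intro sum_mono) auto
  also have "\<dots> = v (t n) - v (t 0)" by (rule sum_lessThan_telescope)
  also have "\<dots> = d" using t assms(2) by (simp add: deg_def)
  finally show "(\<Sum>i<n. \<bar>u (t (Suc i)) - u (t i)\<bar>) \<le> d" .
qed

lemma var_le_monotone: "mono u \<Longrightarrow> deg d u \<Longrightarrow> var_le u d"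
  by (rule var_le_majorant[of u u]) (auto simp: mono_def)

lemma var_le_nonneg: "var_le u C \<Longrightarrow> 0 \<le> C"
  using var_leD[of u C 1 "\<lambda>i. real i"]
  by (smt (verit) abs_ge_zero lessThan_Suc_atMost of_nat_0 of_nat_1 of_nat_mono sum_nonneg lessThan_iff
      less_one le_add2 plus_1_eq_Suc)

text \<open>The period starting at x is subdivided at the integer translate of y that it
  contains.\<close>

lemma var_le_osc:
  assumes "var_le u C" "deg 0 u"
  shows "\<bar>u y - u x\<bar> \<le> C"
proof -
  define z where "z = y - of_int \<lfloor>y - x\<rfloor>"
  have z: "x \<le> z" "z \<le> x + 1" unfolding z_def by linarith+
  have "u z = u y" using deg_int[OF assms(2), of z "\<lfloor>y - x\<rfloor>"] by (simp add: z_def)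
  moreover have "(\<Sum>i<2. \<bar>u ((\<lambda>i. if i = 0 then x else if i = 1 then z else x + 1) (Suc i)) -
      u ((\<lambda>i::nat. if i = 0 then x else if i = 1 then z else x + 1) i)\<bar>) \<le> C"
    using z by (intro var_leD[OF assms(1)]) (auto simp: less_2_cases_iff)
  ultimately show ?thesis by (simp add: numeral_2_eq_2)
qed

text \<open>Translation by 1 adds d = u (a + 1) - u a, which is nonnegative by the two pieces; so
  monotonicity spreads from one period to the line. All monotonicity claims about ramps reduce to
  this.\<close>

lemma mono_of_pieces:
  assumes d: "deg d u" and l: "a \<le> b" "b \<le> a + 1"
    and 1: "\<And>x y. a \<le> x \<Longrightarrow> x \<le> y \<Longrightarrow> y \<le> b \<Longrightarrow> u x \<le> u y"
    and 2: "\<And>x y. b \<le> x \<Longrightarrow> x \<le> y \<Longrightarrow> y \<le> a + 1 \<Longrightarrow> u x \<le> u y"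
  shows "mono u"
proof
  have 3: "u x \<le> u y" if "a \<le> x" "x \<le> y" "y \<le> a + 1" for x y
  proof -
    consider "y \<le> b" | "b \<le> x" | "x \<le> b" "b \<le> y" by linarith
    then show ?thesis
    proof cases
      case 3
      then have "u x \<le> u b" "u b \<le> u y" using 1 2 that by auto
      then show ?thesis by simp
    qed (use 1 2 that in auto)
  qed
  have d0: "0 \<le> d" using 3[of a "a + 1"] d by (simp add: deg_def)
  fix x y :: real assume xy: "x \<le> y"
  define m n where "m = \<lfloor>x - a\<rfloor>" and "n = \<lfloor>y - a\<rfloor>"
  have mn: "m \<le> n" using xy by (auto simp: m_def n_def intro: floor_mono)
  have ux: "u x = u (x - of_int m) + of_int m * d" "u y = u (y - of_int n) + of_int n * d"
    using deg_int[OF d, of "x - of_int m" m] deg_int[OF d, of "y - of_int n" n] by simp_all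
  have b: "a \<le> x - of_int m" "x - of_int m \<le> a + 1" "a \<le> y - of_int n" "y - of_int n \<le> a + 1"
    unfolding m_def n_def by linarith+
  show "u x \<le> u y"
  proof (cases "m = n")
    case True
    then show ?thesis using ux 3[of "x - of_int m" "y - of_int n"] b xy by simp
  next
    case False
    then have "of_int m * d + d \<le> of_int n * d"
      using mn d0 mult_right_mono[of "of_int m + 1" "of_int n :: real" d] by (simp add: algebra_simps)
    moreover have "u (x - of_int m) \<le> u a + d" using 3[of "x - of_int m" "a + 1"] b d by (simp add: deg_def)
    moreover have "u a \<le> u (y - of_int n)" using 3[of a "y - of_int n"] b by simp
    ultimately show ?thesis using ux by linarith
  qed
qed

section \<open>Ramps\<close>

definition ramp :: "real \<Rightarrow> real \<Rightarrow> real \<Rightarrow> real" where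
  "ramp l w t = of_int \<lfloor>t - l\<rfloor> + min 1 (frac (t - l) / w)"

lemma deg_ramp: "deg 1 (ramp l w)"
proof -
  have "t + 1 - l = (t - l) + 1" for t by simp
  then have "ramp l w (t + 1) = ramp l w t + 1" for t by (simp only: ramp_def frac_1_eq) simp
  then show ?thesis by (simp add: deg_def)
qed

lemma ramp_inside:
  assumes "0 < w" "w \<le> 1" "l \<le> t" "t \<le> l + w"
  shows "ramp l w t = (t - l) / w"
proof (cases "t = l + 1")
  case True
  then show ?thesis using assms by (simp add: ramp_def)
next
  case False
  then have f: "\<lfloor>t - l\<rfloor> = 0" using assms by (simp add: floor_eq_iff)
  then show ?thesis using assms by (simp add: ramp_def frac_def)
qed

lemma ramp_outside:
  assumes "0 < w" "w \<le> 1" "l + w \<le> t" "t \<le> l + 1"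
  shows "ramp l w t = 1"
proof (cases "t = l + 1")
  case True
  then show ?thesis using assms by (simp add: ramp_def)
next
  case False
  then have f: "\<lfloor>t - l\<rfloor> = 0" using assms by (simp add: floor_eq_iff)
  then show ?thesis using assms by (simp add: ramp_def frac_def)
qed

lemma mono_ramp:
  assumes "0 < w" "w \<le> 1"
  shows "mono (ramp l w)"
  using assms
  by (intro mono_of_pieces[OF deg_ramp, of l "l + w"])
     (auto simp: ramp_inside ramp_outside divide_right_mono)

text \<open>The density of a ramp is at most 1 / w: the function t / w - ramp is constant on the
  sloping piece and has slope 1 / w on the flat one.\<close>

lemma ramp_le_slope:
  assumes "0 < w" "w \<le> 1" "x \<le> y"
  shows "ramp l w y - ramp l w x \<le> (y - x) / w"
proof -
  have "mono (\<lambda>t. t / w - ramp l w t)"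
  proof (rule mono_of_pieces[of "1 / w - 1" _ l "l + w"])
    show "deg (1 / w - 1) (\<lambda>t. t / w - ramp l w t)"
      using deg_ramp by (simp add: deg_def add_divide_distrib)
  qed (use assms in \<open>auto simp: ramp_inside ramp_outside divide_right_mono diff_divide_distrib\<close>)
  from monoD[OF this assms(3)] show ?thesis by (simp add: diff_divide_distrib)
qed

lemma ramp_frac:
  assumes "0 < w" "0 \<le> l" "l + w \<le> 1"
  shows "ramp l w t = of_int \<lfloor>t\<rfloor> + max 0 (min 1 ((frac t - l) / w))"
proof -
  define s where "s = frac t"
  have s: "0 \<le> s" "s < 1" by (simp_all add: s_def frac_lt_1)
  have t: "t = s + of_int \<lfloor>t\<rfloor>" by (simp add: s_def frac_def)
  have "ramp l w t = ramp l w s + of_int \<lfloor>t\<rfloor>"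
    using deg_int[OF deg_ramp, of l w s "\<lfloor>t\<rfloor>"] t by simp
  moreover have "ramp l w s = max 0 (min 1 ((s - l) / w))"
  proof -
    consider "s < l" | "l \<le> s" "s \<le> l + w" | "l + w \<le> s" by linarith
    then show ?thesis
    proof cases
      case 1
      \<comment> \<open>Left of l the point belongs to the flat piece of the preceding period, so it
        is evaluated one period later.\<close>
      have "ramp l w (s + 1) = 1" using assms 1 s by (intro ramp_outside) auto
      then have "ramp l w s = 0" using deg_ramp[of l w] by (simp add: deg_def)
      then show ?thesis using 1 assms divide_nonpos_pos[of "s - l" w] by (simp add: max_def min_def)
    next
      case 2
      then show ?thesis using assms by (simp add: ramp_inside)
    next
      case 3
      then show ?thesis using assms s by (simp add: ramp_outside)
    qed
  qed
  ultimately show ?thesis by (simp add: s_def)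
qed

lemma continuous_ramp:
  assumes "0 < w" "w \<le> 1"
  shows "continuous_on UNIV (ramp l w)"
proof (rule continuous_onI)
  fix x e :: real assume "0 < e"
  show "\<exists>d>0. \<forall>x'\<in>UNIV. dist x' x < d \<longrightarrow> dist (ramp l w x') (ramp l w x) \<le> e"
  proof (intro exI[of _ "e * w"] conjI ballI impI)
    show "0 < e * w" using \<open>0 < e\<close> assms by simp
    fix y :: real assume y: "dist y x < e * w"
    have "\<bar>ramp l w y - ramp l w x\<bar> \<le> \<bar>y - x\<bar> / w"
    proof (cases "x \<le> y")
      case True
      then show ?thesis using ramp_le_slope[OF assms True, of l] monoD[OF mono_ramp[OF assms, of l] True] by simp
    next
      case False
      then have "y \<le> x" by simp
      then show ?thesis using ramp_le_slope[OF assms \<open>y \<le> x\<close>, of l] monoD[OF mono_ramp[OF assms, of l] \<open>y \<le> x\<close>] by simp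
    qed
    also have "\<dots> \<le> e" using y assms by (simp add: dist_real_def divide_le_eq)
    finally show "dist (ramp l w y) (ramp l w x) \<le> e" by (simp add: dist_real_def)
  qed
qed

section \<open>Absolutely continuous functions\<close>

definition ac :: "(real \<Rightarrow> real) \<Rightarrow> bool" where
  "ac u \<longleftrightarrow> (\<forall>a b. abs_cont_interval a b u)"

definition subintervals :: "real \<Rightarrow> real \<Rightarrow> nat \<Rightarrow> (nat \<Rightarrow> real) \<Rightarrow> (nat \<Rightarrow> real) \<Rightarrow> bool" where
  "subintervals a b n x y \<longleftrightarrow> (\<forall>i<n. a \<le> x i \<and> x i \<le> y i \<and> y i \<le> b) \<and>
     (\<forall>i<n. \<forall>j<n. i \<noteq> j \<longrightarrow> {x i<..<y i} \<inter> {x j<..<y j} = {})"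

lemma ac_iff:
  "ac u \<longleftrightarrow> (\<forall>a b e. 0 < e \<longrightarrow> (\<exists>d>0. \<forall>n x y. subintervals a b n x y \<longrightarrow> (\<Sum>i<n. y i - x i) < d \<longrightarrow>
     (\<Sum>i<n. \<bar>u (y i) - u (x i)\<bar>) < e))"
  by (simp add: ac_def abs_cont_interval_def subintervals_def conj_assoc imp_conjL)

lemma acD:
  assumes "ac u" "0 < e"
  obtains d where "0 < d" "\<And>n x y. subintervals a b n x y \<Longrightarrow> (\<Sum>i<n. y i - x i) < d \<Longrightarrow>
     (\<Sum>i<n. \<bar>u (y i) - u (x i)\<bar>) < e"
proof -
  have "\<exists>d>0. \<forall>n x y. subintervals a b n x y \<longrightarrow> (\<Sum>i<n. y i - x i) < d \<longrightarrow>
     (\<Sum>i<n. \<bar>u (y i) - u (x i)\<bar>) < e"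
    using assms unfolding ac_iff by simp
  then show thesis using that by blast
qed

lemma acI:
  assumes "\<And>a b e. 0 < e \<Longrightarrow> \<exists>d>0. \<forall>n x y. subintervals a b n x y \<longrightarrow> (\<Sum>i<n. y i - x i) < d \<longrightarrow>
     (\<Sum>i<n. \<bar>u (y i) - u (x i)\<bar>) < e"
  shows "ac u"
  using assms unfolding ac_iff by simp

lemma ac_isCont:
  assumes "ac u"
  shows "isCont u x"
proof (rule continuous_at_eps_delta[THEN iffD2], intro allI impI)
  fix e :: real assume "0 < e"
  obtain d where d: "0 < d"
    "\<And>n p q. subintervals (x - 1) (x + 1) n p q \<Longrightarrow> (\<Sum>i<n. q i - p i) < d \<Longrightarrow> (\<Sum>i<n. \<bar>u (q i) - u (p i)\<bar>) < e"
    using acD[OF assms \<open>0 < e\<close>, of "x - 1" "x + 1"] by metis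
  show "\<exists>d>0. \<forall>x'. dist x' x < d \<longrightarrow> dist (u x') (u x) < e"
  proof (intro exI[of _ "min d 1"] conjI allI impI)
    show "0 < min d 1" using d by simp
    fix y assume y: "dist y x < min d 1"
    have "x - 1 \<le> min x y" "min x y \<le> max x y" "max x y \<le> x + 1" "max x y - min x y < d"
      using y unfolding dist_real_def by linarith+
    then have "subintervals (x - 1) (x + 1) (Suc 0) (\<lambda>_. min x y) (\<lambda>_. max x y)"
      unfolding subintervals_def by simp
    then have "(\<Sum>i<Suc 0. \<bar>u (max x y) - u (min x y)\<bar>) < e"
      using \<open>max x y - min x y < d\<close> by (intro d(2)) simp_all
    then show "dist (u y) (u x) < e"
      by (auto simp: dist_real_def max_def min_def split: if_splits)
  qed
qed

lemma ac_add:
  assumes "ac u" "ac v"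
  shows "ac (\<lambda>t. u t + v t)"
proof (rule acI)
  fix a b e :: real assume "0 < e"
  then have e: "0 < e / 2" by simp
  obtain d1 where d1: "0 < d1"
    "\<And>n x y. subintervals (a) (b) n x y \<Longrightarrow> (\<Sum>i<n. y i - x i) < d1 \<Longrightarrow> (\<Sum>i<n. \<bar>u (y i) - u (x i)\<bar>) < e / 2"
    using acD[OF assms(1) e, of a b] by metis
  obtain d2 where d2: "0 < d2"
    "\<And>n x y. subintervals (a) (b) n x y \<Longrightarrow> (\<Sum>i<n. y i - x i) < d2 \<Longrightarrow> (\<Sum>i<n. \<bar>v (y i) - v (x i)\<bar>) < e / 2"
    using acD[OF assms(2) e, of a b] by metis
  show "\<exists>d>0. \<forall>n x y. subintervals a b n x y \<longrightarrow>
      (\<Sum>i<n. y i - x i) < d \<longrightarrow> (\<Sum>i<n. \<bar>u (y i) + v (y i) - (u (x i) + v (x i))\<bar>) < e"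
  proof (intro exI[of _ "min d1 d2"] conjI allI impI)
    show "0 < min d1 d2" using d1 d2 by simp
    fix n and x y :: "nat \<Rightarrow> real"
    assume *: "subintervals a b n x y" "(\<Sum>i<n. y i - x i) < min d1 d2"
    have "(\<Sum>i<n. \<bar>u (y i) + v (y i) - (u (x i) + v (x i))\<bar>)
        \<le> (\<Sum>i<n. \<bar>u (y i) - u (x i)\<bar> + \<bar>v (y i) - v (x i)\<bar>)"
      by (intro sum_mono) linarith
    also have "\<dots> < e / 2 + e / 2"
      unfolding sum.distrib using * by (intro add_strict_mono d1(2) d2(2)) auto
    finally show "(\<Sum>i<n. \<bar>u (y i) + v (y i) - (u (x i) + v (x i))\<bar>) < e" by simp
  qed
qed

text \<open>The Lipschitz bound is asked only on a set S containing the range, with a view to the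
  logarithm of a function bounded away from 0.\<close>

lemma ac_lipschitz_compose:
  assumes "ac u" and L: "0 < L" "\<And>s t. \<lbrakk>s \<in> S; t \<in> S\<rbrakk> \<Longrightarrow> \<bar>\<psi> s - \<psi> t\<bar> \<le> L * \<bar>s - t\<bar>"
    and S: "\<And>t. u t \<in> S"
  shows "ac (\<lambda>t. \<psi> (u t))"
proof (rule acI)
  fix a b e :: real assume "0 < e"
  then have e: "0 < e / L" using L by simp
  obtain d where d: "0 < d"
    "\<And>n x y. subintervals (a) (b) n x y \<Longrightarrow> (\<Sum>i<n. y i - x i) < d \<Longrightarrow> (\<Sum>i<n. \<bar>u (y i) - u (x i)\<bar>) < e / L"
    using acD[OF assms(1) e, of a b] by metis
  show "\<exists>d>0. \<forall>n x y. subintervals a b n x y \<longrightarrow>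
      (\<Sum>i<n. y i - x i) < d \<longrightarrow> (\<Sum>i<n. \<bar>\<psi> (u (y i)) - \<psi> (u (x i))\<bar>) < e"
  proof (intro exI[of _ d] conjI allI impI)
    show "0 < d" by fact
    fix n and x y :: "nat \<Rightarrow> real"
    assume *: "subintervals a b n x y" "(\<Sum>i<n. y i - x i) < d"
    have "(\<Sum>i<n. \<bar>\<psi> (u (y i)) - \<psi> (u (x i))\<bar>) \<le> L * (\<Sum>i<n. \<bar>u (y i) - u (x i)\<bar>)"
      unfolding sum_distrib_left by (intro sum_mono L(2) S)
    also have "\<dots> < L * (e / L)"
      using * L(1) by (intro mult_strict_left_mono d(2)) auto
    finally show "(\<Sum>i<n. \<bar>\<psi> (u (y i)) - \<psi> (u (x i))\<bar>) < e" using L(1) by simp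
  qed
qed

lemma ac_cmult:
  assumes "ac u"
  shows "ac (\<lambda>t. c * u t)"
  by (rule ac_lipschitz_compose[OF assms, of "\<bar>c\<bar> + 1" UNIV])
     (auto simp: abs_mult right_diff_distrib[symmetric] distrib_right)

lemma ac_const: "ac (\<lambda>t. c)"
  by (rule acI) (auto intro: exI[of _ 1])

lemma ac_sum:
  "(\<And>i. i \<in> I \<Longrightarrow> ac (u i)) \<Longrightarrow> ac (\<lambda>t. \<Sum>i\<in>I. u i t)"
  by (induction I rule: infinite_finite_induct) (auto simp: ac_const ac_add)

text \<open>An increasing W keeps disjoint intervals disjoint, and the local Lipschitz bound
  controls their total length. Without monotonicity the composition could fail to be absolutely
  continuous.\<close>

lemma ac_compose:
  assumes "ac u" and W: "strict_mono W" "continuous_on UNIV W"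
    and L: "\<And>a b::real. \<exists>L>0. \<forall>s\<in>{a..b}. \<forall>t\<in>{a..b}. \<bar>W s - W t\<bar> \<le> L * \<bar>s - t\<bar>"
  shows "ac (\<lambda>t. u (W t))"
proof (rule acI)
  fix a b e :: real assume "0 < e"
  obtain L where L: "0 < L" "\<And>s t. \<lbrakk>s \<in> {a..b}; t \<in> {a..b}\<rbrakk> \<Longrightarrow> \<bar>W s - W t\<bar> \<le> L * \<bar>s - t\<bar>"
    using L[of a b] by blast
  obtain d where d: "0 < d"
    "\<And>n x y. subintervals (W a) (W b) n x y \<Longrightarrow> (\<Sum>i<n. y i - x i) < d \<Longrightarrow> (\<Sum>i<n. \<bar>u (y i) - u (x i)\<bar>) < e"
    using acD[OF assms(1) \<open>0 < e\<close>, of "W a" "W b"] by metis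
  have mono: "mono W" using W(1) by (rule strict_mono_mono)
  have Wle: "W s \<le> W t \<longleftrightarrow> s \<le> t" "W s < W t \<longleftrightarrow> s < t" for s t
    using W(1) by (simp_all add: strict_mono_less_eq strict_mono_less)
  show "\<exists>d>0. \<forall>n x y. subintervals a b n x y \<longrightarrow>
      (\<Sum>i<n. y i - x i) < d \<longrightarrow> (\<Sum>i<n. \<bar>u (W (y i)) - u (W (x i))\<bar>) < e"
  proof (intro exI[of _ "d / L"] conjI allI impI)
    show "0 < d / L" using d L by simp
    fix n and x y :: "nat \<Rightarrow> real"
    assume *: "subintervals a b n x y" "(\<Sum>i<n. y i - x i) < d / L"
    have disj: "{W (x i)<..<W (y i)} \<inter> {W (x j)<..<W (y j)} = {}" if ij: "i < n" "j < n" "i \<noteq> j" for i j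
      proof (rule ccontr)
        assume "\<not> ?thesis"
        then have "W (x i) < W (y i)" "W (x i) < W (y j)" "W (x j) < W (y i)" "W (x j) < W (y j)"
          by (auto simp: disjoint_iff intro: less_trans)
        then have "max (x i) (x j) < min (y i) (y j)" by (simp only: Wle max_less_iff_conj min_less_iff_conj)
        then obtain z where "max (x i) (x j) < z" "z < min (y i) (y j)" using dense by blast
        then have "z \<in> {x i<..<y i} \<inter> {x j<..<y j}" by auto
        then show False using *(1) ij unfolding subintervals_def by blast
      qed
    show "(\<Sum>i<n. \<bar>u (W (y i)) - u (W (x i))\<bar>) < e"
    proof (rule d(2)[of n "\<lambda>i. W (x i)" "\<lambda>i. W (y i)"])
      show "subintervals (W a) (W b) n (\<lambda>i. W (x i)) (\<lambda>i. W (y i))"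
        using disj *(1) Wle unfolding subintervals_def by blast
      have "(\<Sum>i<n. W (y i) - W (x i)) \<le> (\<Sum>i<n. L * (y i - x i))"
      proof (rule sum_mono)
        fix i assume "i \<in> {..<n}"
        then show "W (y i) - W (x i) \<le> L * (y i - x i)"
          using L(2)[of "y i" "x i"] *(1) unfolding subintervals_def by force
      qed
      also have "\<dots> = L * (\<Sum>i<n. y i - x i)" by (simp add: sum_distrib_left)
      also have "\<dots> < L * (d / L)" using *(2) L(1) by (intro mult_strict_left_mono) auto
      finally show "(\<Sum>i<n. W (y i) - W (x i)) < d" using L(1) by simp
    qed
  qed
qed

lemma ac_uniform_subsum:
  assumes "ac u" "0 < e"
  obtains d where "0 < d"
    "\<And>N S. \<lbrakk>0 < N; S \<subseteq> {..<N}; real (card S) / real N < d\<rbrakk>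
      \<Longrightarrow> (\<Sum>j\<in>S. \<bar>u (real (Suc j) / real N) - u (real j / real N)\<bar>) < e"
proof -
  obtain d where d: "0 < d"
    "\<And>n x y. subintervals (0) (1) n x y \<Longrightarrow> (\<Sum>i<n. y i - x i) < d \<Longrightarrow> (\<Sum>i<n. \<bar>u (y i) - u (x i)\<bar>) < e"
    using acD[OF assms, of 0 1] by metis
  show thesis
  proof (rule that[OF d(1)])
    fix N S assume NS: "0 < N" "S \<subseteq> {..<N}" "real (card S) / real N < d"
    \<comment> \<open>Cells outside S are degenerated to points, so that the family remains indexed
      by all j < N.\<close>
    define x y where "x = (\<lambda>j. real j / real N)" and "y = (\<lambda>j. if j \<in> S then real (Suc j) / real N else real j / real N)"
    have "(\<Sum>j<N. \<bar>u (y j) - u (x j)\<bar>) < e"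
    proof (rule d(2))
      have 1: "0 \<le> x i \<and> x i \<le> y i \<and> y i \<le> 1" if "i < N" for i
        using that by (auto simp: x_def y_def field_simps)
      have 2: "{x i<..<y i} \<inter> {x j<..<y j} = {}" if ij: "i < N" "j < N" "i \<noteq> j" for i j
      proof -
      have "{real i / real N<..<real (Suc i) / real N} \<inter> {real j / real N<..<real (Suc j) / real N} = {}"
      proof -
        have "Suc i \<le> j \<or> Suc j \<le> i" using ij by linarith
        then have "real (Suc i) / real N \<le> real j / real N \<or> real (Suc j) / real N \<le> real i / real N"
          using NS(1) by (metis divide_right_mono of_nat_0_le_iff of_nat_mono)
        then show ?thesis by auto
      qed
        then show ?thesis by (auto simp: x_def y_def)
      qed
      show "subintervals 0 1 N x y" using 1 2 by (auto simp: subintervals_def)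
      have "(\<Sum>j<N. y j - x j) = (\<Sum>j\<in>S. 1 / real N)"
        using NS by (intro sum.mono_neutral_cong_right) (auto simp: x_def y_def diff_divide_distrib[symmetric])
      then show "(\<Sum>j<N. y j - x j) < d" using NS by simp
    qed
    moreover have "(\<Sum>j<N. \<bar>u (y j) - u (x j)\<bar>) = (\<Sum>j\<in>S. \<bar>u (real (Suc j) / real N) - u (real j / real N)\<bar>)"
      using NS by (intro sum.mono_neutral_cong_right) (auto simp: x_def y_def)
    ultimately show "(\<Sum>j\<in>S. \<bar>u (real (Suc j) / real N) - u (real j / real N)\<bar>) < e" by simp
  qed
qed

section \<open>Approximation by piecewise linear functions in variation\<close>

lemma sum_lessThan_mult:
  fixes f :: "nat \<Rightarrow> 'a::comm_monoid_add"
  shows "(\<Sum>k<N * M. f k) = (\<Sum>j<N. \<Sum>i<M. f (j * M + i))"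
proof (induction N)
  case (Suc N)
  have split: "(\<Sum>k<a + b. f k) = (\<Sum>k<a. f k) + (\<Sum>i<b. f (a + i))" for a b
    by (induction b) (auto simp: add.assoc)
  show ?case using split[of "N * M" M] Suc by (simp add: add.commute)
qed simp

text \<open>The i-th summand is the length of the part of [0, y] inside [i, i + 1].\<close>

lemma sum_clamp:
  fixes y :: real
  shows "(\<Sum>i<M. max 0 (min 1 (y - real i))) = max 0 (min (real M) y)"
proof (induction M)
  case (Suc M)
  consider "y \<le> real M" | "real M \<le> y" "y \<le> real M + 1" | "real M + 1 \<le> y" by linarith
  then show ?case by cases (use Suc in auto)
qed simp

section \<open>Piecewise linear interpolation on uniform grids\<close>

definition grid_ramp :: "nat \<Rightarrow> nat \<Rightarrow> real \<Rightarrow> real" where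
  "grid_ramp N j = ramp (real j / real N) (1 / real N)"

lemma grid_ramp_eq:
  assumes "j < N"
  shows "grid_ramp N j t = of_int \<lfloor>t\<rfloor> + max 0 (min 1 (real N * frac t - real j))"
proof -
  have N: "0 < real N" "real j + 1 \<le> real N" using assms by linarith+
  then have "grid_ramp N j t = of_int \<lfloor>t\<rfloor> + max 0 (min 1 ((frac t - real j / real N) / (1 / real N)))"
    unfolding grid_ramp_def by (intro ramp_frac) (auto simp: add_divide_distrib[symmetric])
  also have "(frac t - real j / real N) / (1 / real N) = real N * frac t - real j"
    using N by (simp add: field_simps)
  finally show ?thesis .
qed

lemma deg_grid_ramp: "deg 1 (grid_ramp N j)"
  unfolding grid_ramp_def by (rule deg_ramp)

lemma mono_grid_ramp: "0 < N \<Longrightarrow> mono (grid_ramp N j)"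
  unfolding grid_ramp_def by (intro mono_ramp) (auto simp: divide_le_eq_1 Suc_leI)

text \<open>The uniform density on a cell is the mean of the uniform densities on its M
  subcells.\<close>

lemma grid_ramp_subdivide:
  assumes "j < N" "0 < M"
  shows "real M * grid_ramp N j t = (\<Sum>i<M. grid_ramp (N * M) (j * M + i) t)"
proof -
  define y where "y = real M * (real N * frac t - real j)"
  have fine: "grid_ramp (N * M) (j * M + i) t = of_int \<lfloor>t\<rfloor> + max 0 (min 1 (y - real i))" if "i < M" for i
  proof -
    have "Suc j * M \<le> N * M" using assms by (intro mult_le_mono1) auto
    then have "j * M + i < N * M" using that by simp
    from grid_ramp_eq[OF this, of t] show ?thesis by (simp add: y_def algebra_simps)
  qed
  have "real M * max 0 (min 1 (y / real M)) = max 0 (min (real M) y)"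
    using assms(2) by (simp add: max_def min_def field_simps)
  moreover have "y / real M = real N * frac t - real j" using assms(2) by (simp add: y_def)
  ultimately show ?thesis
    using fine grid_ramp_eq[OF assms(1), of t] sum_clamp[of y M] by (simp add: sum.distrib distrib_left)
qed

definition grid_incr :: "(real \<Rightarrow> real) \<Rightarrow> nat \<Rightarrow> nat \<Rightarrow> real" where
  "grid_incr u N j = u (real (Suc j) / real N) - u (real j / real N)"

text \<open>For periodic u this is the piecewise linear interpolation of u - u 0 at the multiples of
  1 / N; the constant u 0 is invisible to the variation.\<close>

definition interpolant :: "(real \<Rightarrow> real) \<Rightarrow> nat \<Rightarrow> real \<Rightarrow> real" where
  "interpolant u N t = (\<Sum>j<N. grid_incr u N j * grid_ramp N j t)"

lemma sum_grid_incr: "0 < N \<Longrightarrow> deg d u \<Longrightarrow> (\<Sum>j<N. grid_incr u N j) = d"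
  unfolding grid_incr_def
  by (subst sum_lessThan_telescope[of "\<lambda>j. u (real j / real N)"]) (use degD[of d u 0] in simp)

lemma sum_abs_grid_incr:
  assumes "0 < N" "var_le u C"
  shows "(\<Sum>j<N. \<bar>grid_incr u N j\<bar>) \<le> C"
  unfolding grid_incr_def
  by (rule var_leD[OF assms(2), of N "\<lambda>j. real j / real N"]) (use assms(1) in \<open>auto simp: divide_right_mono\<close>)

lemma sum_grid_incr_subdivide:
  assumes "0 < M" "0 < N"
  shows "(\<Sum>i<M. grid_incr u (N * M) (j * M + i)) = grid_incr u N j"
proof -
  have "(\<Sum>i<M. grid_incr u (N * M) (j * M + i))
      = (\<Sum>i<M. u (real (j * M + Suc i) / real (N * M)) - u (real (j * M + i) / real (N * M)))"
    by (simp add: grid_incr_def)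
  also have "\<dots> = u (real (j * M + M) / real (N * M)) - u (real (j * M + 0) / real (N * M))"
    by (rule sum_lessThan_telescope)
  also have "real (j * M + M) / real (N * M) = real (Suc j) / real N"
    using assms by (simp add: field_simps)
  also have "real (j * M + 0) / real (N * M) = real j / real N"
    using assms by simp
  finally show ?thesis by (simp add: grid_incr_def)
qed

text \<open>Both interpolants are expanded in the ramps of the fine grid. Each ramp has variation 1,
  so the sum of the absolute differences of the coefficients is a bound.\<close>

lemma var_interpolant_subdivide:
  assumes "0 < M" "0 < N"
  shows "var_le (\<lambda>t. interpolant u (N * M) t - interpolant u N t)
    (\<Sum>j<N. \<Sum>i<M. \<bar>grid_incr u (N * M) (j * M + i) - grid_incr u N j / real M\<bar>)"
proof -
  let ?r = "grid_ramp (N * M)"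
  let ?c = "\<lambda>j i. grid_incr u (N * M) (j * M + i) - grid_incr u N j / real M"
  have "interpolant u (N * M) t - interpolant u N t = (\<Sum>j<N. \<Sum>i<M. ?c j i * ?r (j * M + i) t)" for t
  proof -
    have "grid_incr u N j * grid_ramp N j t = (\<Sum>i<M. grid_incr u N j / real M * ?r (j * M + i) t)" if "j < N" for j
      unfolding sum_distrib_left[symmetric] grid_ramp_subdivide[OF that assms(1), symmetric]
      using assms by simp
    then show ?thesis
      unfolding interpolant_def sum_lessThan_mult
      by (simp add: sum_subtractf[symmetric] left_diff_distrib)
  qed
  moreover have "var_le (\<lambda>t. \<Sum>j<N. \<Sum>i<M. ?c j i * ?r (j * M + i) t) (\<Sum>j<N. \<Sum>i<M. \<bar>?c j i\<bar> * 1)"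
    using assms by (intro var_le_sum var_le_cmult var_le_monotone deg_grid_ramp mono_grid_ramp) simp
  ultimately show ?thesis by simp
qed

text \<open>The error at t is controlled by the values of u at the end points of the cell around t,
  and continuity at t makes them close to u t.\<close>

lemma isCont_interpolant_limit:
  assumes "isCont u (frac t)" "deg 0 u"
  shows "(\<lambda>n. interpolant u (2 ^ n) t) \<longlonglongrightarrow> u t - u 0"
proof (rule LIMSEQ_I)
  fix e :: real assume "0 < e"
  define x where "x = frac t"
  have x: "0 \<le> x" "x < 1" by (simp_all add: x_def frac_lt_1)
  have ut: "u t = u x" using deg_frac[OF assms(2), of t] by (simp add: x_def)
  obtain d where d: "d > 0" "\<And>y. \<bar>y - x\<bar> < d \<Longrightarrow> \<bar>u y - u x\<bar> < e / 3"
    using assms(1) \<open>0 < e\<close> unfolding x_def[symmetric] continuous_at_eps_delta dist_real_def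
    by (metis zero_less_divide_iff zero_less_numeral)
  obtain n0 where n0: "(1 / 2 :: real) ^ n0 < d" using real_arch_pow_inv[OF d(1), of "1/2"] by auto
  show "\<exists>no. \<forall>n\<ge>no. norm (interpolant u (2 ^ n) t - (u t - u 0)) < e"
  proof (intro exI[of _ n0] allI impI)
    fix n assume "n0 \<le> n"
    define N :: nat where "N = 2 ^ n"
    have N: "0 < N" by (simp add: N_def)
    have "1 / real N = (1/2) ^ n" by (simp add: N_def power_one_over)
    also have "\<dots> \<le> (1 / 2) ^ n0" using \<open>n0 \<le> n\<close> by (intro power_decreasing) auto
    finally have Nd: "1 / real N < d" using n0 by simp
    \<comment> \<open>The cell containing x: grid ramps to its left have already reached 1 and those
      to its right are still 0.\<close>
    define k where "k = nat \<lfloor>real N * x\<rfloor>"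
    have k0: "real k = of_int \<lfloor>real N * x\<rfloor>" using x by (simp add: k_def)
    have k: "real k \<le> real N * x" "real N * x < real k + 1" unfolding k0 by linarith+
    have "real N * x < real N * 1" using x N by (intro mult_strict_left_mono) auto
    then have kN: "k < N" using k by linarith
    have "interpolant u N t = (\<Sum>j<N. grid_incr u N j * of_int \<lfloor>t\<rfloor> + grid_incr u N j * max 0 (min 1 (real N * x - real j)))"
      unfolding interpolant_def by (intro sum.cong) (auto simp: grid_ramp_eq x_def distrib_left)
    also have "\<dots> = (\<Sum>j<N. grid_incr u N j) * of_int \<lfloor>t\<rfloor> + (\<Sum>j<N. grid_incr u N j * max 0 (min 1 (real N * x - real j)))"
      by (simp add: sum.distrib sum_distrib_right)
    also have "(\<Sum>j<N. grid_incr u N j) = 0" using N assms(2) by (rule sum_grid_incr)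
    also have "(\<Sum>j<N. grid_incr u N j * max 0 (min 1 (real N * x - real j)))
        = (\<Sum>j<Suc k. grid_incr u N j * max 0 (min 1 (real N * x - real j)))"
    proof (rule sum.mono_neutral_right)
      show "\<forall>i\<in>{..<N} - {..<Suc k}. grid_incr u N i * max 0 (min 1 (real N * x - real i)) = 0"
      proof
        fix i assume "i \<in> {..<N} - {..<Suc k}"
        then have "real k + 1 \<le> real i" by auto
        then show "grid_incr u N i * max 0 (min 1 (real N * x - real i)) = 0" using k by auto
      qed
    qed (use kN in auto)
    also have "\<dots> = (\<Sum>j<k. grid_incr u N j) + grid_incr u N k * (real N * x - real k)"
    proof -
      have "grid_incr u N j * max 0 (min 1 (real N * x - real j)) = grid_incr u N j" if "j < k" for j
      proof -
        have "real j + 1 \<le> real k" using that by linarith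
        then show ?thesis using k by auto
      qed
      then show ?thesis using k by (auto intro!: sum.cong)
    qed
    also have "(\<Sum>j<k. grid_incr u N j) = u (real k / real N) - u 0"
      unfolding grid_incr_def by (subst sum_lessThan_telescope[of "\<lambda>j. u (real j / real N)"]) simp
    finally have eq: "interpolant u N t - (u t - u 0) =
        (u (real k / real N) - u x) + grid_incr u N k * (real N * x - real k)"
      by (simp add: ut)
    have "\<bar>real k / real N - x\<bar> \<le> 1 / real N" "\<bar>real (Suc k) / real N - x\<bar> \<le> 1 / real N"
    proof -
      have "real k / real N \<le> x" "x \<le> (real k + 1) / real N"
        using k N by (simp_all add: pos_divide_le_eq pos_le_divide_eq mult.commute)
      moreover have "real (Suc k) / real N = real k / real N + 1 / real N"
        by (simp add: add_divide_distrib)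
      ultimately show "\<bar>real k / real N - x\<bar> \<le> 1 / real N" "\<bar>real (Suc k) / real N - x\<bar> \<le> 1 / real N"
        by (auto simp: abs_le_iff add_divide_distrib)
    qed
    then have b: "\<bar>u (real k / real N) - u x\<bar> < e / 3" "\<bar>u (real (Suc k) / real N) - u x\<bar> < e / 3"
      using Nd by (intro d(2); linarith)+
    have "\<bar>grid_incr u N k\<bar> < e / 3 + e / 3" using b unfolding grid_incr_def by linarith
    moreover have "\<bar>grid_incr u N k * (real N * x - real k)\<bar> \<le> \<bar>grid_incr u N k\<bar> * 1"
      unfolding abs_mult using k by (intro mult_left_mono) auto
    ultimately show "norm (interpolant u (2 ^ n) t - (u t - u 0)) < e"
      using b(1) eq unfolding N_def real_norm_def by linarith
  qed
qed

text \<open>The energy below is the sum of the slopes under the Huber function, written with the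
  clamped slope \<open>s\<close> as \<open>2 s x - s\<^sup>2\<close>. It grows under subdivision, by at least the mean square of
  the change of the clamped slopes; absolute continuity controls the part cut off by clamping.\<close>

definition cutoff :: "real \<Rightarrow> real \<Rightarrow> real" where
  "cutoff K x = max (- K) (min K x)"

definition huber :: "real \<Rightarrow> real \<Rightarrow> real" where
  "huber K x = 2 * cutoff K x * x - (cutoff K x)\<^sup>2"

text \<open>The right side minus the left side is 2 (cutoff y - cutoff x) (y - cutoff y). The last
  factor is nonzero only where the cutoff of y takes an extreme value, and then both factors have
  the same sign.\<close>

lemma huber_bregman:
  assumes "0 < K"
  shows "(cutoff K y - cutoff K x)\<^sup>2 \<le> huber K y - huber K x - 2 * cutoff K x * (y - x)"
proof -
  have "0 \<le> (cutoff K y - cutoff K x) * (y - cutoff K y)"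
  proof -
    consider "y < - K" | "- K \<le> y" "y \<le> K" | "K < y" by linarith
    then show ?thesis
    proof cases
      case 1
      then show ?thesis using assms by (intro mult_nonpos_nonpos) (auto simp: cutoff_def)
    next
      case 2
      then show ?thesis by (simp add: cutoff_def)
    next
      case 3
      then show ?thesis using assms by (intro mult_nonneg_nonneg) (auto simp: cutoff_def)
    qed
  qed
  then show ?thesis by (simp add: huber_def power2_eq_square algebra_simps)
qed

text \<open>Linear growth is what keeps the energy bounded for u of bounded variation; the energy
  with plain squares could diverge.\<close>

lemma huber_le:
  assumes "0 < K"
  shows "huber K x \<le> 2 * K * \<bar>x\<bar>"
proof -
  have "cutoff K x * x \<le> \<bar>cutoff K x\<bar> * \<bar>x\<bar>" by (metis abs_ge_self abs_mult)
  also have "\<dots> \<le> K * \<bar>x\<bar>" using assms by (intro mult_right_mono) (auto simp: cutoff_def)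
  finally have "2 * cutoff K x * x \<le> 2 * K * \<bar>x\<bar>" by simp
  then show ?thesis unfolding huber_def using zero_le_power2[of "cutoff K x"] by linarith
qed

definition energy :: "real \<Rightarrow> (real \<Rightarrow> real) \<Rightarrow> nat \<Rightarrow> real" where
  "energy K u N = (\<Sum>j<N. huber K (real N * grid_incr u N j)) / real N"

text \<open>This is \<open>huber_bregman\<close> summed over the subcells. The linear term drops out
  because the fine slopes in a cell have the coarse slope as their mean.\<close>

lemma energy_subdivide:
  assumes "0 < K" "0 < M" "0 < N"
  shows "(\<Sum>j<N. \<Sum>i<M. (cutoff K (real (N * M) * grid_incr u (N * M) (j * M + i)) - cutoff K (real N * grid_incr u N j))\<^sup>2)
     \<le> real (N * M) * (energy K u (N * M) - energy K u N)"
proof -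
  let ?x = "\<lambda>j. real N * grid_incr u N j" and ?y = "\<lambda>j i. real (N * M) * grid_incr u (N * M) (j * M + i)"
  have mean: "(\<Sum>i<M. ?y j i - ?x j) = 0" for j
  proof -
    have "(\<Sum>i<M. ?y j i - ?x j) = real (N * M) * (\<Sum>i<M. grid_incr u (N * M) (j * M + i)) - real M * ?x j"
      by (simp add: sum_subtractf sum_distrib_left)
    then show ?thesis by (simp only: sum_grid_incr_subdivide[OF assms(2,3)] of_nat_mult) simp
  qed
  have "(\<Sum>j<N. \<Sum>i<M. (cutoff K (?y j i) - cutoff K (?x j))\<^sup>2)
     \<le> (\<Sum>j<N. \<Sum>i<M. huber K (?y j i) - huber K (?x j) - 2 * cutoff K (?x j) * (?y j i - ?x j))"
    by (intro sum_mono huber_bregman assms)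
  also have "\<dots> = (\<Sum>j<N. \<Sum>i<M. huber K (?y j i)) - (\<Sum>j<N. real M * huber K (?x j))
     - (\<Sum>j<N. 2 * cutoff K (?x j) * (\<Sum>i<M. ?y j i - ?x j))"
  proof -
    have "(\<Sum>i<M. A i - B - c * D i) = (\<Sum>i<M. A i) - real M * B - c * (\<Sum>i<M. D i)"
      for A D :: "nat \<Rightarrow> real" and B c :: real
      by (simp add: sum_subtractf sum_distrib_left)
    then show ?thesis by (simp only: sum_subtractf)
  qed
  also have "\<dots> = (\<Sum>j<N. \<Sum>i<M. huber K (?y j i)) - (\<Sum>j<N. real M * huber K (?x j))"
    by (simp only: mean mult_zero_right sum.neutral_const diff_0_right)
  also have "\<dots> = real (N * M) * energy K u (N * M) - real (N * M) * energy K u N"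
  proof -
    have "real (N * M) * energy K u (N * M) = (\<Sum>j<N. \<Sum>i<M. huber K (?y j i))"
      using assms by (simp add: energy_def sum_lessThan_mult)
    moreover have "real (N * M) * energy K u N = real M * (\<Sum>j<N. huber K (?x j))"
      using assms by (simp add: energy_def)
    ultimately show ?thesis by (simp only: sum_distrib_left)
  qed
  finally show ?thesis by (simp only: right_diff_distrib)
qed

text \<open>By Chebyshev, at most N C / K cells have a slope beyond K. For large K they are so small
  a proportion that absolute continuity makes the variation over them small, uniformly in N.\<close>

lemma cutoff_excess_small:
  assumes "ac u" "var_le u C" "0 < e"
  obtains K where "0 < K" "\<And>N. 0 < N \<Longrightarrow>
    (\<Sum>j<N. \<bar>real N * grid_incr u N j - cutoff K (real N * grid_incr u N j)\<bar>) \<le> real N * e"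
proof -
  obtain d where d: "0 < d" "\<And>N S. \<lbrakk>0 < N; S \<subseteq> {..<N}; real (card S) / real N < d\<rbrakk>
      \<Longrightarrow> (\<Sum>j\<in>S. \<bar>u (real (Suc j) / real N) - u (real j / real N)\<bar>) < e"
    by (rule ac_uniform_subsum[OF assms(1,3)]) (rule that)
  have C: "0 \<le> C" using assms(2) by (rule var_le_nonneg)
  \<comment> \<open>Chosen so that C / K < d, with K > 0 also for C = 0.\<close>
  define K where "K = (C + 1) / d"
  have K: "0 < K" using C d by (simp add: K_def)
  show thesis
  proof (rule that[OF K])
    fix N :: nat assume N: "0 < N"
    define S where "S = {j\<in>{..<N}. K < \<bar>real N * grid_incr u N j\<bar>}"
    have "real (card S) * K = (\<Sum>j\<in>S. K)" by simp
    also have "\<dots> \<le> (\<Sum>j\<in>S. real N * \<bar>grid_incr u N j\<bar>)"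
      by (intro sum_mono) (auto simp: S_def abs_mult)
    also have "\<dots> \<le> (\<Sum>j<N. real N * \<bar>grid_incr u N j\<bar>)"
      by (intro sum_mono2) (auto simp: S_def)
    also have "\<dots> \<le> real N * C"
      unfolding sum_distrib_left[symmetric] by (intro mult_left_mono sum_abs_grid_incr N assms) auto
    finally have "real (card S) / real N \<le> C / K" using N K by (simp add: field_simps)
    also have "C / K < d" using C d by (simp add: K_def field_simps)
    finally have "(\<Sum>j\<in>S. \<bar>grid_incr u N j\<bar>) < e"
      unfolding grid_incr_def using N by (intro d(2)) (auto simp: S_def)
    then have "(\<Sum>j\<in>S. real N * \<bar>grid_incr u N j\<bar>) \<le> real N * e"
      unfolding sum_distrib_left[symmetric] by (intro mult_left_mono) auto
    moreover have "(\<Sum>j<N. \<bar>real N * grid_incr u N j - cutoff K (real N * grid_incr u N j)\<bar>)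
        = (\<Sum>j\<in>S. \<bar>real N * grid_incr u N j - cutoff K (real N * grid_incr u N j)\<bar>)"
      by (intro sum.mono_neutral_right) (auto simp: S_def cutoff_def)
    moreover have "\<dots> \<le> (\<Sum>j\<in>S. real N * \<bar>grid_incr u N j\<bar>)"
    proof (rule sum_mono)
      fix j
      have "\<bar>z - cutoff K z\<bar> \<le> \<bar>z\<bar>" for z using K by (auto simp: cutoff_def)
      then show "\<bar>real N * grid_incr u N j - cutoff K (real N * grid_incr u N j)\<bar> \<le> real N * \<bar>grid_incr u N j\<bar>"
        by (metis abs_mult abs_of_nat)
    qed
    ultimately show "(\<Sum>j<N. \<bar>real N * grid_incr u N j - cutoff K (real N * grid_incr u N j)\<bar>) \<le> real N * e"
      by linarith
  qed
qed

lemma energy_bounded: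
  assumes "0 < K" "var_le u C" "0 < N"
  shows "energy K u N \<le> 2 * K * C"
proof -
  have "(\<Sum>j<N. huber K (real N * grid_incr u N j)) \<le> (\<Sum>j<N. 2 * K * (real N * \<bar>grid_incr u N j\<bar>))"
  proof (rule sum_mono)
    fix j
    show "huber K (real N * grid_incr u N j) \<le> 2 * K * (real N * \<bar>grid_incr u N j\<bar>)"
      using huber_le[OF assms(1), of "real N * grid_incr u N j"] by (simp add: abs_mult)
  qed
  also have "\<dots> = 2 * K * real N * (\<Sum>j<N. \<bar>grid_incr u N j\<bar>)"
    by (simp add: sum_distrib_left mult.assoc)
  also have "\<dots> \<le> 2 * K * real N * C"
    using assms by (intro mult_left_mono sum_abs_grid_incr) auto
  finally show ?thesis using assms(3) by (simp add: energy_def field_simps)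
qed

text \<open>If the energy at level n is within h^2 of the supremum, no further refinement can gain
  more. The clamped slopes then change little in mean square, hence in mean, simultaneously for all
  m.\<close>

lemma interpolants_cauchy_var:
  assumes "ac u" "var_le u C" "0 < e"
  obtains n where "\<And>m. var_le (\<lambda>t. interpolant u (2 ^ (n + m)) t - interpolant u (2 ^ n) t) e"
proof -
  \<comment> \<open>Four contributions of size h: two from \<open>amgm\<close>, one from the excess
    of the fine slopes and one from that of the coarse slopes.\<close>
  define h where "h = e / 4"
  have h: "0 < h" using assms(3) by (simp add: h_def)
  obtain K where K: "0 < K" "\<And>N. 0 < N \<Longrightarrow>
    (\<Sum>j<N. \<bar>real N * grid_incr u N j - cutoff K (real N * grid_incr u N j)\<bar>) \<le> real N * h"
    using cutoff_excess_small[OF assms(1,2) h] by blast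
  define E where "E = (\<lambda>n. energy K u (2 ^ n))"
  have bdd: "bdd_above (range E)"
    by (rule bdd_aboveI[of _ "2 * K * C"]) (auto simp: E_def intro!: energy_bounded K assms)
  have "\<exists>n. (SUP n. E n) - h\<^sup>2 < E n"
    using less_cSUP_iff[OF _ bdd, of "(SUP n. E n) - h\<^sup>2"] h by auto
  then obtain n where n: "(SUP n. E n) - h\<^sup>2 < E n" by blast
  show thesis
  proof (rule that[of n])
    fix m
    define N M :: nat where "N = 2 ^ n" and "M = 2 ^ m"
    have NM: "0 < N" "0 < M" by (simp_all add: N_def M_def)
    let ?x = "\<lambda>j. real N * grid_incr u N j" and ?y = "\<lambda>j i. real (N * M) * grid_incr u (N * M) (j * M + i)"
    have "E (n + m) \<le> (SUP n. E n)" using bdd by (intro cSUP_upper) auto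
    then have "energy K u (N * M) - energy K u N \<le> h\<^sup>2"
      using n by (simp add: E_def N_def M_def power_add)
    then have en: "(\<Sum>j<N. \<Sum>i<M. (cutoff K (?y j i) - cutoff K (?x j))\<^sup>2) \<le> real (N * M) * h\<^sup>2"
      using energy_subdivide[OF K(1) NM(2,1), of u] by (meson mult_left_mono of_nat_0_le_iff order_trans)
    \<comment> \<open>Replaces the Cauchy-Schwarz inequality in passing from the mean square to the
      mean.\<close>
    have amgm: "\<bar>z\<bar> \<le> h + z\<^sup>2 / h" for z
    proof -
      have "0 \<le> (\<bar>z\<bar> - h / 2)\<^sup>2" by simp
      also have "\<dots> = z\<^sup>2 - h * \<bar>z\<bar> + h\<^sup>2 / 4" by (simp add: power2_eq_square algebra_simps)
      finally have "h * \<bar>z\<bar> \<le> h\<^sup>2 + z\<^sup>2" using zero_le_power2[of h] by linarith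
      then show ?thesis using h by (simp add: field_simps power2_eq_square)
    qed
    have tri: "\<bar>a - b\<bar> \<le> \<bar>cutoff K a - cutoff K b\<bar> + \<bar>a - cutoff K a\<bar> + \<bar>b - cutoff K b\<bar>" for a b
      by linarith
    have "(\<Sum>j<N. \<Sum>i<M. \<bar>?y j i - ?x j\<bar>) \<le> (\<Sum>j<N. \<Sum>i<M. (h + (cutoff K (?y j i) - cutoff K (?x j))\<^sup>2 / h)
         + \<bar>?y j i - cutoff K (?y j i)\<bar> + \<bar>?x j - cutoff K (?x j)\<bar>)"
      by (intro sum_mono order_trans[OF tri] add_mono amgm order_refl)
    also have "\<dots> = real (N * M) * h + (\<Sum>j<N. \<Sum>i<M. (cutoff K (?y j i) - cutoff K (?x j))\<^sup>2) / h
         + (\<Sum>j<N * M. \<bar>real (N * M) * grid_incr u (N * M) j - cutoff K (real (N * M) * grid_incr u (N * M) j)\<bar>)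
         + real M * (\<Sum>j<N. \<bar>?x j - cutoff K (?x j)\<bar>)"
      by (simp add: sum.distrib sum_distrib_left sum_divide_distrib sum_lessThan_mult)
    also have "\<dots> \<le> real (N * M) * h + real (N * M) * h\<^sup>2 / h + real (N * M) * h + real M * (real N * h)"
      using en h NM by (intro add_mono divide_right_mono mult_left_mono K(2)) auto
    also have "\<dots> = real (N * M) * e" using h by (simp add: h_def power2_eq_square)
    finally have "(\<Sum>j<N. \<Sum>i<M. \<bar>?y j i - ?x j\<bar>) / real (N * M) \<le> e"
      using NM by (simp add: divide_le_eq mult.commute)
    moreover have "(\<Sum>j<N. \<Sum>i<M. \<bar>grid_incr u (N * M) (j * M + i) - grid_incr u N j / real M\<bar>)
        = (\<Sum>j<N. \<Sum>i<M. \<bar>?y j i - ?x j\<bar>) / real (N * M)"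
    proof -
      have "\<bar>grid_incr u (N * M) (j * M + i) - grid_incr u N j / real M\<bar> = \<bar>?y j i - ?x j\<bar> / real (N * M)" for i j
      proof -
        have "grid_incr u (N * M) (j * M + i) - grid_incr u N j / real M = (?y j i - ?x j) / real (N * M)"
          using NM by (simp add: field_simps)
        then show ?thesis by (simp only: abs_divide abs_of_nat)
      qed
      then show ?thesis by (simp add: sum_divide_distrib)
    qed
    ultimately show "var_le (\<lambda>t. interpolant u (2 ^ (n + m)) t - interpolant u (2 ^ n) t) e"
      using var_le_mono[OF var_interpolant_subdivide[OF NM(2,1), of u]]
      by (simp add: N_def M_def power_add)
  qed
qed

text \<open>Lower semicontinuity of the variation: on a fixed subdivision the Cauchy estimate passes
  to the pointwise limit as m grows.\<close>

lemma ac_approx_interpolant: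
  assumes "ac u" "var_le u C" "deg 0 u" "0 < e"
  obtains N where "0 < N" "var_le (\<lambda>t. u t - interpolant u N t) e"
proof -
  obtain n where n: "\<And>m. var_le (\<lambda>t. interpolant u (2 ^ (n + m)) t - interpolant u (2 ^ n) t) e"
    using interpolants_cauchy_var[OF assms(1,2,4)] by blast
  show thesis
  proof (rule that[of "2 ^ n"])
    show "var_le (\<lambda>t. u t - interpolant u (2 ^ n) t) e"
      unfolding var_le_def
    proof (intro allI impI)
      fix l and t :: "nat \<Rightarrow> real"
      assume t: "(\<forall>i<l. t i \<le> t (Suc i)) \<and> t l = t 0 + 1"
      have lim: "(\<lambda>m. interpolant u (2 ^ (n + m)) s) \<longlonglongrightarrow> u s - u 0" for s
        using LIMSEQ_ignore_initial_segment[OF isCont_interpolant_limit[OF ac_isCont[OF assms(1)] assms(3)], of n s]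
        by (simp add: add.commute)
      have "(\<lambda>m. \<Sum>i<l. \<bar>(interpolant u (2 ^ (n + m)) (t (Suc i)) - interpolant u (2 ^ n) (t (Suc i)))
             - (interpolant u (2 ^ (n + m)) (t i) - interpolant u (2 ^ n) (t i))\<bar>)
          \<longlonglongrightarrow> (\<Sum>i<l. \<bar>(u (t (Suc i)) - u 0 - interpolant u (2 ^ n) (t (Suc i)))
             - (u (t i) - u 0 - interpolant u (2 ^ n) (t i))\<bar>)"
        by (intro tendsto_intros lim)
      moreover have "(\<Sum>i<l. \<bar>(interpolant u (2 ^ (n + m)) (t (Suc i)) - interpolant u (2 ^ n) (t (Suc i)))
             - (interpolant u (2 ^ (n + m)) (t i) - interpolant u (2 ^ n) (t i))\<bar>) \<le> e" for m
        using var_leD[OF n, of l t m] t by simp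
      ultimately have "(\<Sum>i<l. \<bar>(u (t (Suc i)) - u 0 - interpolant u (2 ^ n) (t (Suc i)))
             - (u (t i) - u 0 - interpolant u (2 ^ n) (t i))\<bar>) \<le> e"
        by (intro LIMSEQ_le_const2) auto
      then show "(\<Sum>i<l. \<bar>u (t (Suc i)) - interpolant u (2 ^ n) (t (Suc i)) - (u (t i) - interpolant u (2 ^ n) (t i))\<bar>) \<le> e"
        by (simp add: algebra_simps)
    qed
  qed simp
qed

section \<open>Closest returns of an aperiodic lift\<close>

lemma var_le_obtain_majorant:
  assumes "var_le u C" "deg 0 u"
  obtains v D where "D \<le> C" "mono v" "deg D v" "\<And>x y. x \<le> y \<Longrightarrow> \<bar>u y - u x\<bar> \<le> v y - v x"
proof -
  \<comment> \<open>The supremum w of these sums is the variation of u over [0, t]. Its extension v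
    to the line turns sums of oscillations over the intervals of a tiling into increments that add
    up to the degree.\<close>
  define A where "A t = {(\<Sum>i<n. \<bar>u (\<tau> (Suc i)) - u (\<tau> i)\<bar>) |n \<tau>.
    (\<forall>i<n. \<tau> i \<le> \<tau> (Suc i)) \<and> \<tau> 0 = 0 \<and> \<tau> n = t}" for t
  define w where "w t = Sup (A t)" for t
  have bound: "a \<le> C" if "a \<in> A t" "t \<le> 1" for a t
  proof -
    obtain n \<tau> where n: "a = (\<Sum>i<n. \<bar>u (\<tau> (Suc i)) - u (\<tau> i)\<bar>)"
      "\<forall>i<n. \<tau> i \<le> \<tau> (Suc i)" "\<tau> 0 = 0" "\<tau> n = t"
      using \<open>a \<in> A t\<close> unfolding A_def by blast
    \<comment> \<open>Adding the end point 1 completes the chain to a full period, where the bound C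
      is available.\<close>
    define \<sigma> where "\<sigma> = \<tau>(Suc n := 1)"
    have "(\<Sum>i<Suc n. \<bar>u (\<sigma> (Suc i)) - u (\<sigma> i)\<bar>) \<le> C"
      using n that by (intro var_leD[OF assms(1)]) (auto simp: \<sigma>_def less_Suc_eq)
    moreover have "a = (\<Sum>i<n. \<bar>u (\<sigma> (Suc i)) - u (\<sigma> i)\<bar>)"
      unfolding n(1) by (intro sum.cong) (auto simp: \<sigma>_def)
    moreover have "(\<Sum>i<n. \<bar>u (\<sigma> (Suc i)) - u (\<sigma> i)\<bar>) \<le> (\<Sum>i<Suc n. \<bar>u (\<sigma> (Suc i)) - u (\<sigma> i)\<bar>)"
      by simp
    ultimately show ?thesis by linarith
  qed
  have bdd: "bdd_above (A t)" if "t \<le> 1" for t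
    using bound that by (intro bdd_aboveI[of _ C]) auto
  have ext: "a + \<bar>u t - u s\<bar> \<in> A t" if "a \<in> A s" "s \<le> t" for a s t
  proof -
    obtain n \<tau> where n: "a = (\<Sum>i<n. \<bar>u (\<tau> (Suc i)) - u (\<tau> i)\<bar>)"
      "\<forall>i<n. \<tau> i \<le> \<tau> (Suc i)" "\<tau> 0 = 0" "\<tau> n = s"
      using \<open>a \<in> A s\<close> unfolding A_def by blast
    define \<sigma> where "\<sigma> = \<tau>(Suc n := t)"
    have "a = (\<Sum>i<n. \<bar>u (\<sigma> (Suc i)) - u (\<sigma> i)\<bar>)"
      unfolding n(1) by (intro sum.cong) (auto simp: \<sigma>_def)
    then have "a + \<bar>u t - u s\<bar> = (\<Sum>i<Suc n. \<bar>u (\<sigma> (Suc i)) - u (\<sigma> i)\<bar>)"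
      using n by (simp add: \<sigma>_def)
    moreover have "(\<forall>i<Suc n. \<sigma> i \<le> \<sigma> (Suc i)) \<and> \<sigma> 0 = 0 \<and> \<sigma> (Suc n) = t"
      using n that by (auto simp: \<sigma>_def less_Suc_eq)
    ultimately show ?thesis unfolding A_def by blast
  qed
  have zero: "0 \<in> A 0"
    unfolding A_def by (intro CollectI exI[of _ 0] exI[of _ "\<lambda>_. 0"]) auto
  have ne: "A t \<noteq> {}" if "0 \<le> t" for t using ext[OF zero that] by auto
  have incr: "w s + \<bar>u t - u s\<bar> \<le> w t" if "0 \<le> s" "s \<le> t" "t \<le> 1" for s t
  proof -
    have "w s \<le> w t - \<bar>u t - u s\<bar>"
      unfolding w_def
    proof (rule cSup_least)
      fix a assume "a \<in> A s"
      then have "a + \<bar>u t - u s\<bar> \<le> Sup (A t)"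
        using that by (intro cSup_upper bdd ext)
      then show "a \<le> Sup (A t) - \<bar>u t - u s\<bar>" by simp
    qed (use ne that in auto)
    then show ?thesis by simp
  qed
  define D where "D = w 1 - w 0"
  define v where "v t = of_int \<lfloor>t\<rfloor> * D + w (frac t)" for t
  have "0 \<le> w 0" unfolding w_def using zero bdd[of 0] by (intro cSup_upper) auto
  moreover have "w 1 \<le> C" unfolding w_def using ne[of 1] bound by (intro cSup_least) auto
  ultimately have DC: "D \<le> C" by (simp add: D_def)
  have dv: "deg D v" by (simp add: deg_def v_def frac_1_eq algebra_simps)
  have v01: "v t = w t" if "0 \<le> t" "t \<le> 1" for t
  proof (cases "t = 1")
    case False
    then have "\<lfloor>t\<rfloor> = 0" using that by (simp add: floor_eq_iff)
    then show ?thesis by (simp add: v_def frac_def)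
  qed (simp add: v_def D_def)
  \<comment> \<open>The majorant property amounts to monotonicity of v + u and v - u, so
    \<open>mono_of_pieces\<close> applies, with a degenerate second piece.\<close>
  have "mono (\<lambda>t. v t + u t)"
  proof (rule mono_of_pieces[of D _ 0 1])
    show "deg D (\<lambda>t. v t + u t)" using deg_add[OF dv assms(2)] by simp
    fix x y :: real assume "0 \<le> x" "x \<le> y" "y \<le> 1"
    then show "v x + u x \<le> v y + u y" using incr[of x y] v01[of x] v01[of y] by auto
  next
    fix x y :: real assume "1 \<le> x" "x \<le> y" "y \<le> 0 + 1"
    then have "x = y" by simp
    then show "v x + u x \<le> v y + u y" by simp
  qed auto
  moreover have "mono (\<lambda>t. v t - u t)"
  proof (rule mono_of_pieces[of D _ 0 1])
    show "deg D (\<lambda>t. v t - u t)" using deg_diff[OF dv assms(2)] by simp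
    fix x y :: real assume "0 \<le> x" "x \<le> y" "y \<le> 1"
    then show "v x - u x \<le> v y - u y" using incr[of x y] v01[of x] v01[of y] by auto
  next
    fix x y :: real assume "1 \<le> x" "x \<le> y" "y \<le> 0 + 1"
    then have "x = y" by simp
    then show "v x - u x \<le> v y - u y" by simp
  qed auto
  ultimately have maj: "\<bar>u y - u x\<bar> \<le> v y - v x" if "x \<le> y" for x y
    using that by (fastforce dest: monoD)
  have "mono v"
  proof
    fix x y :: real assume "x \<le> y"
    then show "v x \<le> v y" using maj[of x y] by simp
  qed
  then show thesis using that DC dv maj by blast
qed

text \<open>Testing with arbitrary functions of a degree, step functions included, encodes that the
  intervals cover the circle exactly once, without arranging them in cyclic order. Orbit sums
  provide tilings directly in this form.\<close>

definition tiling :: "nat \<Rightarrow> (nat \<Rightarrow> real) \<Rightarrow> (nat \<Rightarrow> real) \<Rightarrow> bool" where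
  "tiling n l r \<longleftrightarrow> (\<forall>i<n. l i < r i) \<and> (\<forall>d u. deg d u \<longrightarrow> (\<Sum>i<n. u (r i) - u (l i)) = d)"

lemma tilingD: "tiling n l r \<Longrightarrow> deg d u \<Longrightarrow> (\<Sum>i<n. u (r i) - u (l i)) = d"
  by (simp add: tiling_def)

lemma tiling_less: "tiling n l r \<Longrightarrow> i < n \<Longrightarrow> l i < r i"
  by (simp add: tiling_def)

lemma tiling_length:
  assumes "tiling n l r" "i < n"
  shows "r i - l i \<le> 1"
proof -
  have "r i - l i \<le> (\<Sum>i<n. r i - l i)"
    using assms tiling_less[OF assms(1)] by (intro member_le_sum) (auto intro: less_imp_le)
  also have "\<dots> = 1" using tilingD[OF assms(1), of 1 "\<lambda>t. t"] by (simp add: deg_def)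
  finally show ?thesis .
qed

lemma tiling_cover:
  assumes "tiling n l r"
  obtains i k where "i < n" "l i + of_int k \<le> t" "t < r i + of_int k"
proof -
  \<comment> \<open>A step function whose jumps are just to the right of the points t + k; a tile
    that sees a jump contains such a point and extends beyond it on the right.\<close>
  define u :: "real \<Rightarrow> real" where "u s = of_int \<lceil>s - t\<rceil>" for s
  have "s + 1 - t = (s - t) + 1" for s by simp
  then have "deg 1 u" unfolding deg_def u_def by (simp only: ceiling_add_one) simp
  then have "(\<Sum>i<n. u (r i) - u (l i)) = 1" using assms by (simp add: tilingD)
  then obtain i where i: "i < n" "u (l i) < u (r i)"
    by (metis (no_types, lifting) diff_gt_0_iff_gt lessThan_iff not_less sum_nonpos zero_neq_one zero_le_one
        order_antisym linorder_not_less)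
  define k where "k = - \<lceil>l i - t\<rceil>"
  have "l i + of_int k \<le> t" unfolding k_def by linarith
  moreover have "\<lceil>l i - t\<rceil> < \<lceil>r i - t\<rceil>" using i(2) by (simp add: u_def)
  then have "t < r i + of_int k" unfolding k_def by (simp add: less_ceiling_iff)
  ultimately show thesis using that i(1) by blast
qed

section \<open>Lifts without periodic points and their return times\<close>

locale aperiodic_lift =
  fixes F \<phi> :: "real \<Rightarrow> real" and V :: real
  assumes deg_F: "deg 1 F"
    and deriv_F: "\<And>t. (F has_real_derivative exp (\<phi> t)) (at t)"
    and deg_\<phi>: "deg 0 \<phi>"
    and var_\<phi>: "var_le \<phi> V"
    and aperiodic: "\<And>n m t. 0 < n \<Longrightarrow> (F ^^ n) t \<noteq> t + of_int m"
begin

text \<open>The Birkhoff sum of \<phi>, equal to the logarithm of the derivative of the n-th iterate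
  by \<open>deriv_funpow\<close>.\<close>

definition S :: "nat \<Rightarrow> real \<Rightarrow> real" where
  "S n t = (\<Sum>j<n. \<phi> ((F ^^ j) t))"

lemma V_nonneg: "0 \<le> V"
  using var_\<phi> by (rule var_le_nonneg)

lemma S_add: "S (m + n) t = S m t + S n ((F ^^ m) t)"
proof -
  have "S (m + n) t = S m t + (\<Sum>j<n. \<phi> ((F ^^ (m + j)) t))"
    unfolding S_def by (induction n) (auto simp: add.assoc)
  moreover have "(F ^^ (m + j)) t = (F ^^ j) ((F ^^ m) t)" for j
    by (simp add: funpow_add add.commute[of m j])
  ultimately show ?thesis by (simp add: S_def)
qed

lemma funpow_add_apply: "(F ^^ m) ((F ^^ n) t) = (F ^^ (m + n)) t"
  by (simp add: funpow_add)

lemma funpow_int: "(F ^^ n) (t + of_int m) = (F ^^ n) t + of_int m"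
  using deg_int[OF deg_funpow[OF deg_F], of n t m] by simp

lemma S_int: "S n (t + of_int m) = S n t"
  unfolding S_def using deg_int[OF deg_\<phi>] by (simp add: funpow_int)

lemma deriv_funpow: "((F ^^ n) has_real_derivative exp (S n t)) (at t)"
proof (induction n)
  case 0
  then show ?case by (simp add: S_def id_def)
next
  case (Suc n)
  have "(F \<circ> (F ^^ n) has_real_derivative exp (\<phi> ((F ^^ n) t)) * exp (S n t)) (at t)"
    by (rule DERIV_chain[OF deriv_F Suc])
  then show ?case by (simp add: S_def exp_add mult.commute comp_def)
qed

lemma continuous_funpow: "continuous_on A (F ^^ n)"
  by (rule DERIV_continuous_on[OF has_field_derivative_at_within[OF deriv_funpow]])

lemma strict_mono_funpow: "strict_mono (F ^^ n)"
proof (rule strict_monoI)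
  fix x y :: real assume "x < y"
  then show "(F ^^ n) x < (F ^^ n) y"
    by (rule DERIV_pos_imp_increasing) (use deriv_funpow in fastforce)
qed

lemma funpow_le_iff [simp]: "(F ^^ n) x \<le> (F ^^ n) y \<longleftrightarrow> x \<le> y"
  by (rule strict_mono_less_eq[OF strict_mono_funpow])

lemma funpow_less_iff [simp]: "(F ^^ n) x < (F ^^ n) y \<longleftrightarrow> x < y"
  by (rule strict_mono_less[OF strict_mono_funpow])

lemma funpow_MVT:
  assumes "x < y"
  obtains z where "x < z" "z < y" "(F ^^ n) y - (F ^^ n) x = (y - x) * exp (S n z)"
  using MVT2[OF assms, of "F ^^ n" "\<lambda>t. exp (S n t)"] deriv_funpow by blast

text \<open>The displacement is continuous and periodic, and has no zero by aperiodicity. It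
  therefore keeps its sign and attains its minimum. The factor \<sigma> serves both signs at
  once.\<close>

lemma displacement_gap:
  fixes \<sigma> :: real
  assumes "0 < n" "0 < \<sigma> * ((F ^^ n) 0 + of_int m)"
  obtains e where "0 < e" "\<And>t. e \<le> \<sigma> * ((F ^^ n) t + of_int m - t)"
proof -
  define g where "g t = \<sigma> * ((F ^^ n) t + of_int m - t)" for t
  have cont: "continuous_on A g" for A unfolding g_def by (intro continuous_intros continuous_funpow)
  have nz: "g t \<noteq> 0" for t
    using aperiodic[OF assms(1), of t "- m"] assms(2) by (auto simp: g_def)
  have pos: "0 < g t" if t: "0 \<le> t" for t
  proof (rule ccontr)
    assume "\<not> 0 < g t"
    then have "\<exists>x\<ge>0. x \<le> t \<and> g x = 0"
      using assms(2) t by (intro IVT2' cont) (auto simp: g_def)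
    then show False using nz by blast
  qed
  have "deg 0 g" using degD[OF deg_funpow[OF deg_F]] by (simp add: deg_def g_def)
  then obtain t0 where t0: "0 \<le> t0" "\<And>t. g t0 \<le> g t"
    using periodic_attains_min[OF _ cont] by blast
  show thesis
    by (rule that[OF pos[OF t0(1)]]) (use t0(2) in \<open>simp add: g_def\<close>)
qed

text \<open>A pair of return times: \<open>F\<^sup>p + m\<close> moves \<open>0\<close> to the right, \<open>F\<^sup>q + m'\<close> moves it to the left.
  The unimodularity condition says that the first \<open>q\<close> images of \<open>[0, F\<^sup>p 0 + m]\<close> and the first
  \<open>p\<close> images of \<open>[F\<^sup>q 0 + m', 0]\<close> tile the circle.\<close>

definition returns :: "nat \<Rightarrow> int \<Rightarrow> nat \<Rightarrow> int \<Rightarrow> bool" where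
  "returns p m q m' \<longleftrightarrow> 0 < p \<and> 0 < q \<and> m * int q - m' * int p = 1 \<and>
     0 < (F ^^ p) 0 + of_int m \<and> (F ^^ q) 0 + of_int m' < 0"

text \<open>With a = F^p 0 + m and c = F^q 0 + m', the last clause says that F^q maps [0, a] into
  [c, 0] modulo integers. At this stage of the continued fraction algorithm a can be bounded by a
  multiple of -c.\<close>

definition good_returns :: "nat \<Rightarrow> int \<Rightarrow> nat \<Rightarrow> int \<Rightarrow> bool" where
  "good_returns p m q m' \<longleftrightarrow> returns p m q m' \<and> q \<le> p \<and> (F ^^ (p + q)) 0 + of_int (m + m') < 0"

text \<open>One stage of the continued fraction algorithm: p is added to q until just before the
  orbit point crosses 0. A crossing occurs since every step moves by at least a fixed amount. If p +
  q is still on the left, p is added at least once and q grows.\<close>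

lemma returns_step_left:
  assumes "returns p m q m'"
  obtains q' m'' where "returns p m q' m''" "0 < (F ^^ (p + q')) 0 + of_int (m + m'')" "q \<le> q'"
    "(F ^^ (p + q)) 0 + of_int (m + m') < 0 \<longrightarrow> q < q'"
proof -
  note st = assms[unfolded returns_def]
  obtain e where e: "0 < e" "\<And>t. e \<le> 1 * ((F ^^ p) t + of_int m - t)"
    using displacement_gap[of p 1 m] st by auto
  define x where "x k = (F ^^ (q + k * p)) 0 + of_int (m' + int k * m)" for k
  have xS: "x (Suc k) = (F ^^ p) (x k) + of_int m" for k
    unfolding x_def funpow_int by (simp add: funpow_add_apply algebra_simps)
  have lin: "x 0 + real k * e \<le> x k" for k
  proof (induction k)
    case (Suc k)
    then show ?case using xS[of k] e(2)[of "x k"] by (simp add: algebra_simps)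
  qed simp
  obtain k0 :: nat where "- x 0 < real k0 * e" using e(1) reals_Archimedean3 by blast
  then have "0 < x k0" using lin[of k0] by linarith
  moreover have x0: "x 0 < 0" using st by (simp add: x_def)
  ultimately have ex: "\<exists>k. 0 < x (Suc k)" by (metis not0_implies_Suc not_less_iff_gr_or_eq)
  define k where "k = (LEAST k. 0 < x (Suc k))"
  have k: "0 < x (Suc k)" unfolding k_def using LeastI_ex[OF ex] .
  have nz: "x j \<noteq> 0" for j
    using aperiodic[of "q + j * p" 0 "- (m' + int j * m)"] st by (simp add: x_def)
  have "x k < 0"
  proof (cases k)
    case (Suc j)
    then have "\<not> 0 < x (Suc j)" using not_less_Least[of j "\<lambda>k. 0 < x (Suc k)"] by (simp add: k_def)
    then show ?thesis using nz[of "Suc j"] Suc by simp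
  qed (simp add: x0)
  show thesis
  proof (rule that[of "q + k * p" "m' + int k * m"])
    show "returns p m (q + k * p) (m' + int k * m)"
      using st \<open>x k < 0\<close> by (auto simp: returns_def x_def algebra_simps)
    show "0 < (F ^^ (p + (q + k * p))) 0 + of_int (m + (m' + int k * m))"
      using k by (simp add: x_def algebra_simps)
    show "(F ^^ (p + q)) 0 + of_int (m + m') < 0 \<longrightarrow> q < q + k * p"
    proof
      assume "(F ^^ (p + q)) 0 + of_int (m + m') < 0"
      then have "x 1 < 0" by (simp add: x_def add.commute)
      then have "k \<noteq> 0" using k by (metis One_nat_def not_less_iff_gr_or_eq)
      then show "q < q + k * p" using st by simp
    qed
  qed simp
qed

text \<open>The mirror image. Since p + q is still on the right, q is added to p at least once,
  which gives q <= p; stopping just before the crossing gives the last clause of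
  \<open>good_returns\<close>.\<close>

lemma returns_step_right:
  assumes "returns p m q m'" "0 < (F ^^ (p + q)) 0 + of_int (m + m')"
  obtains p' m'' where "good_returns p' m'' q m'"
proof -
  note st = assms(1)[unfolded returns_def]
  obtain e where e: "0 < e" "\<And>t. e \<le> (- 1) * ((F ^^ q) t + of_int m' - t)"
    using displacement_gap[of q "- 1" m'] st by auto
  define x where "x k = (F ^^ (p + k * q)) 0 + of_int (m + int k * m')" for k
  have xS: "x (Suc k) = (F ^^ q) (x k) + of_int m'" for k
    unfolding x_def funpow_int by (simp add: funpow_add_apply algebra_simps)
  have lin: "x k \<le> x 0 - real k * e" for k
  proof (induction k)
    case (Suc k)
    then show ?case using xS[of k] e(2)[of "x k"] by (simp add: algebra_simps)
  qed simp
  obtain k0 :: nat where "x 0 < real k0 * e" using e(1) reals_Archimedean3 by blast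
  then have "x k0 < 0" using lin[of k0] by linarith
  moreover have x0: "0 < x 0" using st by (simp add: x_def)
  ultimately have ex: "\<exists>k. x (Suc k) < 0" by (metis not0_implies_Suc not_less_iff_gr_or_eq)
  define k where "k = (LEAST k. x (Suc k) < 0)"
  have k: "x (Suc k) < 0" unfolding k_def using LeastI_ex[OF ex] .
  have nz: "x j \<noteq> 0" for j
    using aperiodic[of "p + j * q" 0 "- (m + int j * m')"] st by (simp add: x_def)
  have x1: "0 < x 1" using assms(2) by (simp add: x_def add.commute)
  then have k0: "k \<noteq> 0" using k by (metis One_nat_def not_less_iff_gr_or_eq)
  then obtain j where j: "k = Suc j" by (cases k) auto
  then have "\<not> x (Suc j) < 0" using not_less_Least[of j "\<lambda>k. x (Suc k) < 0"] by (simp add: k_def)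
  then have "0 < x k" using nz[of "Suc j"] j by simp
  show thesis
  proof (rule that[of "p + k * q" "m + int k * m'"])
    have "q \<le> p + k * q" using k0 by (cases k) auto
    then show "good_returns (p + k * q) (m + int k * m') q m'"
      using st \<open>0 < x k\<close> k by (auto simp: good_returns_def returns_def x_def algebra_simps)
  qed
qed

text \<open>A right step keeps q and ends in good returns, from which a left step increases q;
  alternating them drives q to infinity.\<close>

lemma good_returns_exist: "\<exists>p m q m'. good_returns p m q m' \<and> N \<le> q"
proof (induction N)
  case 0
  have nz: "F 0 \<noteq> of_int k" for k using aperiodic[of 1 0 k] by simp
  \<comment> \<open>The two integers around F 0 serve at time 1: F 0 is not an integer by
    aperiodicity, and their difference 1 is the unimodularity.\<close>
  have "returns 1 (- \<lfloor>F 0\<rfloor>) 1 (- \<lfloor>F 0\<rfloor> - 1)"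
    unfolding returns_def using nz[of "\<lfloor>F 0\<rfloor>"] by (auto simp: algebra_simps) linarith+
  then obtain q' m'' where "returns 1 (- \<lfloor>F 0\<rfloor>) q' m''" "0 < (F ^^ (1 + q')) 0 + of_int (- \<lfloor>F 0\<rfloor> + m'')"
    by (rule returns_step_left)
  then show ?case by (metis returns_step_right le0)
next
  case (Suc N)
  then obtain p m q m' where 1: "good_returns p m q m'" "N \<le> q" by blast
  then have 2: "returns p m q m'" "(F ^^ (p + q)) 0 + of_int (m + m') < 0" by (auto simp: good_returns_def)
  obtain q' m'' where "returns p m q' m''" "0 < (F ^^ (p + q')) 0 + of_int (m + m'')" "q < q'"
    using returns_step_left[OF 2(1)] 2(2) by blast
  then show ?case using 1(2) by (metis returns_step_right Suc_leI le_less_trans)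
qed

end

section \<open>Denjoy's inequality and small tilings\<close>

context aperiodic_lift
begin

text \<open>Since a and c are orbit points of 0 up to integers, all values of u along the orbit
  cancel. What remains is (m q - m' p) d.\<close>

lemma returns_tile:
  assumes "returns p m q m'" "deg d u"
  defines "a \<equiv> (F ^^ p) 0 + of_int m" and "c \<equiv> (F ^^ q) 0 + of_int m'"
  shows "(\<Sum>i<q. u ((F ^^ i) a) - u ((F ^^ i) 0)) + (\<Sum>i<p. u ((F ^^ i) 0) - u ((F ^^ i) c)) = d"
proof -
  define x where "x i = u ((F ^^ i) 0)" for i
  have a: "u ((F ^^ i) a) = x (p + i) + of_int m * d" and c: "u ((F ^^ i) c) = x (q + i) + of_int m' * d" for i
    unfolding a_def c_def funpow_int funpow_add_apply deg_int[OF assms(2)]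
    by (simp_all add: x_def add.commute)
  have split: "(\<Sum>i<k + n. x i) = (\<Sum>i<k. x i) + (\<Sum>i<n. x (k + i))" for k n
    by (induction n) (auto simp: add.assoc)
  have "(\<Sum>i<q. u ((F ^^ i) a) - u ((F ^^ i) 0)) = (\<Sum>i<q. x (p + i)) + real q * (of_int m * d) - (\<Sum>i<q. x i)"
    by (simp add: a x_def sum_subtractf sum.distrib)
  moreover have "(\<Sum>i<p. u ((F ^^ i) 0) - u ((F ^^ i) c)) = (\<Sum>i<p. x i) - ((\<Sum>i<p. x (q + i)) + real p * (of_int m' * d))"
    by (simp add: c x_def sum_subtractf sum.distrib)
  moreover have "(\<Sum>i<p. x i) + (\<Sum>i<q. x (p + i)) = (\<Sum>i<q. x i) + (\<Sum>i<p. x (q + i))"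
    using split[of p q] split[of q p] by (simp add: add.commute)
  moreover have "real q * (of_int m * d) - real p * (of_int m' * d) = d"
  proof -
    have "real_of_int (m * int q - m' * int p) = 1" using assms(1) unfolding returns_def by presburger
    then have "(of_int m * real q - of_int m' * real p) * d = d" by simp
    then show ?thesis by (simp add: algebra_simps)
  qed
  ultimately show ?thesis by linarith
qed

lemma distortion_le_sum:
  assumes v: "mono v" "\<And>x y. x \<le> y \<Longrightarrow> \<bar>\<phi> y - \<phi> x\<bar> \<le> v y - v x"
    and xy: "l \<le> x" "x \<le> r" "l \<le> y" "y \<le> r"
  shows "\<bar>S n x - S n y\<bar> \<le> (\<Sum>j<n. v ((F ^^ j) r) - v ((F ^^ j) l))"
proof -
  have "\<bar>\<phi> ((F ^^ j) x) - \<phi> ((F ^^ j) y)\<bar> \<le> v ((F ^^ j) r) - v ((F ^^ j) l)" for j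
  proof -
    have "v ((F ^^ j) l) \<le> v ((F ^^ j) x)" "v ((F ^^ j) x) \<le> v ((F ^^ j) r)"
      "v ((F ^^ j) l) \<le> v ((F ^^ j) y)" "v ((F ^^ j) y) \<le> v ((F ^^ j) r)"
      using xy by (auto intro!: monoD[OF v(1)])
    moreover have "\<bar>\<phi> ((F ^^ j) x) - \<phi> ((F ^^ j) y)\<bar> \<le> \<bar>v ((F ^^ j) x) - v ((F ^^ j) y)\<bar>"
      using v(2)[of "(F ^^ j) x" "(F ^^ j) y"] v(2)[of "(F ^^ j) y" "(F ^^ j) x"] by linarith
    ultimately show ?thesis by linarith
  qed
  then have "(\<Sum>j<n. \<bar>\<phi> ((F ^^ j) x) - \<phi> ((F ^^ j) y)\<bar>) \<le> (\<Sum>j<n. v ((F ^^ j) r) - v ((F ^^ j) l))"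
    by (intro sum_mono)
  then show ?thesis
    unfolding S_def sum_subtractf[symmetric] by (rule order_trans[OF sum_abs])
qed

text \<open>In each case the intervals over which \<open>distortion_le_sum\<close> adds the
  increments of v are levels of a single tiling, so the sum is at most V.\<close>

lemma distortion:
  assumes R: "returns p m q m'"
  defines "a \<equiv> (F ^^ p) 0 + of_int m" and "c \<equiv> (F ^^ q) 0 + of_int m'"
  shows distortion_right: "\<lbrakk>n \<le> q; 0 \<le> x; x \<le> a; 0 \<le> y; y \<le> a\<rbrakk> \<Longrightarrow> \<bar>S n x - S n y\<bar> \<le> V"
    and distortion_both: "\<lbrakk>n \<le> p; n \<le> q; c \<le> x; x \<le> a; c \<le> y; y \<le> a\<rbrakk> \<Longrightarrow> \<bar>S n x - S n y\<bar> \<le> V"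
    and distortion_left: "\<lbrakk>n \<le> p; (F ^^ k) c \<le> x; x \<le> (F ^^ k) 0; (F ^^ k) c \<le> y; y \<le> (F ^^ k) 0\<rbrakk>
      \<Longrightarrow> \<bar>S n x - S n y\<bar> \<le> V"
proof -
  obtain v D where v: "D \<le> V" "mono v" "deg D v" "\<And>x y. x \<le> y \<Longrightarrow> \<bar>\<phi> y - \<phi> x\<bar> \<le> v y - v x"
    by (rule var_le_obtain_majorant[OF var_\<phi> deg_\<phi>]) (rule that)
  have a0: "0 \<le> a" and c0: "c \<le> 0" using R by (auto simp: returns_def a_def c_def)
  have nn: "0 \<le> v ((F ^^ j) ((F ^^ k) a)) - v ((F ^^ j) ((F ^^ k) 0))"
    "0 \<le> v ((F ^^ j) ((F ^^ k) 0)) - v ((F ^^ j) ((F ^^ k) c))" for j k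
    using a0 c0 monoD[OF v(2)] by (auto simp: funpow_add_apply)
  \<comment> \<open>The image of the tiling under F^k is again a tiling: \<open>returns_tile\<close>
    is applied to v \<circ> F^k.\<close>
  have tile: "(\<Sum>i<q. v ((F ^^ i) ((F ^^ k) a)) - v ((F ^^ i) ((F ^^ k) 0)))
      + (\<Sum>i<p. v ((F ^^ i) ((F ^^ k) 0)) - v ((F ^^ i) ((F ^^ k) c))) \<le> V" for k
    using returns_tile[OF R deg_compose[OF v(3) deg_funpow[OF deg_F, of k]]] v(1)
    by (simp add: a_def[symmetric] c_def[symmetric] funpow_add_apply add.commute[of k])
  have part1: "(\<Sum>i<n. v ((F ^^ i) ((F ^^ k) a)) - v ((F ^^ i) ((F ^^ k) 0)))
      \<le> (\<Sum>i<q. v ((F ^^ i) ((F ^^ k) a)) - v ((F ^^ i) ((F ^^ k) 0)))" if "n \<le> q" for n k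
    using that by (intro sum_mono2 nn) auto
  have part2: "(\<Sum>i<n. v ((F ^^ i) ((F ^^ k) 0)) - v ((F ^^ i) ((F ^^ k) c)))
      \<le> (\<Sum>i<p. v ((F ^^ i) ((F ^^ k) 0)) - v ((F ^^ i) ((F ^^ k) c)))" if "n \<le> p" for n k
    using that by (intro sum_mono2 nn) auto
  have pos1: "0 \<le> (\<Sum>i<n. v ((F ^^ i) ((F ^^ k) a)) - v ((F ^^ i) ((F ^^ k) 0)))" for n k
    by (intro sum_nonneg nn)
  have pos2: "0 \<le> (\<Sum>i<n. v ((F ^^ i) ((F ^^ k) 0)) - v ((F ^^ i) ((F ^^ k) c)))" for n k
    by (intro sum_nonneg nn)
  note dis = distortion_le_sum[OF v(2,4)]
  { assume "n \<le> q" "0 \<le> x" "x \<le> a" "0 \<le> y" "y \<le> a"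
    then show "\<bar>S n x - S n y\<bar> \<le> V"
      using dis[of 0 x a y n] part1[of n 0] tile[of 0] pos2[of 0 p] by simp }
  { assume "n \<le> p" "(F ^^ k) c \<le> x" "x \<le> (F ^^ k) 0" "(F ^^ k) c \<le> y" "y \<le> (F ^^ k) 0"
    then show "\<bar>S n x - S n y\<bar> \<le> V"
      using dis[of "(F ^^ k) c" x "(F ^^ k) 0" y n] part2[of n k] tile[of k] pos1[of k q] by linarith }
  { assume "n \<le> p" "n \<le> q" "c \<le> x" "x \<le> a" "c \<le> y" "y \<le> a"
    then have "\<bar>S n x - S n y\<bar> \<le> (\<Sum>j<n. v ((F ^^ j) a) - v ((F ^^ j) c))"
      by (intro dis) auto
    also have "\<dots> = (\<Sum>j<n. v ((F ^^ j) a) - v ((F ^^ j) 0)) + (\<Sum>j<n. v ((F ^^ j) 0) - v ((F ^^ j) c))"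
      by (simp add: sum.distrib[symmetric])
    also have "\<dots> \<le> V" using part1[of n 0] part2[of n 0] tile[of 0] \<open>n \<le> p\<close> \<open>n \<le> q\<close> by simp
    finally show "\<bar>S n x - S n y\<bar> \<le> V" . }
qed

lemma funpow_length:
  assumes "x \<le> y" "\<And>t. \<lbrakk>x \<le> t; t \<le> y\<rbrakk> \<Longrightarrow> \<bar>S n t\<bar> \<le> C"
  shows "exp (- C) * (y - x) \<le> (F ^^ n) y - (F ^^ n) x" "(F ^^ n) y - (F ^^ n) x \<le> exp C * (y - x)"
proof -
  have "exp (- C) * (y - x) \<le> (F ^^ n) y - (F ^^ n) x \<and> (F ^^ n) y - (F ^^ n) x \<le> exp C * (y - x)"
  proof (cases "x = y")
    case False
    then have "x < y" using assms by simp
    then obtain z where z: "x < z" "z < y" "(F ^^ n) y - (F ^^ n) x = (y - x) * exp (S n z)"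
      by (rule funpow_MVT)
    have "- C \<le> S n z" "S n z \<le> C" using assms(2)[of z] z by auto
    then have "(y - x) * exp (- C) \<le> (y - x) * exp (S n z)" "(y - x) * exp (S n z) \<le> (y - x) * exp C"
      using \<open>x < y\<close> by (auto intro!: mult_left_mono)
    then show ?thesis using z(3) by (simp add: mult.commute)
  qed simp
  then show "exp (- C) * (y - x) \<le> (F ^^ n) y - (F ^^ n) x" "(F ^^ n) y - (F ^^ n) x \<le> exp C * (y - x)"
    by auto
qed

text \<open>Since q <= p, each level over [0, a] can be joined to its neighbour over [c, 0] with the
  same index. Every resulting tile contains F^i [c, 0], on which the common part will be
  placed.\<close>

lemma good_returns_tiling:
  assumes "good_returns p m q m'"
  defines "a \<equiv> (F ^^ p) 0 + of_int m" and "c \<equiv> (F ^^ q) 0 + of_int m'"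
  shows "tiling p (\<lambda>i. (F ^^ i) c) (\<lambda>i. (F ^^ i) (if i < q then a else 0))"
proof -
  have R: "returns p m q m'" and qp: "q \<le> p" using assms(1) by (auto simp: good_returns_def)
  have ac: "0 < a" "c < 0" using R by (auto simp: returns_def a_def c_def)
  have "(\<Sum>i<p. u ((F ^^ i) (if i < q then a else 0)) - u ((F ^^ i) c)) = d" if "deg d u" for d u
  proof -
    have "(\<Sum>i<p. u ((F ^^ i) (if i < q then a else 0)) - u ((F ^^ i) c))
        = (\<Sum>i<p. (if i < q then u ((F ^^ i) a) - u ((F ^^ i) 0) else 0) + (u ((F ^^ i) 0) - u ((F ^^ i) c)))"
      by (intro sum.cong) auto
    also have "\<dots> = (\<Sum>i<p. (if i < q then u ((F ^^ i) a) - u ((F ^^ i) 0) else 0))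
        + (\<Sum>i<p. u ((F ^^ i) 0) - u ((F ^^ i) c))"
      by (rule sum.distrib)
    also have "(\<Sum>i<p. (if i < q then u ((F ^^ i) a) - u ((F ^^ i) 0) else 0)) = (\<Sum>i<q. u ((F ^^ i) a) - u ((F ^^ i) 0))"
      using qp by (intro sum.mono_neutral_cong_right) auto
    finally show ?thesis using returns_tile[OF R that] by (simp add: a_def c_def)
  qed
  then show ?thesis using ac by (auto simp: tiling_def)
qed

text \<open>Denjoy's inequality. The logarithmic derivative of \<open>F\<^sup>q\<close> has a zero, and every point lies in
  some image \<open>F\<^sup>i z\<close> of the base; there \<open>S q (F\<^sup>i z) - S q z = S i (F\<^sup>q z) - S i z\<close>,
  where \<open>z\<close> and \<open>F\<^sup>q z\<close> are close to each other modulo integers.\<close>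

lemma denjoy_inequality:
  assumes G: "good_returns p m q m'"
  shows "\<bar>S q t\<bar> \<le> 6 * V"
proof -
  have R: "returns p m q m'" and qp: "q \<le> p" and neg: "(F ^^ (p + q)) 0 + of_int (m + m') < 0"
    using G by (auto simp: good_returns_def)
  define a c where "a = (F ^^ p) 0 + of_int m" and "c = (F ^^ q) 0 + of_int m'"
  note dist_right = distortion_right[OF R, folded a_def c_def]
    and dist_both = distortion_both[OF R, folded a_def c_def]
    and dist_left = distortion_left[OF R, folded a_def c_def]
  have ac: "0 < a" "c < 0" using R by (auto simp: returns_def a_def c_def)
  have ga: "(F ^^ q) a + of_int m' < 0"
    using neg unfolding a_def funpow_int funpow_add_apply by (simp add: add.commute)
  \<comment> \<open>Of the 3 V, two are spent on passing from z to F^q z along i steps and one on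
    comparing z with 0 in the base.\<close>
  have base: "\<bar>S q s - S q 0\<bar> \<le> 3 * V" for s
  proof -
    obtain i k where i: "i < p" "(F ^^ i) c + of_int k \<le> s" "s < (F ^^ i) (if i < q then a else 0) + of_int k"
      using tiling_cover[OF good_returns_tiling[OF G], folded a_def c_def] by blast
    define b where "b = (if i < q then a else 0)"
    have cb: "c < b" using ac by (auto simp: b_def)
    have "\<exists>z\<ge>c. z \<le> b \<and> (F ^^ i) z = s - of_int k"
      using i cb by (intro IVT') (auto simp: b_def continuous_funpow)
    then obtain z where z: "c \<le> z" "z \<le> b" "(F ^^ i) z = s - of_int k" by blast
    have "S q s = S q ((F ^^ i) z)" using S_int[of q "s - of_int k" k] z(3) by simp
    also have "\<dots> = S (i + q) z - S i z" by (simp add: S_add)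
    also have "S (i + q) z = S q z + S i ((F ^^ q) z)" by (subst add.commute, simp add: S_add)
    finally have eq: "S q s = S q z + (S i ((F ^^ q) z) - S i z)" by simp
    have shift: "S i ((F ^^ q) z) = S i ((F ^^ q) z + of_int m')" by (simp add: S_int)
    have "\<bar>S i ((F ^^ q) z) - S i z\<bar> \<le> 2 * V"
    proof (cases "z \<le> 0")
      case True
      \<comment> \<open>F^q z lies in the image level F^q [c, 0], whose end point F^q 0 is c modulo
        integers; c serves as intermediate point.\<close>
      have "\<bar>S i ((F ^^ q) z) - S i ((F ^^ q) 0)\<bar> \<le> V"
        using True z i ac by (intro dist_left[of _ q]) auto
      moreover have "S i ((F ^^ q) 0) = S i c" by (simp add: c_def S_int)
      moreover have "\<bar>S i c - S i z\<bar> \<le> V"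
        using True z i ac by (intro dist_left[of _ 0]) auto
      ultimately show ?thesis by linarith
    next
      case False
      then have iq: "i < q" and za: "z \<le> a" using z by (auto simp: b_def split: if_splits)
      \<comment> \<open>By goodness F^q moves z back into [c, 0] modulo integers. Both points then
        lie in [c, a] and a single V suffices.\<close>
      have "(F ^^ q) 0 \<le> (F ^^ q) z" "(F ^^ q) z \<le> (F ^^ q) a" using False za by auto
      then have "c \<le> (F ^^ q) z + of_int m'" "(F ^^ q) z + of_int m' \<le> 0"
        using ga unfolding c_def by linarith+
      then have "\<bar>S i ((F ^^ q) z + of_int m') - S i z\<bar> \<le> V"
        using False za iq i(1) ac by (intro dist_both) linarith+
      then show ?thesis using shift V_nonneg by simp
    qed
    moreover have "\<bar>S q z - S q 0\<bar> \<le> V"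
      using z cb ac qp by (intro dist_both) (auto simp: b_def split: if_splits)
    ultimately show ?thesis using eq by linarith
  qed
  obtain z where z: "(F ^^ q) 1 - (F ^^ q) 0 = (1 - 0) * exp (S q z)"
    using funpow_MVT[of 0 1 q] by auto
  \<comment> \<open>The mean slope of F^q over a period is 1. Comparing t with z through 0 doubles 3
    V to 6 V.\<close>
  then have "S q z = 0" using degD[OF deg_funpow[OF deg_F, of q], of 0] by simp
  then show ?thesis using base[of t] base[of z] by linarith
qed

text \<open>F^q carries [0, a] into [c, 0] modulo integers and, by Denjoy's inequality, shrinks it
  at most by the factor exp (6 V).\<close>

lemma good_returns_ratio:
  assumes "good_returns p m q m'"
  shows "(F ^^ p) 0 + of_int m \<le> exp (6 * V) * - ((F ^^ q) 0 + of_int m')"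
proof -
  have R: "returns p m q m'" and neg: "(F ^^ (p + q)) 0 + of_int (m + m') < 0"
    using assms by (auto simp: good_returns_def)
  define a c where "a = (F ^^ p) 0 + of_int m" and "c = (F ^^ q) 0 + of_int m'"
  have ac: "0 < a" "c < 0" using R by (auto simp: returns_def a_def c_def)
  have ga: "(F ^^ q) a + of_int m' < 0"
    using neg unfolding a_def funpow_int funpow_add_apply by (simp add: add.commute)
  have "exp (- (6 * V)) * (a - 0) \<le> (F ^^ q) a - (F ^^ q) 0"
    using ac denjoy_inequality[OF assms] by (intro funpow_length) auto
  also have "\<dots> \<le> - c" using ga by (simp add: c_def)
  finally have "exp (6 * V) * (exp (- (6 * V)) * a) \<le> exp (6 * V) * - c"
    by (intro mult_left_mono) auto
  then show ?thesis by (simp add: a_def c_def exp_add[symmetric] mult.assoc[symmetric])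
qed

text \<open>If \<open>L = F\<^sup>i[x, y]\<close> belongs to a tall tower, then many images \<open>F\<^sup>n L\<close> (or preimages) with
  \<open>n\<close> a return time belong to it as well; they are disjoint and comparable to \<open>L\<close>, so \<open>L\<close> is short.\<close>

lemma tower_level_short:
  assumes xy: "x \<le> y" and tower: "(\<Sum>j<h. (F ^^ j) y - (F ^^ j) x) \<le> 1"
    and B: "finite B" "\<And>n. n \<in> B \<Longrightarrow> n \<le> T" "\<And>n t. n \<in> B \<Longrightarrow> \<bar>S n t\<bar> \<le> C"
    and h: "2 * T \<le> h" "i < h"
  shows "real (card B) * (exp (- C) * ((F ^^ i) y - (F ^^ i) x)) \<le> 1"
proof -
  define L where "L j = (F ^^ j) y - (F ^^ j) x" for j
  have L0: "0 \<le> L j" for j using xy by (simp add: L_def)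
  have Fxy: "(F ^^ j) x \<le> (F ^^ j) y" for j using xy by simp
  have fwd: "exp (- C) * L j \<le> L (j + n)" "L (j + n) \<le> exp C * L j" if "n \<in> B" for j n
    using funpow_length[OF Fxy[of j] B(3)[OF that]] by (simp_all add: L_def funpow_add_apply add.commute)
  have "real (card B) * (exp (- C) * L i) = (\<Sum>n\<in>B. exp (- C) * L i)" by simp
  also have "\<dots> \<le> (\<Sum>j<h. L j)"
  proof (cases "i + T < h")
    case True
    have "(\<Sum>n\<in>B. exp (- C) * L i) \<le> (\<Sum>n\<in>B. L (i + n))" by (intro sum_mono fwd)
    also have "\<dots> = sum L ((+) i ` B)" by (subst sum.reindex) (auto simp: inj_on_def)
    also have "\<dots> \<le> (\<Sum>j<h. L j)"
    proof (intro sum_mono2)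
      show "(+) i ` B \<subseteq> {..<h}" using True B(2) by fastforce
    qed (use L0 in auto)
    finally show ?thesis .
  next
    case False
    \<comment> \<open>Here i >= h - T >= T because 2 T <= h, so the indices i - n are genuine
      differences.\<close>
    then have Ti: "T \<le> i" using h by simp
    have bwd: "exp (- C) * L i \<le> L (i - n)" if "n \<in> B" for n
    proof -
      have "L i \<le> exp C * L (i - n)" using fwd(2)[OF that, of "i - n"] B(2)[OF that] Ti by simp
      then have "exp (- C) * L i \<le> exp (- C) * (exp C * L (i - n))" by (intro mult_left_mono) auto
      then show ?thesis by (simp add: mult.assoc[symmetric] exp_add[symmetric])
    qed
    have "(\<Sum>n\<in>B. exp (- C) * L i) \<le> (\<Sum>n\<in>B. L (i - n))" by (intro sum_mono bwd)
    also have "\<dots> = sum L ((-) i ` B)"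
    proof (subst sum.reindex)
      show "inj_on ((-) i) B"
      proof (rule inj_onI)
        fix m n assume mn: "m \<in> B" "n \<in> B" "i - m = i - n"
        have "m \<le> i" "n \<le> i" using B(2) mn Ti by (auto intro: order_trans)
        then show "m = n" using mn by simp
      qed
    qed auto
    also have "\<dots> \<le> (\<Sum>j<h. L j)"
    proof (intro sum_mono2)
      show "(-) i ` B \<subseteq> {..<h}" using h by auto
    qed (use L0 in auto)
    finally show ?thesis .
  qed
  also have "\<dots> \<le> 1" using tower by (simp add: L_def)
  finally show ?thesis by (simp add: L_def)
qed

text \<open>The M return times are fixed first and the towers are chosen much taller afterwards;
  \<open>tower_level_short\<close> then finds, for each level, M levels of comparable length in its
  tower.\<close>

lemma mesh_small:
  assumes "0 < \<delta>"
  obtains p m q m' where "good_returns p m q m'"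
    "\<And>i. i < p \<Longrightarrow> (F ^^ i) (if i < q then (F ^^ p) 0 + of_int m else 0) - (F ^^ i) ((F ^^ q) 0 + of_int m') < \<delta>"
proof -
  let ?Q = "{q. \<exists>p m m'. good_returns p m q m'}"
  \<comment> \<open>Each level is then shorter than \<delta> / 2, and a tile consists of at most two
    levels.\<close>
  obtain M :: nat where M: "2 * exp (6 * V) / \<delta> < real M" using reals_Archimedean2 by blast
  have "infinite ?Q"
  proof
    assume "finite ?Q"
    then obtain N where "\<And>q. q \<in> ?Q \<Longrightarrow> q < N" using finite_nat_set_iff_bounded by auto
    moreover obtain p m q m' where "good_returns p m q m'" "N \<le> q" using good_returns_exist by blast
    ultimately show False by (metis (mono_tags, lifting) mem_Collect_eq not_less)
  qed
  then obtain B where B: "finite B" "card B = M" "B \<subseteq> ?Q" using infinite_arbitrarily_large by blast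
  define T where "T = Max (insert 0 B)"
  have BT: "n \<le> T" if "n \<in> B" for n using that B(1) by (simp add: T_def)
  have BS: "\<bar>S n t\<bar> \<le> 6 * V" if "n \<in> B" for n t using that B(3) denjoy_inequality by blast
  obtain p m q m' where G: "good_returns p m q m'" and q: "2 * T \<le> q"
    using good_returns_exist by blast
  have R: "returns p m q m'" and qp: "q \<le> p" using G by (auto simp: good_returns_def)
  define a c where "a = (F ^^ p) 0 + of_int m" and "c = (F ^^ q) 0 + of_int m'"
  have ac: "0 < a" "c < 0" using R by (auto simp: returns_def a_def c_def)
  have sum1: "(\<Sum>i<q. (F ^^ i) a - (F ^^ i) 0) + (\<Sum>i<p. (F ^^ i) 0 - (F ^^ i) c) = 1"
    using returns_tile[OF R, of 1 "\<lambda>t. t"] by (simp add: deg_def a_def c_def)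
  have "0 \<le> (\<Sum>i<q. (F ^^ i) a - (F ^^ i) 0)" "0 \<le> (\<Sum>i<p. (F ^^ i) 0 - (F ^^ i) c)"
    using ac by (auto intro!: sum_nonneg)
  then have towers: "(\<Sum>i<q. (F ^^ i) a - (F ^^ i) 0) \<le> 1" "(\<Sum>i<p. (F ^^ i) 0 - (F ^^ i) c) \<le> 1"
    using sum1 by linarith+
  have short: "L < \<delta> / 2" if "real (card B) * (exp (- (6 * V)) * L) \<le> 1" for L
  proof -
    have "exp (6 * V) * 2 < real M * \<delta>" using M assms by (simp add: field_simps)
    moreover have "real M * L \<le> exp (6 * V)" using that B(2) by (simp add: exp_minus field_simps)
    ultimately have "real M * L < real M * (\<delta> / 2)" by simp
    then show ?thesis by (rule mult_left_less_imp_less) simp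
  qed
  have left: "(F ^^ i) 0 - (F ^^ i) c < \<delta> / 2" if "i < p" for i
    using ac qp q that by (intro short tower_level_short[OF _ towers(2) B(1) BT BS]) auto
  have right: "(F ^^ i) a - (F ^^ i) 0 < \<delta> / 2" if "i < q" for i
    using ac q that by (intro short tower_level_short[OF _ towers(1) B(1) BT BS]) auto
  show thesis
  proof (rule that[OF G])
    fix i assume "i < p"
    then show "(F ^^ i) (if i < q then (F ^^ p) 0 + of_int m else 0) - (F ^^ i) ((F ^^ q) 0 + of_int m') < \<delta>"
      using left[of i] right[of i] assms by (auto simp: a_def[symmetric] c_def[symmetric])
  qed
qed

end

section \<open>Contraction of the variation\<close>

text \<open>The supremum of the points up to which the estimate holds satisfies it by continuity,
  and could be moved to the right if it were less than y.\<close>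

lemma right_local_majorant:
  fixes w Y :: "real \<Rightarrow> real"
  assumes cont: "continuous_on UNIV w" "continuous_on UNIV Y"
    and loc: "\<And>t. \<exists>s>t. \<forall>y. t \<le> y \<longrightarrow> y \<le> s \<longrightarrow> \<bar>w y - w t\<bar> \<le> Y y - Y t"
    and xy: "x \<le> y"
  shows "\<bar>w y - w x\<bar> \<le> Y y - Y x"
proof -
  define A where "A = {z \<in> {x..y}. \<bar>w z - w x\<bar> \<le> Y z - Y x}"
  have "closed {z. \<bar>w z - w x\<bar> \<le> Y z - Y x}"
    by (intro closed_Collect_le continuous_intros cont)
  then have "closed ({x..y} \<inter> {z. \<bar>w z - w x\<bar> \<le> Y z - Y x})" by (intro closed_Int) auto
  moreover have "A = {x..y} \<inter> {z. \<bar>w z - w x\<bar> \<le> Y z - Y x}" by (auto simp: A_def)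
  ultimately have cl: "closed A" by simp
  have xA: "x \<in> A" using xy by (simp add: A_def)
  have bdd: "bdd_above A" by (rule bdd_aboveI[of _ y]) (simp add: A_def)
  define z where "z = Sup A"
  have zA: "z \<in> A" unfolding z_def using cl xA bdd by (intro closed_contains_Sup) auto
  have "z = y"
  proof (rule ccontr)
    assume "z \<noteq> y"
    then have zy: "z < y" using zA by (simp add: A_def)
    obtain s where s: "s > z" "\<And>t. z \<le> t \<Longrightarrow> t \<le> s \<Longrightarrow> \<bar>w t - w z\<bar> \<le> Y t - Y z" using loc by blast
    define t where "t = min s y"
    have t: "z < t" "t \<le> s" "t \<le> y" using s zy by (auto simp: t_def)
    have "\<bar>w t - w z\<bar> \<le> Y t - Y z" using s(2)[of t] t by simp
    then have "t \<in> A" using zA t by (auto simp: A_def)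
    then have "t \<le> z" unfolding z_def using bdd by (intro cSup_upper)
    then show False using t by simp
  qed
  then show ?thesis using zA by (simp add: A_def)
qed

text \<open>The kinks are c and c + w modulo integers, and the two floors change exactly when one of
  them is passed. The floors agree on the flat piece and differ on the sloping one.\<close>

lemma ramp_affine_between_kinks:
  assumes w: "0 < w" "w \<le> 1" and xy: "x \<le> y"
    and 1: "\<lfloor>x - c\<rfloor> = \<lfloor>y - c\<rfloor>" and 2: "\<lfloor>x - c - w\<rfloor> = \<lfloor>y - c - w\<rfloor>"
  obtains \<alpha> \<beta> where "\<And>t. x \<le> t \<Longrightarrow> t \<le> y \<Longrightarrow> ramp c w t = \<alpha> + \<beta> * t"
proof -
  define N M where "N = \<lfloor>x - c\<rfloor>" and "M = \<lfloor>x - c - w\<rfloor>"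
  have fl: "\<lfloor>t - c\<rfloor> = N" "\<lfloor>t - c - w\<rfloor> = M" if "x \<le> t" "t \<le> y" for t
  proof -
    have "\<lfloor>x - c\<rfloor> \<le> \<lfloor>t - c\<rfloor>" "\<lfloor>t - c\<rfloor> \<le> \<lfloor>y - c\<rfloor>"
      "\<lfloor>x - c - w\<rfloor> \<le> \<lfloor>t - c - w\<rfloor>" "\<lfloor>t - c - w\<rfloor> \<le> \<lfloor>y - c - w\<rfloor>"
      using that by (auto intro!: floor_mono)
    then show "\<lfloor>t - c\<rfloor> = N" "\<lfloor>t - c - w\<rfloor> = M" using 1 2 by (auto simp: N_def M_def)
  qed
  show thesis
  proof (cases "N \<le> M")
    case True
    have "ramp c w t = (of_int N + 1) + 0 * t" if "x \<le> t" "t \<le> y" for t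
    proof -
      have "of_int N \<le> (of_int M :: real)" using True by simp
      also have "of_int M \<le> t - c - w" using fl(2)[OF that] by linarith
      finally have "1 \<le> (t - c - of_int N) / w" using w by (simp add: le_divide_eq)
      then show ?thesis using fl(1)[OF that] by (simp add: ramp_def frac_def)
    qed
    then show thesis using that by blast
  next
    case False
    have "ramp c w t = (of_int N - (c + of_int N) / w) + (1 / w) * t" if "x \<le> t" "t \<le> y" for t
    proof -
      have "t - c - w < of_int M + 1" using fl(2)[OF that] by linarith
      also have "of_int M + 1 \<le> (of_int N :: real)" using False by linarith
      finally have "(t - c - of_int N) / w \<le> 1" using w by (simp add: divide_le_eq)
      then show ?thesis using fl(1)[OF that] by (simp add: ramp_def frac_def diff_divide_distrib add_divide_distrib)
    qed
    then show thesis using that by blast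
  qed
qed

section \<open>Ramps of a tiling\<close>

definition tile_ramp :: "(nat \<Rightarrow> real) \<Rightarrow> (nat \<Rightarrow> real) \<Rightarrow> nat \<Rightarrow> real \<Rightarrow> real" where
  "tile_ramp l r i = ramp (l i) (r i - l i)"

lemma deg_tile_ramp: "deg 1 (tile_ramp l r i)"
  unfolding tile_ramp_def by (rule deg_ramp)

lemma mono_tile_ramp: "tiling n l r \<Longrightarrow> i < n \<Longrightarrow> mono (tile_ramp l r i)"
  unfolding tile_ramp_def using tiling_less tiling_length by (intro mono_ramp) auto

lemma continuous_tile_ramp: "tiling n l r \<Longrightarrow> i < n \<Longrightarrow> continuous_on UNIV (tile_ramp l r i)"
  unfolding tile_ramp_def using tiling_less tiling_length by (intro continuous_ramp) auto

lemma tile_ramp_inside: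
  assumes "tiling n l r" "i < n" "l i \<le> x" "x \<le> r i"
  shows "tile_ramp l r i x = (x - l i) / (r i - l i)"
  unfolding tile_ramp_def using tiling_less[OF assms(1,2)] tiling_length[OF assms(1,2)] assms
  by (intro ramp_inside) auto

text \<open>The i-th ramp gains 1 on its own tile, which is its whole degree; being monotone, it
  gains nothing on another tile.\<close>

lemma tile_ramp_other:
  assumes T: "tiling n l r" and ij: "i < n" "j < n" "i \<noteq> j"
    and xy: "l j \<le> x" "x \<le> y" "y \<le> r j"
  shows "tile_ramp l r i y = tile_ramp l r i x"
proof -
  let ?T = "tile_ramp l r i"
  note mono = monoD[OF mono_tile_ramp[OF T ij(1)]]
  have nn: "0 \<le> ?T (r k) - ?T (l k)" if "k < n" for k
    using mono[of "l k" "r k"] tiling_less[OF T that] by simp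
  have "?T (r i) - ?T (l i) = 1"
    using tile_ramp_inside[OF T ij(1), of "r i"] tile_ramp_inside[OF T ij(1), of "l i"] tiling_less[OF T ij(1)] by simp
  moreover have "(\<Sum>k<n. ?T (r k) - ?T (l k)) = 1"
    by (rule tilingD[OF T deg_tile_ramp])
  moreover have "(\<Sum>k\<in>{i, j}. ?T (r k) - ?T (l k)) \<le> (\<Sum>k<n. ?T (r k) - ?T (l k))"
    using ij nn by (intro sum_mono2) auto
  ultimately have "?T (r j) - ?T (l j) \<le> 0" using ij by simp
  moreover have "?T (l j) \<le> ?T x" "?T x \<le> ?T y" "?T y \<le> ?T (r j)" using xy by (auto intro!: mono)
  ultimately show ?thesis by linarith
qed

text \<open>On a tile without a kink the ramp is affine and is reproduced exactly. The other tiles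
  contain only two kinks per period in total, and on them the error has slope at most 1 / w.\<close>

lemma tiling_ramp_approx:
  assumes T: "tiling n l r" and mesh: "\<And>i. i < n \<Longrightarrow> r i - l i \<le> \<delta>" and w: "0 < w" "w \<le> 1"
  shows "var_le (\<lambda>t. ramp c w t - (\<Sum>i<n. (ramp c w (r i) - ramp c w (l i)) * tile_ramp l r i t)) (4 * \<delta> / w)"
proof -
  define R where "R = ramp c w"
  \<comment> \<open>Counts the translates of c and c + w in the half-open tile from l i (excluded)
    to r i (included).\<close>
  define kinks :: "nat \<Rightarrow> real" where "kinks i = of_int (\<lfloor>r i - c\<rfloor> - \<lfloor>l i - c\<rfloor>) + of_int (\<lfloor>r i - c - w\<rfloor> - \<lfloor>l i - c - w\<rfloor>)" for i
  define X where "X t = R t - (\<Sum>i<n. (R (r i) - R (l i)) * tile_ramp l r i t)" for t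
  \<comment> \<open>A majorant of the error X that grows only on tiles with kinks. There are two
    kinks per period, so its degree is 4 \<delta> / w.\<close>
  define Y where "Y t = (\<Sum>i<n. (2 * \<delta> / w * kinks i) * tile_ramp l r i t)" for t
  have R: "deg 1 R" "mono R" "continuous_on UNIV R"
    unfolding R_def using w by (auto intro: deg_ramp mono_ramp continuous_ramp)
  have contX: "continuous_on UNIV X" unfolding X_def
    using continuous_tile_ramp[OF T] by (intro continuous_intros R) auto
  have contY: "continuous_on UNIV Y" unfolding Y_def
    using continuous_tile_ramp[OF T] by (intro continuous_intros) auto
  have "deg (1 - (\<Sum>i<n. (R (r i) - R (l i)) * 1)) X"
    unfolding X_def by (intro deg_diff deg_sum deg_mult R deg_tile_ramp)
  moreover have "(\<Sum>i<n. R (r i) - R (l i)) = 1" by (rule tilingD[OF T R(1)])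
  ultimately have degX: "deg 0 X" by simp
  have degfl: "deg 1 (\<lambda>t. of_int \<lfloor>t - b\<rfloor>)" for b :: real
  proof -
    have "t + 1 - b = (t - b) + 1" for t by simp
    then show ?thesis by (simp only: deg_def floor_add_int floor_one one_add_floor) simp
  qed
  have "(\<Sum>i<n. kinks i) = 2"
  proof -
    have "(\<Sum>i<n. kinks i) = (\<Sum>i<n. of_int \<lfloor>r i - c\<rfloor> - of_int \<lfloor>l i - c\<rfloor>) + (\<Sum>i<n. of_int \<lfloor>r i - (c + w)\<rfloor> - of_int \<lfloor>l i - (c + w)\<rfloor>)"
      unfolding sum.distrib[symmetric] by (simp add: kinks_def diff_diff_eq)
    also have "\<dots> = 2" using tilingD[OF T degfl[of c]] tilingD[OF T degfl[of "c + w"]] by simp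
    finally show ?thesis .
  qed
  then have "(\<Sum>i<n. (2 * \<delta> / w * kinks i) * 1) = 4 * \<delta> / w"
    unfolding mult_1_right sum_distrib_left[symmetric] by simp
  moreover have "deg (\<Sum>i<n. (2 * \<delta> / w * kinks i) * 1) Y"
    unfolding Y_def by (intro deg_sum deg_mult deg_tile_ramp)
  ultimately have degY: "deg (4 * \<delta> / w) Y" by simp
  have loc: "\<bar>X y - X x\<bar> \<le> Y y - Y x" if i: "i < n" and xy: "l i \<le> x" "x \<le> y" "y \<le> r i" for i x y
  proof -
    define L where "L = r i - l i"
    have L: "0 < L" "L \<le> \<delta>" using tiling_less[OF T i] mesh[OF i] by (auto simp: L_def)
    have incr: "(\<Sum>k<n. b k * tile_ramp l r k y) - (\<Sum>k<n. b k * tile_ramp l r k x) = b i * ((y - x) / L)" for b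
    proof -
      have "(\<Sum>k<n. b k * tile_ramp l r k y) - (\<Sum>k<n. b k * tile_ramp l r k x)
          = (\<Sum>k<n. if k = i then b i * ((y - x) / L) else 0)"
        unfolding sum_subtractf[symmetric]
      proof (intro sum.cong refl)
        fix k assume "k \<in> {..<n}"
        show "b k * tile_ramp l r k y - b k * tile_ramp l r k x = (if k = i then b i * ((y - x) / L) else 0)"
        proof (cases "k = i")
          case True
          then show ?thesis
            using tile_ramp_inside[OF T i, of x] tile_ramp_inside[OF T i, of y] xy
            by (simp add: L_def right_diff_distrib[symmetric] diff_divide_distrib[symmetric])
        next
          case False
          then show ?thesis using tile_ramp_other[OF T _ i, of k x y] xy \<open>k \<in> {..<n}\<close> by simp
        qed
      qed
      then show ?thesis using i by simp
    qed
    have X: "X y - X x = (R y - R x) - (R (r i) - R (l i)) * ((y - x) / L)"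
      using incr[of "\<lambda>k. R (r k) - R (l k)"] by (simp add: X_def)
    have Y: "Y y - Y x = 2 * \<delta> / w * kinks i * ((y - x) / L)"
      using incr[of "\<lambda>k. 2 * \<delta> / w * kinks k"] by (simp add: Y_def)
    have fl: "\<lfloor>l i - c\<rfloor> \<le> \<lfloor>r i - c\<rfloor>" "\<lfloor>l i - c - w\<rfloor> \<le> \<lfloor>r i - c - w\<rfloor>"
      using tiling_less[OF T i] by (auto intro!: floor_mono)
    show ?thesis
    proof (cases "\<lfloor>l i - c\<rfloor> = \<lfloor>r i - c\<rfloor> \<and> \<lfloor>l i - c - w\<rfloor> = \<lfloor>r i - c - w\<rfloor>")
      case True
      then obtain \<alpha> \<beta> where ab: "\<And>t. l i \<le> t \<Longrightarrow> t \<le> r i \<Longrightarrow> R t = \<alpha> + \<beta> * t"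
        using ramp_affine_between_kinks[OF w, of "l i" "r i" c] tiling_less[OF T i] unfolding R_def
        by (metis less_imp_le)
      have "R y - R x = \<beta> * (y - x)" "R (r i) - R (l i) = \<beta> * L"
        using ab[of x] ab[of y] ab[of "l i"] ab[of "r i"] xy by (simp_all add: L_def algebra_simps)
      then have "X y - X x = 0" unfolding X using L by simp
      moreover have "kinks i = 0" using True by (simp add: kinks_def)
      ultimately show ?thesis using Y by simp
    next
      case False
      then have "\<lfloor>l i - c\<rfloor> < \<lfloor>r i - c\<rfloor> \<or> \<lfloor>l i - c - w\<rfloor> < \<lfloor>r i - c - w\<rfloor>" using fl by auto
      then have "1 \<le> (\<lfloor>r i - c\<rfloor> - \<lfloor>l i - c\<rfloor>) + (\<lfloor>r i - c - w\<rfloor> - \<lfloor>l i - c - w\<rfloor>)" using fl by linarith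
      then have k1: "1 \<le> kinks i"
        unfolding kinks_def of_int_add[symmetric] by (metis of_int_1 of_int_le_iff)
      have "0 \<le> R y - R x" "R y - R x \<le> (y - x) / w"
        using monoD[OF R(2) xy(2)] ramp_le_slope[OF w xy(2)] by (auto simp: R_def)
      moreover have "0 \<le> (R (r i) - R (l i)) * ((y - x) / L)"
        using monoD[OF R(2), of "l i" "r i"] xy L by (intro mult_nonneg_nonneg) auto
      moreover have "(R (r i) - R (l i)) * ((y - x) / L) \<le> (L / w) * ((y - x) / L)"
        using ramp_le_slope[OF w, of "l i" "r i"] xy L by (intro mult_right_mono) (auto simp: R_def L_def)
      ultimately have "\<bar>X y - X x\<bar> \<le> (y - x) / w"
        unfolding X using L by simp
      also have "\<dots> \<le> 2 * ((y - x) / w)"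
        using divide_nonneg_pos[of "y - x" w] xy w by linarith
      also have "\<dots> \<le> 2 * ((y - x) / w) * (\<delta> / L * kinks i)"
      proof -
        have "1 * 1 \<le> \<delta> / L * kinks i" using L k1 by (intro mult_mono) auto
        then show ?thesis using xy w mult_left_mono[of 1 "\<delta> / L * kinks i" "2 * ((y - x) / w)"] by simp
      qed
      also have "\<dots> = Y y - Y x" by (simp add: Y)
      finally show ?thesis .
    qed
  qed
  \<comment> \<open>Inside a tile this is \<open>loc\<close>. The tiles are not ordered, so the
    estimates are glued pointwise to the right instead of being added up.\<close>
  have "\<bar>X y - X x\<bar> \<le> Y y - Y x" if "x \<le> y" for x y
  proof (rule right_local_majorant[OF contX contY _ that])
    fix t
    obtain i k where i: "i < n" "l i + of_int k \<le> t" "t < r i + of_int k"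
      using tiling_cover[OF T] by blast
    have "\<bar>X s - X t\<bar> \<le> Y s - Y t" if "t \<le> s" "s \<le> r i + of_int k" for s
    proof -
      have "\<bar>X (s - of_int k) - X (t - of_int k)\<bar> \<le> Y (s - of_int k) - Y (t - of_int k)"
        using i that by (intro loc[of i]) auto
      moreover have "X (s - of_int k) = X s" "X (t - of_int k) = X t"
        using deg_int[OF degX, of "s - of_int k" k] deg_int[OF degX, of "t - of_int k" k] by simp_all
      moreover have "Y (s - of_int k) - Y (t - of_int k) = Y s - Y t"
        using deg_int[OF degY, of "s - of_int k" k] deg_int[OF degY, of "t - of_int k" k] by simp
      ultimately show ?thesis by simp
    qed
    then show "\<exists>s>t. \<forall>y. t \<le> y \<longrightarrow> y \<le> s \<longrightarrow> \<bar>X y - X t\<bar> \<le> Y y - Y t"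
      using i(3) by blast
  qed
  then have "var_le X (4 * \<delta> / w)" using degY by (rule var_le_majorant)
  then show ?thesis by (simp add: X_def[abs_def] R_def)
qed

context aperiodic_lift
begin

text \<open>The denominator bounds the length of [c, a] relative to [c, 0], by
  \<open>good_returns_ratio\<close>; exp (- V) is the loss by distortion. Only V enters, neither the
  mesh nor the function to be averaged.\<close>

definition overlap :: real where "overlap = exp (- V) / (1 + exp (6 * V))"

lemma overlap_pos: "0 < overlap"
  by (simp add: overlap_def add_pos_pos)

lemma overlap_less_1: "overlap < 1"
proof -
  have "exp (- V) \<le> 1" using V_nonneg by simp
  then have "exp (- V) < 1 + exp (6 * V)" using exp_gt_zero[of "6 * V"] by linarith
  then show ?thesis by (simp add: overlap_def divide_less_eq add_pos_pos)
qed

text \<open>Pulled back by \<open>F\<^sup>i\<close>, the uniform density on the \<open>i\<close>-th tile lives on \<open>[c, a]\<close> and, by bounded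
  distortion, is at least \<open>overlap\<close> times the uniform density on \<open>[c, 0]\<close>; here \<open>a\<close> is at most a
  constant times \<open>- c\<close>. This common part of all tiles is \<open>Q\<close>.\<close>

lemma tiling_common_part:
  assumes "0 < \<delta>"
  obtains n l r Q where "tiling n l r" "\<And>i. i < n \<Longrightarrow> r i - l i < \<delta>" "deg overlap Q"
    "\<And>i. i < n \<Longrightarrow> mono (\<lambda>t. tile_ramp l r i ((F ^^ i) t) - Q t)"
proof -
  obtain p m q m' where G: "good_returns p m q m'" and mesh:
    "\<And>i. i < p \<Longrightarrow> (F ^^ i) (if i < q then (F ^^ p) 0 + of_int m else 0) - (F ^^ i) ((F ^^ q) 0 + of_int m') < \<delta>"
    using mesh_small[OF assms] by blast
  have R: "returns p m q m'" and qp: "q \<le> p" using G by (auto simp: good_returns_def)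
  define a c where "a = (F ^^ p) 0 + of_int m" and "c = (F ^^ q) 0 + of_int m'"
  note dist_both = distortion_both[OF R, folded a_def c_def]
    and dist_left = distortion_left[OF R, folded a_def c_def]
  have ac: "0 < a" "c < 0" using R by (auto simp: returns_def a_def c_def)
  have ratio: "a \<le> exp (6 * V) * - c" using good_returns_ratio[OF G] by (simp add: a_def c_def)
  define b where "b i = (if i < q then a else 0)" for i
  define l r where "l i = (F ^^ i) c" and "r i = (F ^^ i) (b i)" for i
  have T: "tiling p l r" using good_returns_tiling[OF G, folded a_def c_def] by (simp only: l_def[abs_def] r_def[abs_def] b_def)
  have bi: "0 \<le> b i" "b i \<le> a" "c < b i" for i using ac by (auto simp: b_def)
  have p0: "0 < p" using R by (simp add: returns_def)
  have "-c \<le> 1"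
  proof -
    have "(F ^^ 0) 0 - (F ^^ 0) c \<le> r 0 - l 0" using bi(1)[of 0] by (simp add: r_def l_def)
    also have "\<dots> \<le> 1" by (rule tiling_length[OF T p0])
    finally show ?thesis by simp
  qed
  then have c1: "0 < - c" "-c \<le> 1" using ac by auto
  define Q where "Q t = overlap * ramp c (- c) t" for t
  have degQ: "deg overlap Q" using deg_mult[OF deg_ramp, of overlap c "- c"] by (simp add: Q_def[abs_def])
  have ov: "overlap * ((b i - c) * exp V) \<le> - c" for i
  proof -
    have "overlap * ((b i - c) * exp V) = (b i - c) / (1 + exp (6 * V))"
      by (simp add: overlap_def exp_minus)
    also have "\<dots> \<le> (1 + exp (6 * V)) * - c / (1 + exp (6 * V))"
      using bi(2)[of i] ratio by (intro divide_right_mono) (auto simp: algebra_simps add_nonneg_nonneg)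
    also have "\<dots> = - c" by (simp add: add_pos_pos less_imp_neq[symmetric])
    finally show ?thesis .
  qed
  \<comment> \<open>The mean slopes of F^i over [x, y] and over the base of the tile are its
    derivatives at z and z', whose logarithms differ by at most V.\<close>
  have slope: "overlap * ((y - x) / - c) \<le> ((F ^^ i) y - (F ^^ i) x) / (r i - l i)"
    if i: "i < p" and xy: "c \<le> x" "x \<le> y" "y \<le> 0" for i x y
  proof (cases "x = y")
    case False
    then obtain z where z: "x < z" "z < y" "(F ^^ i) y - (F ^^ i) x = (y - x) * exp (S i z)"
      using funpow_MVT[of x y i] xy by auto
    obtain z' where z': "c < z'" "z' < b i" "r i - l i = (b i - c) * exp (S i z')"
      using funpow_MVT[of c "b i" i] bi(3)[of i] by (auto simp: r_def l_def)
    have "\<bar>S i z - S i z'\<bar> \<le> V"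
    proof (cases "i < q")
      case True
      then show ?thesis using z z' xy bi[of i] i ac by (intro dist_both) auto
    next
      case False
      then show ?thesis using z z' xy i ac by (intro dist_left[of _ 0]) (auto simp: b_def)
    qed
    then have "exp (S i z') \<le> exp V * exp (S i z)" by (simp add: exp_add[symmetric])
    then have "r i - l i \<le> (b i - c) * (exp V * exp (S i z))"
      unfolding z'(3) using bi(3)[of i] by (intro mult_left_mono) auto
    then have "overlap * (r i - l i) \<le> overlap * ((b i - c) * (exp V * exp (S i z)))"
      using overlap_pos by (intro mult_left_mono) auto
    also have "\<dots> = overlap * ((b i - c) * exp V) * exp (S i z)" by simp
    also have "\<dots> \<le> - c * exp (S i z)" using ov by (intro mult_right_mono) auto
    finally have "overlap * (r i - l i) * (y - x) \<le> - c * exp (S i z) * (y - x)"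
      using xy by (intro mult_right_mono) auto
    also have "\<dots> = - c * ((F ^^ i) y - (F ^^ i) x)" by (simp add: z(3))
    finally have "overlap * (y - x) * (r i - l i) \<le> ((F ^^ i) y - (F ^^ i) x) * - c"
      by (simp add: algebra_simps)
    then have "overlap * (y - x) / - c \<le> ((F ^^ i) y - (F ^^ i) x) / (r i - l i)"
      using tiling_less[OF T i] by (simp only: pos_divide_le_eq[OF c1(1)] times_divide_eq_left pos_le_divide_eq diff_gt_0_iff_gt)
    then show ?thesis by simp
  qed simp
  \<comment> \<open>On [c, 0] this is \<open>slope\<close>; on [0, c + 1] the common part Q is
    constant.\<close>
  have "mono (\<lambda>t. tile_ramp l r i ((F ^^ i) t) - Q t)" if i: "i < p" for i
  proof (rule mono_of_pieces[of "1 - overlap" _ c 0])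
    show "deg (1 - overlap) (\<lambda>t. tile_ramp l r i ((F ^^ i) t) - Q t)"
      by (intro deg_diff degQ deg_compose[OF deg_tile_ramp deg_funpow[OF deg_F]])
    show "c \<le> 0" "0 \<le> c + 1" using c1 by auto
    fix x y assume xy: "c \<le> x" "x \<le> y" "y \<le> 0"
    have "Q y - Q x = overlap * ((y - x) / - c)"
    proof -
      have "ramp c (- c) x = (x - c) / - c" "ramp c (- c) y = (y - c) / - c"
        using xy by (intro ramp_inside[OF c1]; simp)+
      then have "Q y - Q x = overlap * ((y - c) / - c - (x - c) / - c)"
        by (simp only: Q_def right_diff_distrib)
      also have "(y - c) / - c - (x - c) / - c = (y - x) / - c"
        unfolding diff_divide_distrib[symmetric] by simp
      finally show ?thesis .
    qed
    moreover have "tile_ramp l r i ((F ^^ i) y) - tile_ramp l r i ((F ^^ i) x) = ((F ^^ i) y - (F ^^ i) x) / (r i - l i)"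
    proof -
      have "l i \<le> (F ^^ i) x" "(F ^^ i) x \<le> r i" "l i \<le> (F ^^ i) y" "(F ^^ i) y \<le> r i"
        using xy bi[of i] by (auto simp: l_def r_def)
      then show ?thesis using tile_ramp_inside[OF T i] by (simp add: diff_divide_distrib[symmetric])
    qed
    ultimately show "tile_ramp l r i ((F ^^ i) x) - Q x \<le> tile_ramp l r i ((F ^^ i) y) - Q y"
      using slope[OF i xy] by linarith
  next
    fix x y assume xy: "0 \<le> x" "x \<le> y" "y \<le> c + 1"
    then have "Q x = Q y" using ramp_outside[OF c1, of c x] ramp_outside[OF c1, of c y] by (simp add: Q_def)
    moreover have "tile_ramp l r i ((F ^^ i) x) \<le> tile_ramp l r i ((F ^^ i) y)"
      using xy by (intro monoD[OF mono_tile_ramp[OF T i]]) simp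
    ultimately show "tile_ramp l r i ((F ^^ i) x) - Q x \<le> tile_ramp l r i ((F ^^ i) y) - Q y" by simp
  qed
  moreover have "r i - l i < \<delta>" if "i < p" for i
    using mesh[OF that, folded a_def c_def] by (simp only: l_def r_def b_def)
  ultimately show thesis using that[OF T _ degQ] by blast
qed

text \<open>The approximation uses the ramps T i themselves, the contraction their pullbacks by F^i.
  The two statements are kept apart because the exchange is possible only after averaging, as a
  coboundary.\<close>

lemma variation_contraction:
  assumes u: "ac u" "var_le u C" "deg 0 u" and e: "0 < e"
  obtains n b T where "var_le (\<lambda>t. u t - (\<Sum>i<n. b i * T i t)) e"
    "\<And>i. i < n \<Longrightarrow> mono (T i)" "\<And>i. deg 1 (T i)"
    "var_le (\<lambda>t. \<Sum>i<n. b i * T i ((F ^^ i) t)) ((1 - overlap) * C)"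
proof -
  have C: "0 \<le> C" using u(2) by (rule var_le_nonneg)
  obtain N where N: "0 < N" "var_le (\<lambda>t. u t - interpolant u N t) (e / 2)"
    using ac_approx_interpolant[OF u, of "e / 2"] e by auto
  define c where "c = grid_incr u N"
  have c: "(\<Sum>j<N. c j) = 0" "(\<Sum>j<N. \<bar>c j\<bar>) \<le> C"
    unfolding c_def using sum_grid_incr[OF N(1) u(3)] sum_abs_grid_incr[OF N(1) u(2)] by auto
  define R where "R = grid_ramp N"
  have wN: "0 < 1 / real N" "1 / real N \<le> 1" using N(1) by (auto simp: divide_le_eq_1 Suc_leI)
  have R: "deg 1 (R j)" "mono (R j)" for j unfolding R_def using N(1) by (auto intro: deg_grid_ramp mono_grid_ramp)
  \<comment> \<open>By \<open>tiling_ramp_approx\<close> each grid ramp costs 4 \<delta> N; weighted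
    with coefficients of absolute sum at most C, the total is at most e / 2.\<close>
  define \<delta> where "\<delta> = e / (8 * real N * (C + 1))"
  have \<delta>: "0 < \<delta>" using e N C by (simp add: \<delta>_def)
  obtain n l r Q where T: "tiling n l r" "\<And>i. i < n \<Longrightarrow> r i - l i < \<delta>" "deg overlap Q"
    "\<And>i. i < n \<Longrightarrow> mono (\<lambda>t. tile_ramp l r i ((F ^^ i) t) - Q t)"
    by (rule tiling_common_part[OF \<delta>]) (rule that)
  \<comment> \<open>The row \<Delta> j is a probability vector, the masses that the j-th grid
    density gives to the tiles. Hence b inherits sum 0 and absolute sum at most C from c.\<close>
  define \<Delta> where "\<Delta> j i = R j (r i) - R j (l i)" for j i
  have \<Delta>: "(\<Sum>i<n. \<Delta> j i) = 1" for j unfolding \<Delta>_def by (rule tilingD[OF T(1) R(1)])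
  have \<Delta>0: "0 \<le> \<Delta> j i" if "i < n" for i j
    using monoD[OF R(2), of "l i" "r i" j] tiling_less[OF T(1) that] by (simp add: \<Delta>_def)
  define b where "b i = (\<Sum>j<N. c j * \<Delta> j i)" for i
  have b0: "(\<Sum>i<n. b i) = 0"
  proof -
    have "(\<Sum>i<n. b i) = (\<Sum>j<N. c j * (\<Sum>i<n. \<Delta> j i))"
      unfolding b_def sum_distrib_left by (rule sum.swap)
    then show ?thesis using c \<Delta> by simp
  qed
  have b1: "(\<Sum>i<n. \<bar>b i\<bar>) \<le> C"
  proof -
    have "(\<Sum>i<n. \<bar>b i\<bar>) \<le> (\<Sum>i<n. \<Sum>j<N. \<bar>c j\<bar> * \<Delta> j i)"
    proof (rule sum_mono)
      fix i assume "i \<in> {..<n}"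
      have "\<bar>b i\<bar> \<le> (\<Sum>j<N. \<bar>c j * \<Delta> j i\<bar>)" unfolding b_def by (rule sum_abs)
      also have "\<dots> = (\<Sum>j<N. \<bar>c j\<bar> * \<Delta> j i)" using \<Delta>0 \<open>i \<in> {..<n}\<close> by (simp add: abs_mult)
      finally show "\<bar>b i\<bar> \<le> (\<Sum>j<N. \<bar>c j\<bar> * \<Delta> j i)" .
    qed
    also have "\<dots> = (\<Sum>j<N. \<bar>c j\<bar> * (\<Sum>i<n. \<Delta> j i))"
      unfolding sum_distrib_left by (rule sum.swap)
    also have "\<dots> \<le> C" using c \<Delta> by simp
    finally show ?thesis .
  qed
  let ?T = "tile_ramp l r"
  show thesis
  proof (rule that[where n = n and b = b and T = ?T])
    have "var_le (\<lambda>t. \<Sum>j<N. c j * (R j t - (\<Sum>i<n. \<Delta> j i * ?T i t))) (\<Sum>j<N. \<bar>c j\<bar> * (4 * \<delta> / (1 / real N)))"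
      unfolding \<Delta>_def R_def grid_ramp_def using T(2) by (intro var_le_sum var_le_cmult tiling_ramp_approx[OF T(1) _ wN]) (auto intro: less_imp_le)
    moreover have "(\<Sum>j<N. c j * (R j t - (\<Sum>i<n. \<Delta> j i * ?T i t))) = interpolant u N t - (\<Sum>i<n. b i * ?T i t)" for t
    proof -
      have "(\<Sum>j<N. c j * (\<Sum>i<n. \<Delta> j i * ?T i t)) = (\<Sum>i<n. b i * ?T i t)"
        unfolding b_def sum_distrib_left sum_distrib_right by (subst sum.swap) (simp add: mult.assoc)
      then show ?thesis by (simp add: right_diff_distrib sum_subtractf interpolant_def c_def R_def)
    qed
    moreover have "(\<Sum>j<N. \<bar>c j\<bar> * (4 * \<delta> / (1 / real N))) \<le> e / 2"
    proof -
      have "(\<Sum>j<N. \<bar>c j\<bar> * (4 * \<delta> / (1 / real N))) = (\<Sum>j<N. \<bar>c j\<bar>) * (4 * \<delta> * real N)"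
        by (simp add: sum_distrib_right)
      also have "\<dots> \<le> (C + 1) * (4 * \<delta> * real N)" using c(2) \<delta> by (intro mult_right_mono) auto
      also have "\<dots> = e / 2"
      proof -
        have "C + 1 \<noteq> 0" "real N \<noteq> 0" using N C by auto
        then show ?thesis by (simp add: \<delta>_def divide_simps)
      qed
      finally show ?thesis .
    qed
    ultimately have "var_le (\<lambda>t. interpolant u N t - (\<Sum>i<n. b i * ?T i t)) (e / 2)"
      by (auto intro: var_le_mono)
    from var_le_add[OF N(2) this] show "var_le (\<lambda>t. u t - (\<Sum>i<n. b i * ?T i t)) e" by simp
    show "mono (?T i)" if "i < n" for i by (rule mono_tile_ramp[OF T(1) that])
    show "deg 1 (?T i)" for i by (rule deg_tile_ramp)
    have "var_le (\<lambda>t. \<Sum>i<n. b i * (?T i ((F ^^ i) t) - Q t)) (\<Sum>i<n. \<bar>b i\<bar> * (1 - overlap))"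
    proof (intro var_le_sum var_le_cmult var_le_monotone T(4))
      show "deg (1 - overlap) (\<lambda>t. ?T i ((F ^^ i) t) - Q t)" for i
        by (intro deg_diff T(3) deg_compose[OF deg_tile_ramp deg_funpow[OF deg_F]])
    qed auto
    moreover have "(\<Sum>i<n. b i * (?T i ((F ^^ i) t) - Q t)) = (\<Sum>i<n. b i * ?T i ((F ^^ i) t))" for t
      using b0 by (simp add: right_diff_distrib sum_subtractf sum_distrib_right[symmetric])
    moreover have "(\<Sum>i<n. \<bar>b i\<bar> * (1 - overlap)) \<le> (1 - overlap) * C"
      unfolding sum_distrib_right[symmetric] using b1 overlap_less_1
      by (subst mult.commute) (intro mult_left_mono, auto)
    ultimately show "var_le (\<lambda>t. \<Sum>i<n. b i * ?T i ((F ^^ i) t)) ((1 - overlap) * C)"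
      by (auto intro: var_le_mono)
  qed
qed

end

section \<open>Lifts and rotation numbers\<close>

lemma circ_add_int [simp]: "circ (t + of_int m) = circ t"
  by (simp add: circ_eq_iff)

lemma circ_add_one [simp]: "circ (t + 1) = circ t"
  by (simp add: circ_eq_iff)

lemma dist_circ_le: "dist (circ x) (circ y) \<le> \<bar>x - y\<bar>"
  by transfer (use round_diff_minimal[of _ 0] in simp)

lemma continuous_circ: "continuous_on UNIV circ"
  by (rule continuous_on_iff[THEN iffD2])
     (metis dist_circ_le dist_real_def le_less_trans)

lemma deg_circ: "deg 0 (\<lambda>t. \<psi> (circ t))"
  by (simp add: deg_def)

lemma circle_var_le_iff:
  assumes "0 \<le> C"
  shows "circle_var \<psi> \<le> ennreal C \<longleftrightarrow> var_le (\<lambda>t. \<psi> (circ t)) C"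
proof -
  have "circle_var \<psi> \<le> ennreal C \<longleftrightarrow> (\<forall>n t. (\<forall>i<n. t i \<le> t (Suc i)) \<and> t n = t 0 + 1 \<longrightarrow>
      (\<Sum>i<n. ennreal \<bar>\<psi> (circ (t (Suc i))) - \<psi> (circ (t i))\<bar>) \<le> ennreal C)"
    unfolding circle_var_def by (auto simp: SUP_le_iff)
  then show ?thesis by (simp add: var_le_def sum_ennreal ennreal_le_iff assms)
qed

lemma circle_var_finite:
  assumes "circle_var \<psi> < \<infinity>"
  obtains C where "var_le (\<lambda>t. \<psi> (circ t)) C"
proof -
  obtain C where "0 \<le> C" "circle_var \<psi> = ennreal C" using assms by (cases "circle_var \<psi>") auto
  then show thesis using circle_var_le_iff[of C \<psi>] that by simp
qed

lemma is_lift_comp: "is_lift F f \<Longrightarrow> is_lift G g \<Longrightarrow> is_lift (F \<circ> G) (f \<circ> g)"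
  unfolding is_lift_def by (auto intro: continuous_on_compose2)

lemma is_lift_funpow: "is_lift F f \<Longrightarrow> is_lift (F ^^ n) (f ^^ n)"
proof (induction n)
  case 0
  show ?case by (simp add: is_lift_def)
next
  case (Suc n)
  then show ?case using is_lift_comp[of F f "F ^^ n" "f ^^ n"] by (simp add: comp_def)
qed

lemma is_lift_shift: "is_lift F f \<Longrightarrow> is_lift (\<lambda>t. F (t + of_int j)) f"
  unfolding is_lift_def by (auto intro!: continuous_on_compose2[of UNIV F] continuous_intros)

lemma circle_C1_lift: "circle_C1 f \<Longrightarrow> \<exists>F. is_lift F f"
  unfolding circle_C1_def circle_has_deriv_def by blast

text \<open>\<open>circle_has_deriv\<close> provides some lift at some preimage of the point. Two
  lifts differ by integer translations in argument and value, so every lift has this derivative at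
  every preimage.\<close>

lemma circle_C1_deriv:
  assumes f: "circle_C1 f" and F: "is_lift F f"
  shows "(F has_real_derivative circle_deriv f (circ t)) (at t)"
proof -
  obtain d where "circle_has_deriv f d (circ t)" using f by (auto simp: circle_C1_def)
  then obtain G s where G: "is_lift G f" "circ s = circ t" "(G has_real_derivative d) (at s)"
    by (auto simp: circle_has_deriv_def)
  obtain j where j: "s = t + of_int j"
    using G(2) by (metis Ints_cases add.commute circ_eq_iff diff_add_cancel)
  obtain m where m: "\<And>u. F u = G (u + of_int j) + of_int m"
    using is_lift_unique[OF is_lift_shift[OF G(1)] F] by blast
  have "((\<lambda>u. G (u + of_int j)) has_real_derivative d) (at t)"
    using G(3) by (simp add: j DERIV_shift)
  then have "((\<lambda>u. G (u + of_int j) + of_int m) has_real_derivative d + 0) (at t)"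
    by (intro derivative_intros)
  then have "(F has_real_derivative d) (at t)" using m by (simp add: ext[of F, OF m])
  moreover have "circle_deriv f (circ t) = d" by (rule circle_deriv_eq[OF F calculation])
  ultimately show ?thesis by simp
qed

lemma circle_diffeo_lift:
  assumes "circle_diffeo f"
  obtains F where "is_lift F f"
  using assms circle_C1_lift unfolding circle_diffeo_def by blast

lemma circle_diffeo_deriv:
  "circle_diffeo f \<Longrightarrow> is_lift F f \<Longrightarrow> (F has_real_derivative circle_deriv f (circ t)) (at t)"
  unfolding circle_diffeo_def by (blast intro: circle_C1_deriv)

lemma circle_diffeo_deriv_pos: "circle_diffeo f \<Longrightarrow> 0 < circle_deriv f x"
  by (simp add: circle_diffeo_def)

lemma lift_strict_mono:
  assumes "circle_diffeo f" "is_lift F f"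
  shows "strict_mono F"
proof (rule strict_monoI)
  fix x y :: real assume "x < y"
  then show "F x < F y"
    by (rule DERIV_pos_imp_increasing)
       (use circle_diffeo_deriv[OF assms] circle_diffeo_deriv_pos[OF assms(1)] in fastforce)
qed

lemma lift_mono: "circle_diffeo f \<Longrightarrow> is_lift F f \<Longrightarrow> mono F"
  by (rule strict_mono_mono[OF lift_strict_mono])

text \<open>The degree is a positive integer by monotonicity. If it were at least 2, F would take
  the value F 0 + 1 strictly inside the period, against the injectivity of f.\<close>

lemma deg_lift:
  assumes f: "circle_diffeo f" and F: "is_lift F f"
  shows "deg 1 F"
proof -
  obtain m where m: "\<And>t. F (t + of_int 1) = F t + of_int m"
    using is_lift_unique[OF F is_lift_shift[OF F, of 1]] by auto
  have "F 0 < F 1" using lift_strict_mono[OF f F] by (simp add: strict_mono_less)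
  then have "0 < m" using m[of 0] by simp
  moreover have "\<not> 2 \<le> m"
  proof
    assume "2 \<le> m"
    then have "F 0 + 2 \<le> F 1" using m[of 0] by simp
    then have "\<exists>t\<ge>0. t \<le> 1 \<and> F t = F 0 + 1"
      using F by (intro IVT') (auto simp: is_lift_def intro: continuous_on_subset)
    then obtain t where t: "0 \<le> t" "t \<le> 1" "F t = F 0 + 1" by blast
    then have "circ (F t) = circ (F 0)" by simp
    then have "f (circ t) = f (circ 0)" using F by (simp add: is_lift_def)
    then have "circ t = circ 0" using f by (simp add: circle_diffeo_def bij_def inj_eq)
    then obtain j where "t = of_int j" by (auto simp: circ_eq_iff elim: Ints_cases)
    then have "t = 0 \<or> t = 1" using t by auto
    then show False using t(3) \<open>F 0 + 2 \<le> F 1\<close> by auto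
  qed
  ultimately have "m = 1" by simp
  then show ?thesis using m by (simp add: deg_def)
qed

lemma continuous_circle_deriv:
  assumes "circle_diffeo f"
  shows "continuous_on UNIV (\<lambda>t. circle_deriv f (circ t))"
  using assms continuous_circ unfolding circle_diffeo_def circle_C1_def
  by (auto intro: continuous_on_compose2)

lemma lift_locally_lipschitz:
  assumes f: "circle_diffeo f" and F: "is_lift F f"
  shows "\<exists>L>0. \<forall>s\<in>{a..b}. \<forall>t\<in>{a..b}. \<bar>F s - F t\<bar> \<le> L * \<bar>s - t\<bar>"
proof -
  have "compact ((\<lambda>t. circle_deriv f (circ t)) ` {a..b})"
    by (intro compact_continuous_image continuous_on_subset[OF continuous_circle_deriv[OF f]]) auto
  then have "bounded ((\<lambda>t. circle_deriv f (circ t)) ` {a..b})" by (rule compact_imp_bounded)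
  then obtain L where L: "0 < L" "\<And>t. t \<in> {a..b} \<Longrightarrow> \<bar>circle_deriv f (circ t)\<bar> \<le> L"
    unfolding bounded_pos by auto
  have "\<bar>F s - F t\<bar> \<le> L * \<bar>s - t\<bar>" if "s \<in> {a..b}" "t \<in> {a..b}" for s t
    using field_differentiable_bound[of "{a..b}" F "\<lambda>t. circle_deriv f (circ t)" L s t] that L
      circle_diffeo_deriv[OF f F] by (auto intro: has_field_derivative_at_within)
  then show ?thesis using L(1) by blast
qed

lemma lift_continuous: "is_lift F f \<Longrightarrow> continuous_on UNIV F"
  by (simp add: is_lift_def)

lemma circle_deriv_comp:
  assumes f: "circle_diffeo f" and g: "circle_diffeo g"
  shows "circle_deriv (f \<circ> g) x = circle_deriv f (g x) * circle_deriv g x"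
proof -
  obtain F G where F: "is_lift F f" and G: "is_lift G g" using f g circle_diffeo_lift by metis
  obtain t where t: "circ t = x" using circ_surj by blast
  have "(F \<circ> G has_real_derivative circle_deriv f (circ (G t)) * circle_deriv g (circ t)) (at t)"
    by (intro DERIV_chain circle_diffeo_deriv f g F G)
  then show ?thesis
    using circle_deriv_eq[OF is_lift_comp[OF F G]] G t by (auto simp: is_lift_def)
qed

lemma circle_deriv_id: "circle_deriv id x = 1"
proof -
  obtain t where t: "circ t = x" using circ_surj by blast
  have "circle_deriv id (circ t) = 1"
    by (rule circle_deriv_eq[of "\<lambda>t. t"]) (auto simp: is_lift_def)
  then show ?thesis using t by simp
qed

text \<open>The chain rule for f composed with its inverse gives the formula, and the formula gives
  the positivity that \<open>circle_diffeo\<close> asks of the inverse.\<close>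

lemma circle_diffeo_inverse:
  assumes f: "circle_diffeo f"
  shows "circle_deriv (inv_into UNIV f) x = 1 / circle_deriv f (inv_into UNIV f x)" (is "circle_deriv ?g x = _")
    and "circle_diffeo (inv_into UNIV f)"
proof -
  have C1: "circle_C1 f" "circle_C1 ?g" and bij: "bij f" using f by (auto simp: circle_diffeo_def)
  have fg: "f \<circ> ?g = id" using bij_is_surj[OF bij] by (simp only: surj_iff)
  obtain F G where F: "is_lift F f" and G: "is_lift G ?g" using C1 circle_C1_lift by metis
  have eq: "circle_deriv f (?g y) * circle_deriv ?g y = 1" for y
  proof -
    obtain t where t: "circ t = y" using circ_surj by blast
    have "(F \<circ> G has_real_derivative circle_deriv f (circ (G t)) * circle_deriv ?g (circ t)) (at t)"
      by (intro DERIV_chain circle_C1_deriv C1 F G)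
    moreover have "is_lift (F \<circ> G) id" using is_lift_comp[OF F G] by (simp add: fg)
    ultimately have "circle_deriv id (circ t) = circle_deriv f (circ (G t)) * circle_deriv ?g (circ t)"
      by (intro circle_deriv_eq)
    then show ?thesis using G t by (auto simp: is_lift_def circle_deriv_id)
  qed
  have pos: "0 < circle_deriv f y" for y using f by (rule circle_diffeo_deriv_pos)
  show inv: "circle_deriv ?g x = 1 / circle_deriv f (?g x)" for x
    using eq[of x] pos[of "?g x"] by (simp add: field_simps)
  show "circle_diffeo ?g"
    unfolding circle_diffeo_def using C1 bij inv pos by (simp add: bij_imp_bij_inv inv_inv_eq)
qed

text \<open>Fekete's argument for a quasi-additive sequence.\<close>

lemma translation_number_exists:
  assumes F: "deg 1 F" "mono F"
  obtains r where "\<And>t. (\<lambda>n. ((F ^^ n) t - t) / real n) \<longlonglongrightarrow> r"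
proof -
  define x where "x n = (F ^^ n) 0" for n
  have close: "\<bar>(F ^^ n) t - t - x n\<bar> \<le> 1" for n t
    unfolding x_def by (rule deg_1_displacement[OF deg_funpow[OF F(1)] mono_funpow_real[OF F(2)]])
  have quasi: "\<bar>x (m + n) - x m - x n\<bar> \<le> 1" for m n
    using close[of m "(F ^^ n) 0"] by (simp add: x_def funpow_add)
  have mult: "\<bar>x (m * n) - real m * x n\<bar> \<le> real m" for m n
  proof (induction m)
    case (Suc m)
    then show ?case using quasi[of n "m * n"] by (simp add: algebra_simps)
  qed (simp add: x_def)
  have cmp: "\<bar>x (m * n) / real (m * n) - x n / real n\<bar> \<le> 1 / real n" if "0 < m" "0 < n" for m n
  proof -
    have "x (m * n) / real (m * n) - x n / real n = (x (m * n) - real m * x n) / real (m * n)"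
      using that by (simp add: field_simps)
    then have "\<bar>x (m * n) / real (m * n) - x n / real n\<bar> = \<bar>x (m * n) - real m * x n\<bar> / real (m * n)"
      by (simp only: abs_divide abs_of_nat)
    also have "\<dots> \<le> real m / real (m * n)" using mult by (intro divide_right_mono) auto
    finally show ?thesis using that by simp
  qed
  have "Cauchy (\<lambda>n. x n / real n)"
  proof (rule CauchyI)
    fix e :: real assume "0 < e"
    obtain N :: nat where N: "2 / e < real N" using reals_Archimedean2 by blast
    show "\<exists>M. \<forall>m\<ge>M. \<forall>n\<ge>M. norm (x m / real m - x n / real n) < e"
    proof (intro exI[of _ "max N 1"] allI impI)
      fix m n assume mn: "max N 1 \<le> m" "max N 1 \<le> n"
      have small: "1 / real k < e / 2" if "max N 1 \<le> k" for k
      proof -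
        have "2 / e < real k" using N that by linarith
        moreover have "0 < real k" using that by simp
        ultimately show ?thesis using \<open>0 < e\<close> by (simp add: field_simps)
      qed
      \<comment> \<open>Both quotients are compared with the one at m n.\<close>
      have "\<bar>x (m * n) / real (m * n) - x n / real n\<bar> \<le> 1 / real n"
        "\<bar>x (n * m) / real (n * m) - x m / real m\<bar> \<le> 1 / real m"
        using cmp[of m n] cmp[of n m] mn by auto
      then show "norm (x m / real m - x n / real n) < e"
        using small[OF mn(1)] small[OF mn(2)] by (simp add: mult.commute[of n m] abs_le_iff abs_less_iff)
    qed
  qed
  then obtain r where r: "(\<lambda>n. x n / real n) \<longlonglongrightarrow> r" by (auto simp: Cauchy_convergent_iff convergent_def)
  have "(\<lambda>n. ((F ^^ n) t - t) / real n) \<longlonglongrightarrow> r" for t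
  proof -
    have "(\<lambda>n. ((F ^^ n) t - t - x n) / real n) \<longlonglongrightarrow> 0"
    proof (rule tendsto_rabs_zero_cancel, rule tendsto_sandwich[OF _ _ tendsto_const lim_1_over_n])
      show "\<forall>\<^sub>F n in sequentially. \<bar>((F ^^ n) t - t - x n) / real n\<bar> \<le> 1 / of_nat n"
        using close[of _ t] by (auto simp: abs_divide intro!: divide_right_mono always_eventually)
    qed simp
    from tendsto_add[OF this r] show ?thesis by (simp add: add_divide_distrib[symmetric])
  qed
  then show thesis by (rule that)
qed

text \<open>H moves points by a bounded amount, so the orbit of t under the conjugate stays at
  bounded distance from the orbit of K t under G.\<close>

lemma translation_number_conjugate:
  assumes H: "deg 1 H" "mono H" and HK: "\<And>t. H (K t) = t" "\<And>t. K (H t) = t"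
    and lim: "\<And>t. (\<lambda>n. ((G ^^ n) t - t) / real n) \<longlonglongrightarrow> r"
  shows "(\<lambda>n. (((H \<circ> G \<circ> K) ^^ n) t - t) / real n) \<longlonglongrightarrow> r"
proof -
  have iter: "((H \<circ> G \<circ> K) ^^ n) s = H ((G ^^ n) (K s))" for n s
    by (induction n) (simp_all add: HK)
  have close: "\<bar>H s - s\<bar> \<le> \<bar>H 0\<bar> + 1" for s
    using deg_1_displacement[OF H, of s] by linarith
  define b where "b n = H ((G ^^ n) (K t)) - (G ^^ n) (K t) + (K t - t)" for n
  have "(\<lambda>n. (\<bar>H 0\<bar> + 1 + \<bar>K t - t\<bar>) * (1 / real n)) \<longlonglongrightarrow> (\<bar>H 0\<bar> + 1 + \<bar>K t - t\<bar>) * 0"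
    by (intro tendsto_mult tendsto_const lim_1_over_n)
  then have lim0: "(\<lambda>n. (\<bar>H 0\<bar> + 1 + \<bar>K t - t\<bar>) * (1 / real n)) \<longlonglongrightarrow> 0" by simp
  have "(\<lambda>n. b n / real n) \<longlonglongrightarrow> 0"
  proof (rule tendsto_rabs_zero_cancel, rule tendsto_sandwich[OF _ _ tendsto_const lim0])
    have "\<bar>b n\<bar> \<le> \<bar>H 0\<bar> + 1 + \<bar>K t - t\<bar>" for n
      using close[of "(G ^^ n) (K t)"] unfolding b_def by linarith
    then show "\<forall>\<^sub>F n in sequentially. \<bar>b n / real n\<bar> \<le> (\<bar>H 0\<bar> + 1 + \<bar>K t - t\<bar>) * (1 / real n)"
      by (auto simp: abs_divide intro!: divide_right_mono always_eventually)
  qed simp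
  from tendsto_add[OF this lim[of "K t"]] show ?thesis
    by (simp add: b_def iter add_divide_distrib[symmetric])
qed

text \<open>Every displacement along the orbit of 0 is within \<omega> of the one at t, hence so is
  their mean and its limit r.\<close>

lemma displacement_near_translation_number:
  fixes r \<omega> :: real
  assumes osc: "\<And>s t. \<bar>(\<Phi> t - t) - (\<Phi> s - s)\<bar> \<le> \<omega>"
    and lim: "(\<lambda>n. ((\<Phi> ^^ n) 0 - 0) / real n) \<longlonglongrightarrow> r"
  shows "\<bar>\<Phi> t - t - r\<bar> \<le> \<omega>"
proof -
  define D where "D = \<Phi> t - t"
  have it: "real n * (D - \<omega>) \<le> (\<Phi> ^^ n) 0 \<and> (\<Phi> ^^ n) 0 \<le> real n * (D + \<omega>)" for n
  proof (induction n)
    case (Suc n)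
    then show ?case using osc[of t "(\<Phi> ^^ n) 0"] by (auto simp: D_def algebra_simps abs_le_iff)
  qed simp
  have "D - \<omega> \<le> r"
  proof (rule LIMSEQ_le_const[OF lim], intro exI[of _ 1] allI impI)
    fix n :: nat assume "1 \<le> n"
    then show "D - \<omega> \<le> ((\<Phi> ^^ n) 0 - 0) / real n" using it[of n] by (simp add: le_divide_eq mult.commute)
  qed
  moreover have "r \<le> D + \<omega>"
  proof (rule LIMSEQ_le_const2[OF lim], intro exI[of _ 1] allI impI)
    fix n :: nat assume "1 \<le> n"
    then show "((\<Phi> ^^ n) 0 - 0) / real n \<le> D + \<omega>" using it[of n] by (simp add: divide_le_eq mult.commute)
  qed
  ultimately show ?thesis by (simp add: D_def abs_le_iff)
qed

section \<open>Averages over Folner sets\<close>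

text \<open>Separates analysis from algebra. Absence of torsion makes the powers of g nontrivial and
  hence fixed point free, so that its lift is aperiodic; the boxes are represented by their Folner
  property.\<close>

locale folner_circle_group =
  fixes \<Gamma> :: "(circle \<Rightarrow> circle) set" and B :: "nat \<Rightarrow> (circle \<Rightarrow> circle) set"
  assumes C1bv: "\<And>g. g \<in> \<Gamma> \<Longrightarrow> circle_C1bv_diffeo g"
    and abs_cont: "\<And>g. g \<in> \<Gamma> \<Longrightarrow> circle_abs_cont (circle_deriv g)"
    and comp_closed: "\<And>g h. g \<in> \<Gamma> \<Longrightarrow> h \<in> \<Gamma> \<Longrightarrow> g \<circ> h \<in> \<Gamma>"
    and commute: "\<And>g h. g \<in> \<Gamma> \<Longrightarrow> h \<in> \<Gamma> \<Longrightarrow> g \<circ> h = h \<circ> g"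
    and fixed_point_free: "\<And>g x. g \<in> \<Gamma> \<Longrightarrow> g \<noteq> id \<Longrightarrow> g x \<noteq> x"
    and torsion_free: "\<And>g n. g \<in> \<Gamma> \<Longrightarrow> g \<noteq> id \<Longrightarrow> 0 < n \<Longrightarrow> g ^^ n \<noteq> id"
    and B: "\<And>n. finite (B n)" "\<And>n. B n \<noteq> {}" "\<And>n. B n \<subseteq> \<Gamma>"
    and folner: "\<And>g. g \<in> \<Gamma> \<Longrightarrow> (\<lambda>n. real (card ((\<circ>) g ` B n - B n)) / real (card (B n))) \<longlonglongrightarrow> 0"
begin

definition lft :: "(circle \<Rightarrow> circle) \<Rightarrow> real \<Rightarrow> real" where
  "lft g = (SOME F. is_lift F g)"

lemma diffeo: "g \<in> \<Gamma> \<Longrightarrow> circle_diffeo g"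
  using C1bv by (simp add: circle_C1bv_diffeo_def)

lemma lft: "g \<in> \<Gamma> \<Longrightarrow> is_lift (lft g) g"
  unfolding lft_def using diffeo circle_diffeo_lift by (metis someI)

lemma deg_lft: "g \<in> \<Gamma> \<Longrightarrow> deg 1 (lft g)"
  using deg_lift diffeo lft by blast

lemma mono_lft: "g \<in> \<Gamma> \<Longrightarrow> mono (lft g)"
  using lift_mono diffeo lft by blast

definition avg :: "nat \<Rightarrow> (real \<Rightarrow> real) \<Rightarrow> real \<Rightarrow> real" where
  "avg n u t = (\<Sum>w\<in>B n. (1 / real (card (B n))) * u (lft w t))"

text \<open>Says N(u) <= C for the upper limit N of the overview, without forming that
  limit.\<close>

definition limvar :: "(real \<Rightarrow> real) \<Rightarrow> real \<Rightarrow> bool" where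
  "limvar u C \<longleftrightarrow> (\<forall>e>0. \<forall>\<^sub>F n in sequentially. var_le (avg n u) (C + e))"

lemma card_B_pos: "0 < real (card (B n))"
  using B by (simp add: card_gt_0_iff)

lemma var_le_avg:
  assumes "var_le u C"
  shows "var_le (avg n u) C"
proof -
  have "var_le (avg n u) (\<Sum>w\<in>B n. \<bar>1 / real (card (B n))\<bar> * C)"
    unfolding avg_def[abs_def]
    using B(3) by (intro var_le_sum var_le_cmult var_le_compose[OF assms] mono_lft deg_lft) auto
  then show ?thesis using card_B_pos[of n] by simp
qed

lemma avg_add: "avg n (\<lambda>t. u t + v t) t = avg n u t + avg n v t"
  by (simp add: avg_def sum.distrib distrib_left)

lemma avg_cmult: "avg n (\<lambda>t. c * u t) t = c * avg n u t"
  by (simp add: avg_def sum_distrib_left mult.left_commute)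

lemma limvar_var: "var_le u C \<Longrightarrow> limvar u C"
  unfolding limvar_def by (auto intro!: always_eventually var_le_mono[OF var_le_avg])

lemma limvar_mono:
  assumes "limvar u C" "C \<le> D"
  shows "limvar u D"
  unfolding limvar_def
proof (intro allI impI)
  fix e :: real assume "0 < e"
  then have "\<forall>\<^sub>F n in sequentially. var_le (avg n u) (C + e)" using assms(1) by (simp add: limvar_def)
  then show "\<forall>\<^sub>F n in sequentially. var_le (avg n u) (D + e)"
    by eventually_elim (use assms(2) in \<open>auto elim!: var_le_mono\<close>)
qed

lemma limvar_add:
  assumes "limvar u C" "limvar v D"
  shows "limvar (\<lambda>t. u t + v t) (C + D)"
  unfolding limvar_def
proof (intro allI impI)
  fix e :: real assume "0 < e"
  then have "\<forall>\<^sub>F n in sequentially. var_le (avg n u) (C + e / 2)" "\<forall>\<^sub>F n in sequentially. var_le (avg n v) (D + e / 2)"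
    using assms unfolding limvar_def by (meson half_gt_zero)+
  then show "\<forall>\<^sub>F n in sequentially. var_le (avg n (\<lambda>t. u t + v t)) (C + D + e)"
  proof eventually_elim
    case (elim n)
    from var_le_add[OF this] show ?case
      by (simp add: avg_add[abs_def] algebra_simps)
  qed
qed

lemma limvar_cmult:
  assumes "limvar u 0"
  shows "limvar (\<lambda>t. c * u t) 0"
  unfolding limvar_def
proof (intro allI impI)
  fix e :: real assume "0 < e"
  then have "0 < e / (\<bar>c\<bar> + 1)" by simp
  then have "\<forall>\<^sub>F n in sequentially. var_le (avg n u) (0 + e / (\<bar>c\<bar> + 1))"
    using assms unfolding limvar_def by blast
  then show "\<forall>\<^sub>F n in sequentially. var_le (avg n (\<lambda>t. c * u t)) (0 + e)"
  proof eventually_elim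
    case (elim n)
    have "\<bar>c\<bar> * (e / (\<bar>c\<bar> + 1)) \<le> e" using \<open>0 < e\<close> by (simp add: divide_le_eq)
    then show ?case using var_le_mono[OF var_le_cmult[OF elim, of c]] by (simp add: avg_cmult[abs_def])
  qed
qed

lemma limvar_sum_zero:
  "(\<And>i. i \<in> I \<Longrightarrow> limvar (u i) 0) \<Longrightarrow> limvar (\<lambda>t. \<Sum>i\<in>I. u i t) 0"
proof (induction I rule: infinite_finite_induct)
  case (insert i I)
  then show ?case using limvar_add[of "u i" 0 "\<lambda>t. \<Sum>i\<in>I. u i t" 0] by simp
qed (auto intro!: limvar_var var_le_const)

lemma limvar_closed:
  assumes "\<And>e. 0 < e \<Longrightarrow> limvar u (C + e)"
  shows "limvar u C"
  unfolding limvar_def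
proof (intro allI impI)
  fix e :: real assume "0 < e"
  then have "limvar u (C + e / 2)" using assms by simp
  then have "\<forall>\<^sub>F n in sequentially. var_le (avg n u) (C + e / 2 + e / 2)"
    using \<open>0 < e\<close> unfolding limvar_def by (meson half_gt_zero)
  then show "\<forall>\<^sub>F n in sequentially. var_le (avg n u) (C + e)"
    by (simp only: add.assoc field_sum_of_halves)
qed

lemma lft_comp:
  assumes "g \<in> \<Gamma>" "h \<in> \<Gamma>"
  obtains m :: int where "\<And>t. lft g (lft h t) = lft (g \<circ> h) t + of_int m"
  using is_lift_unique[OF lft[OF comp_closed[OF assms]] is_lift_comp[OF lft[OF assms(1)] lft[OF assms(2)]]]
  by (auto simp: comp_def)

text \<open>The sums over B n and over its translate by g cancel outside their symmetric difference,
  and each remaining term contributes C / card (B n). Lifts compose only up to integers, which the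
  degree turns into constants.\<close>

lemma var_avg_coboundary:
  assumes g: "g \<in> \<Gamma>" and u: "deg d u" "var_le u C"
  shows "var_le (avg n (\<lambda>t. u t - u (lft g t))) (2 * C * (real (card ((\<circ>) g ` B n - B n)) / real (card (B n))))"
proof -
  define gB where "gB = (\<circ>) g ` B n"
  let ?c = "1 / real (card (B n))"
  have "\<forall>w\<in>B n. \<exists>m::int. \<forall>t. lft g (lft w t) = lft (g \<circ> w) t + of_int m"
    using lft_comp[OF g] B(3) by (metis subsetD)
  then obtain m :: "(circle \<Rightarrow> circle) \<Rightarrow> int" where m: "\<And>w t. w \<in> B n \<Longrightarrow> lft g (lft w t) = lft (g \<circ> w) t + of_int (m w)"
    by metis
  have inj: "inj_on ((\<circ>) g) (B n)"
  proof (rule inj_onI)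
    fix v w assume "g \<circ> v = g \<circ> w"
    moreover have "inj g" using diffeo[OF g] by (simp add: circle_diffeo_def bij_is_inj)
    ultimately show "v = w" by (simp add: fun.inj_map inj_eq fun_eq_iff)
  qed
  have fin: "finite (B n)" "finite gB" using B by (auto simp: gB_def)
  define P where "P t = (\<Sum>w\<in>B n - gB. ?c * u (lft w t)) - (\<Sum>w\<in>gB - B n. ?c * u (lft w t))" for t
  have "avg n (\<lambda>t. u t - u (lft g t)) t = P t - (\<Sum>w\<in>B n. ?c * (of_int (m w) * d))" for t
  proof -
    have "avg n (\<lambda>t. u t - u (lft g t)) t = (\<Sum>w\<in>B n. ?c * u (lft w t) - (?c * u (lft (g \<circ> w) t) + ?c * (of_int (m w) * d)))"
      unfolding avg_def by (intro sum.cong refl) (simp only: m deg_int[OF u(1)] right_diff_distrib distrib_left)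
    also have "\<dots> = (\<Sum>w\<in>B n. ?c * u (lft w t)) - (\<Sum>w\<in>gB. ?c * u (lft w t)) - (\<Sum>w\<in>B n. ?c * (of_int (m w) * d))"
    proof -
      have "(\<Sum>w\<in>gB. ?c * u (lft w t)) = (\<Sum>w\<in>B n. ?c * u (lft (g \<circ> w) t))"
        by (rule sum.reindex_cong[OF inj gB_def]) (rule refl)
      then show ?thesis by (simp only: sum_subtractf sum.distrib diff_diff_add)
    qed
    also have "(\<Sum>w\<in>B n. ?c * u (lft w t)) = (\<Sum>w\<in>B n - gB. ?c * u (lft w t)) + (\<Sum>w\<in>B n \<inter> gB. ?c * u (lft w t))"
      using sum.Int_Diff[OF fin(1), of "\<lambda>w. ?c * u (lft w t)" gB] by simp
    also have "(\<Sum>w\<in>gB. ?c * u (lft w t)) = (\<Sum>w\<in>gB - B n. ?c * u (lft w t)) + (\<Sum>w\<in>B n \<inter> gB. ?c * u (lft w t))"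
      using sum.Int_Diff[OF fin(2), of "\<lambda>w. ?c * u (lft w t)" "B n"] by (simp add: Int_commute)
    finally show ?thesis by (simp add: P_def)
  qed
  then have diff: "avg n (\<lambda>t. u t - u (lft g t)) t - avg n (\<lambda>t. u t - u (lft g t)) s = P t - P s" for s t
    by simp
  \<comment> \<open>Translation by g is injective, so the half of the symmetric difference in the
    Folner condition controls the other half as well.\<close>
  have "card (B n - gB) = card (gB - B n)"
  proof -
    have "card (B n - gB) + card (B n \<inter> gB) = card (gB - B n) + card (B n \<inter> gB)"
      using card_Int_Diff[OF fin(1), of gB] card_Int_Diff[OF fin(2), of "B n"] card_image[OF inj, folded gB_def]
      by (simp add: Int_commute)
    then show ?thesis by simp
  qed
  moreover have "var_le P ((\<Sum>w\<in>B n - gB. \<bar>?c\<bar> * C) + (\<Sum>w\<in>gB - B n. \<bar>?c\<bar> * C))"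
    unfolding P_def[abs_def] using B(3)[of n] comp_closed[OF g]
    by (intro var_le_diff var_le_sum var_le_cmult var_le_compose[OF u(2)] mono_lft deg_lft) (auto simp: gB_def)
  ultimately have "var_le P (2 * C * (real (card (gB - B n)) / real (card (B n))))"
    by (simp add: mult.assoc)
  then show ?thesis unfolding gB_def by (rule var_le_diff_cong) (rule diff)
qed

lemma limvar_coboundary:
  assumes g: "g \<in> \<Gamma>" and u: "deg d u" "var_le u C"
  shows "limvar (\<lambda>t. u t - u (lft g t)) 0"
  unfolding limvar_def
proof (intro allI impI)
  fix e :: real assume e: "0 < e"
  have "(\<lambda>n. 2 * C * (real (card ((\<circ>) g ` B n - B n)) / real (card (B n)))) \<longlonglongrightarrow> 2 * C * 0"
    by (intro tendsto_intros folner g)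
  then have "\<forall>\<^sub>F n in sequentially. 2 * C * (real (card ((\<circ>) g ` B n - B n)) / real (card (B n))) < e"
    using e by (intro order_tendstoD) auto
  then show "\<forall>\<^sub>F n in sequentially. var_le (avg n (\<lambda>t. u t - u (lft g t))) (0 + e)"
    by eventually_elim (auto intro: var_le_mono[OF var_avg_coboundary[OF g u]])
qed

lemma limvar_coboundary_funpow:
  assumes g: "g \<in> \<Gamma>" and u: "deg d u" "var_le u C"
  shows "limvar (\<lambda>t. u t - u ((lft g ^^ i) t)) 0"
proof (induction i)
  case 0
  show ?case by (simp add: limvar_var var_le_const)
next
  case (Suc i)
  \<comment> \<open>The next difference is the preceding one plus the coboundary of u composed with
    the i-th iterate.\<close>
  have "limvar (\<lambda>t. u ((lft g ^^ i) t) - u ((lft g ^^ i) (lft g t))) 0"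
    using g by (intro limvar_coboundary[OF g, of d _ C] deg_compose[OF u(1)] var_le_compose[OF u(2)]
        deg_funpow mono_funpow_real deg_lft mono_lft)
  from limvar_add[OF Suc this] show ?case by (simp add: funpow_swap1)
qed

lemma limvar_avg:
  assumes u: "deg 0 u" "var_le u C"
  shows "limvar (\<lambda>t. u t - avg m u t) 0"
proof -
  have "limvar (\<lambda>t. \<Sum>w\<in>B m. (1 / real (card (B m))) * (u t - u (lft w t))) 0"
    using B(3) by (intro limvar_sum_zero limvar_cmult limvar_coboundary[OF _ u]) auto
  moreover have "(\<Sum>w\<in>B m. (1 / real (card (B m))) * (u t - u (lft w t))) = u t - avg m u t" for t
    using card_B_pos[of m] by (simp add: avg_def right_diff_distrib sum_subtractf)
  ultimately show ?thesis by simp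
qed

lemma deg_avg:
  assumes "deg 0 u"
  shows "deg 0 (avg n u)"
proof -
  have "u (lft w (t + 1)) = u (lft w t)" if "w \<in> B n" for w t
    using degD[OF deg_compose[OF assms deg_lft]] that B(3) by force
  then show ?thesis by (simp add: deg_def avg_def)
qed

lemma ac_avg:
  assumes "ac u"
  shows "ac (avg n u)"
  unfolding avg_def[abs_def]
proof (intro ac_sum ac_cmult)
  fix w assume "w \<in> B n"
  then have w: "w \<in> \<Gamma>" using B(3) by blast
  show "ac (\<lambda>t. u (lft w t))"
    by (rule ac_compose[OF assms lift_strict_mono[OF diffeo lft] lift_continuous[OF lft]
          lift_locally_lipschitz[OF diffeo lft]]) (rule w)+
qed

lemma ln_deriv_lift:
  assumes g: "g \<in> \<Gamma>"
  obtains C where "var_le (\<lambda>t. ln (circle_deriv g (circ t))) C"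
proof -
  have "circle_var (\<lambda>x. ln (circle_deriv g x)) < \<infinity>" using C1bv[OF g] by (simp add: circle_C1bv_diffeo_def)
  then show thesis by (rule circle_var_finite) (rule that)
qed

lemma aperiodic_lift_lft:
  assumes g: "g \<in> \<Gamma>" "g \<noteq> id" and V: "var_le (\<lambda>t. ln (circle_deriv g (circ t))) V"
  shows "aperiodic_lift (lft g) (\<lambda>t. ln (circle_deriv g (circ t))) V"
proof
  show "deg 1 (lft g)" by (rule deg_lft[OF g(1)])
  show "(lft g has_real_derivative exp (ln (circle_deriv g (circ t)))) (at t)" for t
    using circle_diffeo_deriv[OF diffeo lft] circle_diffeo_deriv_pos[OF diffeo] g by simp
  show "deg 0 (\<lambda>t. ln (circle_deriv g (circ t)))" by (rule deg_circ)
  show "var_le (\<lambda>t. ln (circle_deriv g (circ t))) V" by (rule V)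
  fix n :: nat and m :: int and t assume n: "0 < n"
  have pow: "g ^^ Suc j \<in> \<Gamma>" for j
  proof (induction j)
    case (Suc j)
    show ?case using comp_closed[OF g(1) Suc] by (simp only: funpow.simps(2))
  qed (simp add: g)
  obtain j where "n = Suc j" using n by (cases n) auto
  then have "(g ^^ n) (circ t) \<noteq> circ t"
    using fixed_point_free[OF pow torsion_free[OF g]] by auto
  then show "(lft g ^^ n) t \<noteq> t + of_int m"
    using is_lift_funpow[OF lft[OF g(1)], of n] by (metis circ_add_int is_lift_def)
qed

text \<open>Three summands: the approximation error e, the coboundaries b i (T i - T i \<circ> F^i),
  which vanish in the limit, and the pulled back combination, which carries the contracted
  bound.\<close>

lemma limvar_contract:
  assumes g: "g \<in> \<Gamma>" "g \<noteq> id" and V: "var_le (\<lambda>t. ln (circle_deriv g (circ t))) V"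
    and u: "ac u" "var_le u C" "deg 0 u"
  shows "limvar u ((1 - aperiodic_lift.overlap V) * C)"
proof (rule limvar_closed)
  interpret aperiodic_lift "lft g" "\<lambda>t. ln (circle_deriv g (circ t))" V
    by (rule aperiodic_lift_lft[OF g V])
  fix e :: real assume "0 < e"
  obtain n b T where T: "var_le (\<lambda>t. u t - (\<Sum>i<n. b i * T i t)) e"
    "\<And>i. i < n \<Longrightarrow> mono (T i)" "\<And>i. deg 1 (T i)"
    "var_le (\<lambda>t. \<Sum>i<n. b i * T i ((lft g ^^ i) t)) ((1 - overlap) * C)"
    by (rule variation_contraction[OF u \<open>0 < e\<close>]) (rule that)
  have "limvar (\<lambda>t. \<Sum>i<n. b i * (T i t - T i ((lft g ^^ i) t))) 0"
    using T(2,3) by (intro limvar_sum_zero limvar_cmult limvar_coboundary_funpow[OF g(1), of 1 _ 1] var_le_monotone) auto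
  from limvar_add[OF limvar_add[OF limvar_var[OF T(1)] this] limvar_var[OF T(4)]]
  show "limvar u ((1 - overlap) * C + e)"
    by (simp add: right_diff_distrib sum_subtractf add.commute)
qed

lemma limvar_zero:
  assumes g: "g \<in> \<Gamma>" "g \<noteq> id" and u: "ac u" "var_le u C" "deg 0 u"
  shows "limvar u 0"
proof -
  obtain V where V: "var_le (\<lambda>t. ln (circle_deriv g (circ t))) V" using ln_deriv_lift[OF g(1)] .
  interpret aperiodic_lift "lft g" "\<lambda>t. ln (circle_deriv g (circ t))" V
    by (rule aperiodic_lift_lft[OF g V])
  have step: "limvar u ((1 - overlap) * D)" if D: "limvar u D" for D
  proof (rule limvar_closed)
    fix e :: real assume "0 < e"
    then have "\<forall>\<^sub>F n in sequentially. var_le (avg n u) (D + e)" using D by (simp add: limvar_def)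
    then obtain m where m: "var_le (avg m u) (D + e)" by (auto simp: eventually_sequentially)
    have "limvar (avg m u) ((1 - overlap) * (D + e))"
      by (rule limvar_contract[OF g V ac_avg[OF u(1)] m deg_avg[OF u(3)]])
    from limvar_add[OF limvar_avg[OF u(3,2), of m] this]
    have "limvar u ((1 - overlap) * (D + e))" by simp
    moreover have "(1 - overlap) * (D + e) \<le> (1 - overlap) * D + e"
      using overlap_pos \<open>0 < e\<close> by (simp add: algebra_simps)
    ultimately show "limvar u ((1 - overlap) * D + e)" by (rule limvar_mono)
  qed
  have iter: "limvar u ((1 - overlap) ^ j * C)" for j
  proof (induction j)
    case 0
    then show ?case using limvar_var[OF u(2)] by simp
  next
    case (Suc j)
    then show ?case using step[OF Suc] by (simp add: mult.assoc)
  qed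
  show ?thesis
  proof (rule limvar_closed)
    fix e :: real assume e: "0 < e"
    have "(\<lambda>j. (1 - overlap) ^ j * C) \<longlonglongrightarrow> 0 * C"
      using overlap_pos overlap_less_1 by (intro tendsto_mult LIMSEQ_realpow_zero tendsto_const) auto
    then have "\<forall>\<^sub>F j in sequentially. (1 - overlap) ^ j * C < e" using e by (intro order_tendstoD) auto
    then obtain j where "(1 - overlap) ^ j * C < e" by (auto simp: eventually_sequentially)
    then show "limvar u (0 + e)"
      by (intro limvar_mono[OF iter[of j]]) simp
  qed
qed

text \<open>The derivative is bounded below by its positive minimum, where the logarithm is
  Lipschitz, so absolute continuity passes to the logarithm. The identity has no aperiodic lift and
  is treated apart.\<close>

lemma limvar_ln_deriv:
  assumes g: "g \<in> \<Gamma>"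
  shows "limvar (\<lambda>t. ln (circle_deriv g (circ t))) 0"
proof (cases "g = id")
  case True
  then show ?thesis by (simp add: circle_deriv_id limvar_var var_le_const)
next
  case False
  define D where "D t = circle_deriv g (circ t)" for t
  have pos: "0 < D t" for t unfolding D_def by (rule circle_diffeo_deriv_pos[OF diffeo[OF g]])
  obtain t0 where min: "\<And>t. D t0 \<le> D t"
    using periodic_attains_min[OF deg_circ continuous_circle_deriv[OF diffeo[OF g]]] unfolding D_def by blast
  have "\<bar>ln s - ln t\<bar> \<le> (1 / D t0) * \<bar>s - t\<bar>" if "s \<in> {D t0..}" "t \<in> {D t0..}" for s t
  proof -
    have st: "0 < s" "0 < t" "D t0 \<le> s" "D t0 \<le> t" using that pos[of t0] by auto
    have le: "ln a - ln b \<le> \<bar>a - b\<bar> / D t0" if "D t0 \<le> b" "0 < a" "0 < b" for a b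
    proof -
      have "ln a - ln b \<le> (a - b) / b" using ln_diff_le that by blast
      also have "\<dots> \<le> \<bar>a - b\<bar> / b" using that by (intro divide_right_mono) auto
      also have "\<dots> \<le> \<bar>a - b\<bar> / D t0" using that pos[of t0] by (intro divide_left_mono) auto
      finally show ?thesis .
    qed
    show ?thesis using le[of t s] le[of s t] st by (simp add: abs_minus_commute abs_le_iff)
  qed
  then have "ac (\<lambda>t. ln (D t))"
  proof (rule ac_lipschitz_compose[rotated 2])
    show "ac D" using abs_cont[OF g] unfolding ac_def circle_abs_cont_def D_def[abs_def] .
    show "0 < 1 / D t0" using pos[of t0] by simp
    show "D t \<in> {D t0..}" for t using min[of t] by simp
  qed
  moreover obtain C where "var_le (\<lambda>t. ln (D t)) C" using ln_deriv_lift[OF g] unfolding D_def .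
  ultimately show ?thesis
    using limvar_zero[OF g False, of "\<lambda>t. ln (D t)" C] deg_circ[of "\<lambda>x. ln (circle_deriv g x)"] by (simp add: D_def)
qed

end

section \<open>Word boxes\<close>

lemma comp_group_simps:
  "carrier (comp_group \<Gamma>) = \<Gamma>" "\<one>\<^bsub>comp_group \<Gamma>\<^esub> = id" "g \<otimes>\<^bsub>comp_group \<Gamma>\<^esub> h = g \<circ> h"
  by (simp_all add: comp_group_def)

text \<open>c is an isomorphism onto the integer lattice, read in coordinates. The generators need
  not correspond to the standard basis: c (f j) i is some integer matrix.\<close>

locale zk_circle_group =
  fixes \<Gamma> :: "(circle \<Rightarrow> circle) set" and k :: nat and f :: "nat \<Rightarrow> circle \<Rightarrow> circle"
    and c :: "(circle \<Rightarrow> circle) \<Rightarrow> nat \<Rightarrow> int"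
  assumes grp: "group (comp_group \<Gamma>)"
    and gens: "f ` {1..k} \<subseteq> \<Gamma>"
    and gen: "generate (comp_group \<Gamma>) (f ` {1..k}) = \<Gamma>"
    and coord_inj: "\<And>g h. g \<in> \<Gamma> \<Longrightarrow> h \<in> \<Gamma> \<Longrightarrow> (\<And>i. i \<in> {1..k} \<Longrightarrow> c g i = c h i) \<Longrightarrow> g = h"
    and coord_surj: "\<And>z. \<exists>g\<in>\<Gamma>. \<forall>i\<in>{1..k}. c g i = z i"
    and coord_comp: "\<And>g h i. g \<in> \<Gamma> \<Longrightarrow> h \<in> \<Gamma> \<Longrightarrow> i \<in> {1..k} \<Longrightarrow> c (g \<circ> h) i = c g i + c h i"
begin

lemma id_mem: "id \<in> \<Gamma>"
  using monoid.one_closed[OF group.is_monoid[OF grp]] by (simp add: comp_group_def)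

lemma comp_mem: "g \<in> \<Gamma> \<Longrightarrow> h \<in> \<Gamma> \<Longrightarrow> g \<circ> h \<in> \<Gamma>"
  using monoid.m_closed[OF group.is_monoid[OF grp], of g h] by (simp add: comp_group_def)

lemma inv_mem:
  assumes "g \<in> \<Gamma>"
  shows "inv\<^bsub>comp_group \<Gamma>\<^esub> g \<in> \<Gamma>" "inv\<^bsub>comp_group \<Gamma>\<^esub> g \<circ> g = id" "g \<circ> inv\<^bsub>comp_group \<Gamma>\<^esub> g = id"
  using group.inv_closed[OF grp, of g] group.l_inv[OF grp, of g] group.r_inv[OF grp, of g] assms
  by (simp_all add: comp_group_def)

lemma gen_mem: "j \<in> {1..k} \<Longrightarrow> f j \<in> \<Gamma>"
  using gens by blast

lemma comp_commute: "g \<in> \<Gamma> \<Longrightarrow> h \<in> \<Gamma> \<Longrightarrow> g \<circ> h = h \<circ> g"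
  by (rule coord_inj) (auto simp: coord_comp comp_mem)

lemma coord_id: "i \<in> {1..k} \<Longrightarrow> c id i = 0"
  using coord_comp[OF id_mem id_mem, of i] by simp

lemma funpow_mem: "g \<in> \<Gamma> \<Longrightarrow> g ^^ n \<in> \<Gamma>"
proof (induction n)
  case (Suc n)
  then show ?case using comp_mem[of g "g ^^ n"] by (simp only: funpow.simps(2))
qed (simp add: id_mem)

lemma coord_funpow: "g \<in> \<Gamma> \<Longrightarrow> i \<in> {1..k} \<Longrightarrow> c (g ^^ n) i = int n * c g i"
proof (induction n)
  case (Suc n)
  have eq: "c (g ^^ Suc n) i = c g i + c (g ^^ n) i"
    unfolding funpow.simps(2) using Suc.prems by (intro coord_comp funpow_mem)
  show ?case unfolding eq using Suc by (simp add: algebra_simps)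
qed (simp add: coord_id)

lemma funpow_neq_id:
  assumes "g \<in> \<Gamma>" "g \<noteq> id" "0 < n"
  shows "g ^^ n \<noteq> id"
proof
  assume "g ^^ n = id"
  have "c g i = c id i" if "i \<in> {1..k}" for i
    using coord_funpow[OF assms(1) that, of n] coord_id[OF that] assms(3) \<open>g ^^ n = id\<close> by simp
  then have "g = id" using assms(1) id_mem coord_inj by blast
  then show False using assms by simp
qed

lemma word_mem_coord:
  shows "power_word k f m \<in> \<Gamma>"
    and "i \<in> {1..k} \<Longrightarrow> c (power_word k f m) i = (\<Sum>j\<in>{1..k}. int (m j) * c (f j) i)"
proof -
  have *: "foldr (\<circ>) (map (\<lambda>i. f i ^^ m i) xs) id \<in> \<Gamma> \<and>
      (\<forall>i\<in>{1..k}. c (foldr (\<circ>) (map (\<lambda>i. f i ^^ m i) xs) id) i = (\<Sum>j\<leftarrow>xs. int (m j) * c (f j) i))"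
    if "set xs \<subseteq> {1..k}" for xs
    using that
  proof (induction xs)
    case Nil
    then show ?case using id_mem coord_id by (simp add: id_def)
  next
    case (Cons x xs)
    then have x: "f x \<in> \<Gamma>" "f x ^^ m x \<in> \<Gamma>" by (auto intro!: gen_mem funpow_mem)
    define w where "w = foldr (\<circ>) (map (\<lambda>i. f i ^^ m i) xs) id"
    have w: "w \<in> \<Gamma>" "\<forall>i\<in>{1..k}. c w i = (\<Sum>j\<leftarrow>xs. int (m j) * c (f j) i)"
      using Cons.IH Cons.prems unfolding w_def set_simps by blast+
    have "foldr (\<circ>) (map (\<lambda>i. f i ^^ m i) (x # xs)) id = (f x ^^ m x) \<circ> w" by (simp add: w_def)
    moreover have "c ((f x ^^ m x) \<circ> w) i = (\<Sum>j\<leftarrow>x # xs. int (m j) * c (f j) i)" if "i \<in> {1..k}" for i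
      unfolding coord_comp[OF x(2) w(1) that] coord_funpow[OF x(1) that] using w(2) that by simp
    ultimately show ?case using comp_mem[OF x(2) w(1)] by (simp only:) blast
  qed
  have "set [1..<Suc k] \<subseteq> {1..k}" by auto
  note * = *[OF this, folded power_word_def]
  then show "power_word k f m \<in> \<Gamma>" by blast
  assume "i \<in> {1..k}"
  then have "c (power_word k f m) i = (\<Sum>j\<leftarrow>[1..<Suc k]. int (m j) * c (f j) i)" using * by blast
  also have "\<dots> = (\<Sum>j\<in>{1..k}. int (m j) * c (f j) i)"
    by (subst sum_list_distinct_conv_sum_set) (auto intro!: sum.cong)
  finally show "c (power_word k f m) i = (\<Sum>j\<in>{1..k}. int (m j) * c (f j) i)" .
qed

text \<open>Stated for coordinates since inverses of generators produce negative exponents, which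
  \<open>power_word\<close> does not have; they become natural after reduction modulo N.\<close>

lemma word_coord_exists:
  assumes "g \<in> \<Gamma>"
  shows "\<exists>m::nat \<Rightarrow> int. \<forall>i\<in>{1..k}. c g i = (\<Sum>j\<in>{1..k}. m j * c (f j) i)"
proof -
  have "g \<in> generate (comp_group \<Gamma>) (f ` {1..k})" using assms gen by simp
  then have "g \<in> \<Gamma> \<and> (\<exists>m::nat \<Rightarrow> int. \<forall>i\<in>{1..k}. c g i = (\<Sum>j\<in>{1..k}. m j * c (f j) i))"
  proof (induction rule: generate.induct)
    case one
    have "\<forall>i\<in>{1..k}. c id i = (\<Sum>j\<in>{1..k}. 0 * c (f j) i)" using coord_id by simp
    then show ?case unfolding comp_group_simps using id_mem by (intro conjI exI[of _ "\<lambda>_. 0"])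
  next
    case (incl h)
    then obtain l where l: "l \<in> {1..k}" "h = f l" by blast
    have "c h i = (\<Sum>j\<in>{1..k}. (if j = l then 1 else 0) * c (f j) i)" for i
    proof -
      have "(\<Sum>j\<in>{1..k}. (if j = l then 1 else 0) * c (f j) i) = (\<Sum>j\<in>{1..k}. if j = l then c (f j) i else 0)"
        by (intro sum.cong) auto
      then show ?thesis using l by simp
    qed
    then show ?case using l gen_mem by (intro conjI exI[of _ "\<lambda>j. if j = l then 1 else 0"]) auto
  next
    case (inv h)
    then obtain l where l: "l \<in> {1..k}" "h = f l" by blast
    have h: "h \<in> \<Gamma>" using l gen_mem by simp
    have "c (inv\<^bsub>comp_group \<Gamma>\<^esub> h) i = (\<Sum>j\<in>{1..k}. (if j = l then - 1 else 0) * c (f j) i)" if i: "i \<in> {1..k}" for i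
    proof -
      have "(\<Sum>j\<in>{1..k}. (if j = l then - 1 else 0) * c (f j) i) = (\<Sum>j\<in>{1..k}. if j = l then - c (f j) i else 0)"
        by (intro sum.cong) auto
      moreover have "c (inv\<^bsub>comp_group \<Gamma>\<^esub> h) i + c h i = 0"
        using coord_comp[OF inv_mem(1)[OF h] h i] coord_id[OF i] by (simp only: inv_mem(2)[OF h])
      ultimately show ?thesis using l by simp
    qed
    then show ?case using inv_mem(1)[OF h] by (intro conjI exI[of _ "\<lambda>j. if j = l then - 1 else 0"]) auto
  next
    case (eng h1 h2)
    then obtain m1 m2 :: "nat \<Rightarrow> int" where m: "\<forall>i\<in>{1..k}. c h1 i = (\<Sum>j\<in>{1..k}. m1 j * c (f j) i)"
      "\<forall>i\<in>{1..k}. c h2 i = (\<Sum>j\<in>{1..k}. m2 j * c (f j) i)" and h: "h1 \<in> \<Gamma>" "h2 \<in> \<Gamma>" by blast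
    have "\<forall>i\<in>{1..k}. c (h1 \<circ> h2) i = (\<Sum>j\<in>{1..k}. (m1 j + m2 j) * c (f j) i)"
      using m h by (simp add: coord_comp distrib_right sum.distrib)
    then show ?case unfolding comp_group_simps using comp_mem[OF h]
      by (intro conjI exI[of _ "\<lambda>j. m1 j + m2 j"])
  qed
  then show ?thesis by blast
qed

definition exponents :: "nat \<Rightarrow> (nat \<Rightarrow> nat) set" where
  "exponents n = {1..k} \<rightarrow>\<^sub>E {..<n}"

lemma card_exponents: "card (exponents n) = n ^ k" and finite_exponents: "finite (exponents n)"
  unfolding exponents_def by (simp_all add: card_PiE finite_PiE)

text \<open>Modulo \<open>N\<close>, the words with exponents below \<open>N\<close> already exhaust the \<open>N\<^sup>k\<close> elements of
  \<open>(\<int>/N\<int>)\<^sup>k\<close>; as there are only \<open>N\<^sup>k\<close> such words, they are pairwise different.\<close>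

lemma inj_on_power_word: "inj_on (power_word k f) (exponents N)"
proof (cases "N = 0")
  case False
  then have N: "0 < int N" by simp
  define \<rho> where "\<rho> m = (\<lambda>i\<in>{1..k}. c (power_word k f m) i mod int N)" for m
  define Z where "Z = {1..k} \<rightarrow>\<^sub>E {0..<int N}"
  have "Z \<subseteq> \<rho> ` exponents N"
  proof
    fix z assume z: "z \<in> Z"
    obtain g where g: "g \<in> \<Gamma>" "\<And>i. i \<in> {1..k} \<Longrightarrow> c g i = z i" using coord_surj[of z] by blast
    obtain M :: "nat \<Rightarrow> int" where M: "\<And>i. i \<in> {1..k} \<Longrightarrow> c g i = (\<Sum>j\<in>{1..k}. M j * c (f j) i)"
      using word_coord_exists[OF g(1)] by blast
    define m where "m = (\<lambda>j\<in>{1..k}. nat (M j mod int N))"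
    have "m \<in> exponents N" using N by (auto simp: m_def exponents_def nat_less_iff)
    moreover have "\<rho> m = z"
    proof
      fix i show "\<rho> m i = z i"
      proof (cases "i \<in> {1..k}")
        case True
        have "\<rho> m i = (\<Sum>j\<in>{1..k}. int (m j) * c (f j) i) mod int N"
          using True by (simp add: \<rho>_def word_mem_coord(2))
        also have "\<dots> = (\<Sum>j\<in>{1..k}. (M j mod int N) * c (f j) i) mod int N"
          using N by (intro arg_cong[of _ _ "\<lambda>x. x mod int N"] sum.cong) (auto simp: m_def)
        also have "\<dots> = (\<Sum>j\<in>{1..k}. ((M j mod int N) * c (f j) i) mod int N) mod int N"
          by (simp only: mod_sum_eq)
        also have "\<dots> = (\<Sum>j\<in>{1..k}. (M j * c (f j) i) mod int N) mod int N"
          by (simp only: mod_mult_left_eq)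
        also have "\<dots> = c g i mod int N" using M[OF True] by (simp only: mod_sum_eq)
        also have "\<dots> = z i" using g(2)[OF True] z True by (auto simp: Z_def PiE_iff)
        finally show ?thesis .
      qed (use z in \<open>auto simp: \<rho>_def Z_def PiE_iff extensional_def\<close>)
    qed
    ultimately show "z \<in> \<rho> ` exponents N" by blast
  qed
  then have "card Z \<le> card (\<rho> ` exponents N)" by (intro card_mono finite_imageI finite_exponents)
  moreover have "card Z = card (exponents N)" by (simp add: Z_def card_PiE card_exponents)
  moreover have "card (\<rho> ` exponents N) \<le> card (exponents N)" by (intro card_image_le finite_exponents)
  ultimately have "inj_on \<rho> (exponents N)" by (intro eq_card_imp_inj_on finite_exponents) simp
  then show ?thesis unfolding inj_on_def \<rho>_def by metis
qed (auto simp: exponents_def inj_on_def PiE_iff extensional_def fun_eq_iff; force)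

lemma power_word_cong: "(\<And>i. i \<in> {1..k} \<Longrightarrow> m i = m' i) \<Longrightarrow> power_word k f m = power_word k f m'"
  unfolding power_word_def by (intro arg_cong[of _ _ "\<lambda>xs. foldr (\<circ>) xs id"] map_cong) auto

lemma word_box_eq: "word_box k f n = power_word k f ` exponents (Suc n)"
proof
  show "word_box k f n \<subseteq> power_word k f ` exponents (Suc n)"
  proof
    fix w assume "w \<in> word_box k f n"
    then obtain m where m: "w = power_word k f m" "\<forall>i\<in>{1..k}. m i \<le> n" by (auto simp: word_box_def)
    have "w = power_word k f (restrict m {1..k})" unfolding m(1) by (intro power_word_cong) simp
    moreover have "restrict m {1..k} \<in> exponents (Suc n)" using m(2) by (auto simp: exponents_def less_Suc_eq_le)
    ultimately show "w \<in> power_word k f ` exponents (Suc n)" by blast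
  qed
  show "power_word k f ` exponents (Suc n) \<subseteq> word_box k f n"
    by (force simp: word_box_def exponents_def PiE_iff less_Suc_eq_le)
qed

lemma card_word_box: "card (word_box k f n) = Suc n ^ k"
  by (simp add: word_box_eq card_image[OF inj_on_power_word] card_exponents)

lemma word_box_basic:
  shows finite_word_box: "finite (word_box k f n)" and word_box_nonempty: "word_box k f n \<noteq> {}"
    and word_box_subset: "word_box k f n \<subseteq> \<Gamma>"
proof -
  show "finite (word_box k f n)" by (simp add: word_box_eq finite_exponents)
  show "word_box k f n \<noteq> {}" using card_word_box[of n] by auto
  show "word_box k f n \<subseteq> \<Gamma>" by (auto simp: word_box_def word_mem_coord(1))
qed

text \<open>Composition with f l leaves the box only if the l-th exponent was already n, which is
  the case for one word in n + 1.\<close>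

lemma folner_generator:
  assumes l: "l \<in> {1..k}"
  shows "real (card ((\<circ>) (f l) ` word_box k f n - word_box k f n)) / real (card (word_box k f n)) \<le> 1 / real (Suc n)"
proof -
  \<comment> \<open>Exponents of the words that have just left the box: n + 1 at l, at most n
    elsewhere.\<close>
  define X where "X = PiE {1..k} (\<lambda>j. if j = l then {Suc n} else {..n})"
  have "(\<circ>) (f l) ` word_box k f n - word_box k f n \<subseteq> power_word k f ` X"
  proof
    fix v assume v: "v \<in> (\<circ>) (f l) ` word_box k f n - word_box k f n"
    then obtain m where m: "m \<in> exponents (Suc n)" "v = f l \<circ> power_word k f m"
      unfolding word_box_eq by blast
    define m' where "m' = m(l := Suc (m l))"
    have "v = power_word k f m'"
    proof (rule coord_inj)
      show "v \<in> \<Gamma>" using m(2) comp_mem[OF gen_mem[OF l] word_mem_coord(1)] by simp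
      show "power_word k f m' \<in> \<Gamma>" by (rule word_mem_coord)
      fix i assume i: "i \<in> {1..k}"
      have "c v i = c (f l) i + (\<Sum>j\<in>{1..k}. int (m j) * c (f j) i)"
        using coord_comp[OF gen_mem[OF l] word_mem_coord(1) i] word_mem_coord(2)[OF i] m(2) by simp
      also have "c (f l) i = (\<Sum>j\<in>{1..k}. if j = l then c (f j) i else 0)" using l by simp
      also have "\<dots> + (\<Sum>j\<in>{1..k}. int (m j) * c (f j) i) = (\<Sum>j\<in>{1..k}. int (m' j) * c (f j) i)"
        unfolding sum.distrib[symmetric] by (intro sum.cong) (auto simp: m'_def algebra_simps)
      finally show "c v i = c (power_word k f m') i" using word_mem_coord(2)[OF i] by simp
    qed
    moreover have "m' \<in> X"
    proof -
      have "m l = n"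
      proof (rule ccontr)
        assume "m l \<noteq> n"
        moreover have "m l < Suc n" using m(1) l by (auto simp: exponents_def PiE_iff)
        ultimately have "Suc (m l) < Suc n" by simp
        then have "m' \<in> exponents (Suc n)" using m(1) l by (auto simp: m'_def exponents_def PiE_iff extensional_def)
        then have "v \<in> word_box k f n" using \<open>v = power_word k f m'\<close> by (simp add: word_box_eq)
        then show False using v by blast
      qed
      then show ?thesis using m(1) l by (auto simp: X_def m'_def exponents_def PiE_iff extensional_def less_Suc_eq_le)
    qed
    ultimately show "v \<in> power_word k f ` X" by blast
  qed
  moreover have "finite X" unfolding X_def by (intro finite_PiE) auto
  ultimately have "card ((\<circ>) (f l) ` word_box k f n - word_box k f n) \<le> card X"
    by (meson card_image_le card_mono finite_imageI order_trans)
  also have "card X = (\<Prod>j\<in>{1..k}. card (if j = l then {Suc n} else {..n}))"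
    unfolding X_def by (intro card_PiE) auto
  also have "\<dots> = (\<Prod>j\<in>{1..k} - {l}. card (if j = l then {Suc n} else {..n}))"
    using l by (subst prod.remove[of _ l]) auto
  also have "\<dots> = (\<Prod>j\<in>{1..k} - {l}. Suc n)" by (intro prod.cong) auto
  also have "\<dots> = Suc n ^ (k - 1)" using l by (simp add: card_Diff_singleton)
  finally have "real (card ((\<circ>) (f l) ` word_box k f n - word_box k f n)) \<le> real (Suc n ^ (k - 1))" by linarith
  then have "real (card ((\<circ>) (f l) ` word_box k f n - word_box k f n)) / real (card (word_box k f n))
      \<le> real (Suc n ^ (k - 1)) / real (Suc n ^ k)"
    unfolding card_word_box by (intro divide_right_mono) auto
  also have "\<dots> = 1 / real (Suc n)"
  proof -
    obtain k' where "k = Suc k'" using l by (cases k) auto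
    moreover define s where "s = real (Suc n)"
    moreover have "s \<noteq> 0" by (simp add: s_def)
    ultimately show ?thesis by (simp only: of_nat_power s_def[symmetric]) simp
  qed
  finally show ?thesis .
qed

definition folner_ratio :: "(circle \<Rightarrow> circle) \<Rightarrow> nat \<Rightarrow> real" where
  "folner_ratio g n = real (card ((\<circ>) g ` word_box k f n - word_box k f n)) / real (card (word_box k f n))"

lemma inj_comp_left: "g \<in> \<Gamma> \<Longrightarrow> inj_on ((\<circ>) g) A"
proof (rule inj_onI)
  fix v w assume g: "g \<in> \<Gamma>" and "g \<circ> v = g \<circ> w"
  then have "inv\<^bsub>comp_group \<Gamma>\<^esub> g \<circ> (g \<circ> v) = inv\<^bsub>comp_group \<Gamma>\<^esub> g \<circ> (g \<circ> w)" by (simp only:)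
  then show "v = w" by (simp only: comp_assoc[symmetric] inv_mem(2)[OF g] id_comp)
qed

text \<open>Left composition with g carries the part of the translate by the inverse outside the box
  W onto W - g W, which is as large as g W - W because g W and W have equal size.\<close>

lemma folner_ratio_inv:
  assumes g: "g \<in> \<Gamma>"
  shows "folner_ratio (inv\<^bsub>comp_group \<Gamma>\<^esub> g) n = folner_ratio g n"
proof -
  define W where "W = word_box k f n"
  define g' where "g' = inv\<^bsub>comp_group \<Gamma>\<^esub> g"
  have g': "g' \<in> \<Gamma>" "g \<circ> g' = id" using inv_mem[OF g] by (simp_all add: g'_def)
  have fin: "finite W" "finite ((\<circ>) g ` W)" using finite_word_box by (simp_all add: W_def)
  have "(\<circ>) g ` ((\<circ>) g' ` W - W) = (\<circ>) g ` (\<circ>) g' ` W - (\<circ>) g ` W"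
    by (rule image_set_diff[OF inj_comp_left[OF g]])
  also have "(\<circ>) g ` (\<circ>) g' ` W = W"
    unfolding image_image comp_assoc[symmetric] g'(2) by simp
  finally have eq: "(\<circ>) g ` ((\<circ>) g' ` W - W) = W - (\<circ>) g ` W" .
  have "card ((\<circ>) g' ` W - W) = card (W - (\<circ>) g ` W)"
    using card_image[OF inj_comp_left[OF g], of "(\<circ>) g' ` W - W"] by (simp only: eq)
  moreover have "card W = card (W \<inter> (\<circ>) g ` W) + card (W - (\<circ>) g ` W)" by (rule card_Int_Diff[OF fin(1)])
  moreover have "card ((\<circ>) g ` W) = card ((\<circ>) g ` W \<inter> W) + card ((\<circ>) g ` W - W)" by (rule card_Int_Diff[OF fin(2)])
  moreover have "card ((\<circ>) g ` W) = card W" by (rule card_image[OF inj_comp_left[OF g]])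
  moreover have "card ((\<circ>) g ` W \<inter> W) = card (W \<inter> (\<circ>) g ` W)" by (simp only: Int_commute)
  ultimately have "card ((\<circ>) g' ` W - W) = card ((\<circ>) g ` W - W)" by linarith
  then show ?thesis unfolding folner_ratio_def W_def g'_def by (simp only:)
qed

lemma folner_ratio_comp:
  assumes g: "g \<in> \<Gamma>" "h \<in> \<Gamma>"
  shows "folner_ratio (g \<circ> h) n \<le> folner_ratio g n + folner_ratio h n"
proof -
  define W where "W = word_box k f n"
  have fin: "finite W" using finite_word_box by (simp add: W_def)
  have "(\<circ>) (g \<circ> h) ` W - W \<subseteq> (\<circ>) g ` ((\<circ>) h ` W - W) \<union> ((\<circ>) g ` W - W)"
    by (auto simp: comp_assoc)
  then have "card ((\<circ>) (g \<circ> h) ` W - W) \<le> card ((\<circ>) g ` ((\<circ>) h ` W - W) \<union> ((\<circ>) g ` W - W))"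
    using fin by (intro card_mono) auto
  also have "\<dots> \<le> card ((\<circ>) g ` ((\<circ>) h ` W - W)) + card ((\<circ>) g ` W - W)" by (rule card_Un_le)
  also have "\<dots> \<le> card ((\<circ>) h ` W - W) + card ((\<circ>) g ` W - W)" using fin by (intro add_right_mono card_image_le) auto
  finally have "real (card ((\<circ>) (g \<circ> h) ` W - W)) \<le> real (card ((\<circ>) g ` W - W)) + real (card ((\<circ>) h ` W - W))"
    by linarith
  then have "real (card ((\<circ>) (g \<circ> h) ` W - W)) / real (card W)
      \<le> (real (card ((\<circ>) g ` W - W)) + real (card ((\<circ>) h ` W - W))) / real (card W)"
    by (rule divide_right_mono) simp
  then show ?thesis by (simp add: folner_ratio_def W_def add_divide_distrib)
qed

lemma folner_ratio_tendsto:
  assumes "g \<in> \<Gamma>"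
  shows "folner_ratio g \<longlonglongrightarrow> 0"
proof -
  have nn: "0 \<le> folner_ratio h n" for h n by (simp add: folner_ratio_def)
  have gen0: "folner_ratio (f l) \<longlonglongrightarrow> 0" if "l \<in> {1..k}" for l
  proof (rule tendsto_sandwich[OF _ _ tendsto_const])
    show "\<forall>\<^sub>F n in sequentially. folner_ratio (f l) n \<le> 1 / real (Suc n)"
      using folner_generator[OF that] by (simp add: folner_ratio_def del: of_nat_Suc)
    show "(\<lambda>n. 1 / real (Suc n)) \<longlonglongrightarrow> 0" using LIMSEQ_inverse_real_of_nat by (simp add: inverse_eq_divide)
  qed (simp add: nn)
  have "g \<in> generate (comp_group \<Gamma>) (f ` {1..k})" using assms gen by simp
  then have "g \<in> \<Gamma> \<and> folner_ratio g \<longlonglongrightarrow> 0"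
  proof (induction rule: generate.induct)
    case one
    have "folner_ratio id = (\<lambda>n. 0)" by (simp add: folner_ratio_def fun_eq_iff)
    then have "folner_ratio id \<longlonglongrightarrow> 0" by (simp only: tendsto_const)
    then show ?case unfolding comp_group_simps using id_mem by blast
  next
    case (incl h)
    then show ?case using gen0 gen_mem by blast
  next
    case (inv h)
    then have h: "h \<in> \<Gamma>" "folner_ratio h \<longlonglongrightarrow> 0" using gen0 gen_mem by auto
    have "folner_ratio (inv\<^bsub>comp_group \<Gamma>\<^esub> h) = folner_ratio h"
      by (rule ext) (rule folner_ratio_inv[OF h(1)])
    then show ?case using h inv_mem(1)[OF h(1)] by simp
  next
    case (eng h1 h2)
    have "(\<lambda>n. folner_ratio h1 n + folner_ratio h2 n) \<longlonglongrightarrow> 0 + 0"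
      using eng.IH by (intro tendsto_add) auto
    then have lim: "(\<lambda>n. folner_ratio h1 n + folner_ratio h2 n) \<longlonglongrightarrow> 0" by simp
    have "folner_ratio (h1 \<circ> h2) \<longlonglongrightarrow> 0"
      by (rule tendsto_sandwich[OF _ _ tendsto_const lim]) (use nn folner_ratio_comp eng.IH in auto)
    then show ?case unfolding comp_group_simps using comp_mem eng.IH by blast
  qed
  then show ?thesis by blast
qed

end

lemma zk_circle_group_exists:
  assumes grp: "group (comp_group \<Gamma>)" and iso: "comp_group \<Gamma> \<cong> Zk k"
    and gens: "f ` {1..k} \<subseteq> \<Gamma>" and gen: "generate (comp_group \<Gamma>) (f ` {1..k}) = \<Gamma>"
  obtains c where "zk_circle_group \<Gamma> k f c"
proof -
  obtain c where "c \<in> iso (comp_group \<Gamma>) (Zk k)" using iso by (auto simp: is_iso_def)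
  then have hom: "c \<in> hom (comp_group \<Gamma>) (Zk k)" and bij: "bij_betw c \<Gamma> ({1..k} \<rightarrow>\<^sub>E UNIV)"
    by (auto simp: iso_def Zk_def comp_group_def)
  have "zk_circle_group \<Gamma> k f c"
  proof (rule zk_circle_group.intro)
    show "group (comp_group \<Gamma>)" "f ` {1..k} \<subseteq> \<Gamma>" "generate (comp_group \<Gamma>) (f ` {1..k}) = \<Gamma>" by fact+
    fix g h assume g: "g \<in> \<Gamma>" "h \<in> \<Gamma>"
    have ext: "c g \<in> extensional {1..k}" "c h \<in> extensional {1..k}"
      using bij g by (auto simp: bij_betw_def PiE_def)
    show "g = h" if "\<And>i. i \<in> {1..k} \<Longrightarrow> c g i = c h i"
    proof -
      have "c g = c h" using ext that by (intro extensionalityI) auto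
      then show ?thesis using bij g by (auto simp: bij_betw_def inj_on_def)
    qed
    show "c (g \<circ> h) i = c g i + c h i" if "i \<in> {1..k}" for i
    proof -
      have "c (g \<circ> h) = c g \<otimes>\<^bsub>Zk k\<^esub> c h" using hom g by (auto simp: hom_def comp_group_def)
      then show ?thesis using that by (simp add: Zk_def)
    qed
  next
    fix z :: "nat \<Rightarrow> int"
    have "restrict z {1..k} \<in> c ` \<Gamma>" using bij by (auto simp: bij_betw_def)
    then show "\<exists>g\<in>\<Gamma>. \<forall>i\<in>{1..k}. c g i = z i" by (metis imageE restrict_apply')
  qed
  then show thesis by (rule that)
qed

section \<open>Convergence of the conjugates\<close>

lemma inverse_lift:
  assumes h: "circle_diffeo h" and H: "is_lift H h"
  obtains K where "is_lift K (inv_into UNIV h)" "\<And>t. H (K t) = t" "\<And>t. K (H t) = t"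
proof -
  obtain K0 where K0: "is_lift K0 (inv_into UNIV h)"
    using circle_diffeo_lift[OF circle_diffeo_inverse(2)[OF h]] by blast
  have "bij h" using h by (simp add: circle_diffeo_def)
  then have "h \<circ> inv_into UNIV h = id" using bij_is_surj surj_iff by blast
  then have "is_lift (H \<circ> K0) id" using is_lift_comp[OF H K0] by simp
  moreover have "is_lift (\<lambda>t. t) id" by (simp add: is_lift_def)
  ultimately obtain m where m: "\<And>t. H (K0 t) = t + of_int m"
    using is_lift_unique[of "\<lambda>t. t" id "H \<circ> K0"] by auto
  \<comment> \<open>An arbitrary lift of the inverse inverts H only up to the integer m, which is
    removed in the argument.\<close>
  define K where "K t = K0 (t + of_int (- m))" for t
  have HK: "H (K t) = t" for t using m[of "t + of_int (- m)"] by (simp add: K_def)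
  have "inj H" using lift_strict_mono[OF h H] by (rule strict_mono_imp_inj_on)
  then have "K (H t) = t" for t using HK[of "H t"] by (simp add: inj_eq)
  then show thesis using that HK is_lift_shift[OF K0, of "- m"] by (simp add: K_def[abs_def])
qed

lemma circ_add: "circ s + circ t = circ (s + t)"
  by transfer (simp add: circle_rel_def)

text \<open>The lower estimate 1 - exp a <= exp e - 1 rests on exp e + exp (- e) >= 2.\<close>

lemma abs_exp_minus_1_le:
  fixes a e :: real
  assumes "\<bar>a\<bar> \<le> e"
  shows "\<bar>exp a - 1\<bar> \<le> exp e - 1"
proof -
  have "exp a \<le> exp e" "exp (- e) \<le> exp a" using assms by auto
  moreover have "1 + e \<le> exp e" "1 - e \<le> exp (- e)" using exp_ge_add_one_self[of e] exp_ge_add_one_self[of "- e"] by auto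
  moreover have "2 \<le> exp e + exp (- e)"
    using \<open>1 + e \<le> exp e\<close> \<open>1 - e \<le> exp (- e)\<close> by linarith
  ultimately show ?thesis unfolding abs_le_iff by linarith
qed

text \<open>The derivative is 1 somewhere, by the mean value theorem over a period, so small
  variation of its logarithm puts it near 1 everywhere. The displacement is then nearly constant,
  hence near its translation number.\<close>

lemma small_distortion_near_rotation:
  assumes \<Phi>: "is_lift \<Phi> F" "deg 1 \<Phi>"
    and D: "\<And>t. (\<Phi> has_real_derivative circle_deriv F (circ t)) (at t)" "\<And>x. 0 < circle_deriv F x"
    and var: "var_le (\<lambda>t. ln (circle_deriv F (circ t))) e"
    and r: "(\<lambda>n. ((\<Phi> ^^ n) 0 - 0) / real n) \<longlonglongrightarrow> r"
  shows "dist (circle_deriv F x) 1 \<le> exp e - 1" "dist (F x) (x + circ r) \<le> exp e - 1"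
proof -
  obtain z where "\<Phi> 1 - \<Phi> 0 = (1 - 0) * circle_deriv F (circ z)"
    using MVT2[of 0 1 \<Phi> "\<lambda>t. circle_deriv F (circ t)"] D by auto
  then have z: "ln (circle_deriv F (circ z)) = 0" using degD[OF \<Phi>(2), of 0] by simp
  have bound: "\<bar>circle_deriv F (circ t) - 1\<bar> \<le> exp e - 1" for t
  proof -
    have "\<bar>ln (circle_deriv F (circ t)) - ln (circle_deriv F (circ z))\<bar> \<le> e"
      by (rule var_le_osc[OF var deg_circ[of "\<lambda>x. ln (circle_deriv F x)"]])
    then have "\<bar>exp (ln (circle_deriv F (circ t))) - 1\<bar> \<le> exp e - 1"
      using z by (intro abs_exp_minus_1_le) simp
    then show ?thesis using D(2) by simp
  qed
  obtain t where t: "circ t = x" using circ_surj by blast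
  show "dist (circle_deriv F x) 1 \<le> exp e - 1" using bound[of t] t by (simp add: dist_real_def)
  have "\<bar>\<Phi> t - t - r\<bar> \<le> exp e - 1"
  proof (rule displacement_near_translation_number[OF _ r])
    fix s t
    \<comment> \<open>The displacement is periodic, so s may be moved to within distance 1 of
      t.\<close>
    define s' :: real where "s' = s + of_int \<lfloor>t - s\<rfloor>"
    have s': "\<bar>t - s'\<bar> \<le> 1" unfolding s'_def by linarith
    have eq: "\<Phi> s' - s' = \<Phi> s - s" unfolding s'_def deg_int[OF \<Phi>(2)] by simp
    have "norm ((\<Phi> t - t) - (\<Phi> s' - s')) \<le> (exp e - 1) * norm (t - s')"
    proof (rule field_differentiable_bound[of UNIV "\<lambda>t. \<Phi> t - t" "\<lambda>t. circle_deriv F (circ t) - 1"])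
      show "((\<lambda>t. \<Phi> t - t) has_real_derivative circle_deriv F (circ u) - 1) (at u within UNIV)" for u
        by (intro derivative_intros) (use D in auto)
      show "norm (circle_deriv F (circ u) - 1) \<le> exp e - 1" for u using bound[of u] by simp
    qed auto
    also have "\<dots> \<le> (exp e - 1) * 1"
      using s' var_le_nonneg[OF var] by (intro mult_left_mono) auto
    finally show "\<bar>(\<Phi> t - t) - (\<Phi> s - s)\<bar> \<le> exp e - 1" using eq by simp
  qed
  moreover have "dist (F x) (x + circ r) = dist (circ (\<Phi> t)) (circ (t + r))"
    using \<Phi>(1) t by (simp add: is_lift_def circ_add[symmetric])
  ultimately show "dist (F x) (x + circ r) \<le> exp e - 1"
    using dist_circ_le[of "\<Phi> t" "t + r"] by (simp add: diff_diff_eq)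
qed

lemma converges_to_rotationI:
  assumes "\<And>e. 0 < e \<Longrightarrow> \<forall>\<^sub>F n in sequentially. \<forall>x. dist (circle_deriv (F n) x) 1 \<le> exp e - 1 \<and>
      dist (F n x) (x + \<rho>) \<le> exp e - 1 \<and> circle_var (\<lambda>x. ln (circle_deriv (F n) x)) \<le> ennreal e"
  shows "converges_C1bv_to_rotation F \<rho>"
proof -
  \<comment> \<open>The number ln (1 + e / 2) is where exp - 1 takes the value e / 2.\<close>
  have ln: "0 < ln (1 + e / 2) \<and> exp (ln (1 + e / 2)) - 1 < e" if "0 < e" for e :: real
    using that by simp
  have "\<forall>\<^sub>F n in sequentially. \<forall>x\<in>UNIV. dist (F n x) (x + \<rho>) < e" if "0 < e" for e
    using assms[of "ln (1 + e / 2)"] ln[OF that] by (auto elim!: eventually_mono intro: le_less_trans)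
  moreover have "\<forall>\<^sub>F n in sequentially. \<forall>x\<in>UNIV. dist (circle_deriv (F n) x) 1 < e" if "0 < e" for e
    using assms[of "ln (1 + e / 2)"] ln[OF that] by (auto elim!: eventually_mono intro: le_less_trans)
  moreover have "(\<lambda>n. circle_var (\<lambda>x. ln (circle_deriv (F n) x))) \<longlonglongrightarrow> 0"
  proof (rule order_tendstoI)
    fix a :: ennreal assume "0 < a"
    then obtain e where e: "0 < e" "ennreal e < a"
    proof (cases a)
      case (real b)
      then show thesis using that[of "b / 2"] \<open>0 < a\<close> by (simp add: ennreal_less_iff)
    next
      case top
      then show thesis using that[of 1] by simp
    qed
    from assms[OF e(1)] show "\<forall>\<^sub>F n in sequentially. circle_var (\<lambda>x. ln (circle_deriv (F n) x)) < a"
      by eventually_elim (use e(2) in \<open>auto intro: le_less_trans\<close>)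
  qed simp
  ultimately show ?thesis
    by (simp add: converges_C1bv_to_rotation_def uniform_limit_iff)
qed

context folner_circle_group
begin

text \<open>Commutativity turns the logarithmic derivative of the conjugate into the average of
  \<open>ln Dg\<close> over \<open>B n\<close>.\<close>

lemma ln_deriv_conjugate:
  assumes g: "g \<in> \<Gamma>" and h: "circle_diffeo h" "\<And>x. circle_deriv h x = geom_mean_deriv (B n) x / I"
    and K: "is_lift K (inv_into UNIV h)"
    and D: "circle_deriv F (circ t) = circle_deriv h (g (circ (K t))) * circle_deriv g (circ (K t)) / circle_deriv h (circ (K t))"
  shows "ln (circle_deriv F (circ t)) = avg n (\<lambda>t. ln (circle_deriv g (circ t))) (K t)"
proof -
  let ?c = "1 / real (card (B n))"
  define y where "y = circ (K t)"
  have pos: "0 < circle_deriv w x" if "w \<in> \<Gamma>" for w x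
    using circle_diffeo_deriv_pos diffeo that by blast
  have prod_pos: "0 < (\<Prod>w\<in>B n. circle_deriv w x)" for x
    using pos B(3) by (intro prod_pos) blast
  have "0 < geom_mean_deriv (B n) x" for x
    unfolding geom_mean_deriv_def using prod_pos[of x] by simp
  moreover have "0 < geom_mean_deriv (B n) x / I" for x
    using circle_diffeo_deriv_pos[OF h(1), of x] h(2)[of x] by simp
  \<comment> \<open>The sign of the normalising constant is read off from the positive numerator and
    quotient; its logarithm later cancels.\<close>
  ultimately have I: "0 < I" by (meson zero_less_divide_iff less_asym)
  have lnh: "ln (circle_deriv h x) = (\<Sum>w\<in>B n. ?c * ln (circle_deriv w x)) - ln I" for x
  proof -
    have "ln (geom_mean_deriv (B n) x) = ?c * ln (\<Prod>w\<in>B n. circle_deriv w x)"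
      unfolding geom_mean_deriv_def using prod_pos[of x] by (simp add: ln_powr)
    also have "ln (\<Prod>w\<in>B n. circle_deriv w x) = (\<Sum>w\<in>B n. ln (circle_deriv w x))"
    proof (rule ln_prod)
      show "circle_deriv w x \<noteq> 0" if "w \<in> B n" for w
        using pos[of w x] that B(3) by force
    qed (rule B)
    finally show ?thesis
      using \<open>0 < geom_mean_deriv (B n) x\<close> I by (simp add: h(2) ln_div sum_distrib_left)
  qed
  \<comment> \<open>The chain rule at y for both sides of w \<circ> g = g \<circ> w.\<close>
  have cocycle: "ln (circle_deriv w (g y)) + ln (circle_deriv g y) - ln (circle_deriv w y) = ln (circle_deriv g (w y))"
    if "w \<in> B n" for w
  proof -
    have w: "w \<in> \<Gamma>" using that B(3) by blast
    have "circle_deriv w (g y) * circle_deriv g y = circle_deriv g (w y) * circle_deriv w y"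
      unfolding circle_deriv_comp[OF diffeo[OF w] diffeo[OF g], symmetric]
        circle_deriv_comp[OF diffeo[OF g] diffeo[OF w], symmetric] by (simp only: commute[OF w g])
    then have "ln (circle_deriv w (g y) * circle_deriv g y) = ln (circle_deriv g (w y) * circle_deriv w y)" by simp
    then show ?thesis using pos[OF w] pos[OF g] by (simp add: ln_mult_pos)
  qed
  have hpos: "0 < circle_deriv h x" for x by (rule circle_diffeo_deriv_pos[OF h(1)])
  have "ln (circle_deriv F (circ t)) = ln (circle_deriv h (g y)) + ln (circle_deriv g y) - ln (circle_deriv h y)"
    unfolding D y_def[symmetric] using hpos pos[OF g] by (simp add: ln_div ln_mult_pos less_imp_neq[symmetric])
  also have "\<dots> = (\<Sum>w\<in>B n. ?c * ln (circle_deriv w (g y))) + (\<Sum>w\<in>B n. ?c * ln (circle_deriv g y))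
      - (\<Sum>w\<in>B n. ?c * ln (circle_deriv w y))"
    using card_B_pos[of n] by (simp add: lnh)
  also have "\<dots> = (\<Sum>w\<in>B n. ?c * (ln (circle_deriv w (g y)) + ln (circle_deriv g y) - ln (circle_deriv w y)))"
    by (simp only: right_diff_distrib distrib_left sum_subtractf sum.distrib)
  also have "\<dots> = (\<Sum>w\<in>B n. ?c * ln (circle_deriv g (circ (lft w (K t)))))"
  proof (intro sum.cong refl)
    fix w assume w: "w \<in> B n"
    then have "circ (lft w (K t)) = w y" using lft[of w] B(3) by (auto simp: is_lift_def y_def)
    then show "?c * (ln (circle_deriv w (g y)) + ln (circle_deriv g y) - ln (circle_deriv w y))
        = ?c * ln (circle_deriv g (circ (lft w (K t))))"
      using cocycle[OF w] by simp
  qed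
  finally show ?thesis by (simp add: avg_def)
qed

lemma conjugates_converge:
  assumes g: "g \<in> \<Gamma>" and h: "\<And>n. 1 \<le> n \<Longrightarrow> circle_diffeo (h n)"
    "\<And>n x. 1 \<le> n \<Longrightarrow> circle_deriv (h n) x = geom_mean_deriv (B (n - 1)) x / I n"
  shows "converges_C1bv_to_rotation (\<lambda>n. h n \<circ> g \<circ> inv_into UNIV (h n)) (rotation_number g)"
proof (rule converges_to_rotationI)
  let ?G = "lft g" and ?u = "\<lambda>t. ln (circle_deriv g (circ t))"
  obtain r where r: "\<And>t. (\<lambda>n. ((?G ^^ n) t - t) / real n) \<longlonglongrightarrow> r"
    by (rule translation_number_exists[OF deg_lft[OF g] mono_lft[OF g]]) (rule that)
  have rot: "rotation_number g = circ r"
    by (rule rotation_number_eq[OF lft[OF g] degD[OF deg_lft[OF g]] r])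
  fix e :: real assume e: "0 < e"
  have "\<forall>\<^sub>F n in sequentially. var_le (avg n ?u) e"
    using limvar_ln_deriv[OF g] e unfolding limvar_def by simp
  then obtain N where N: "\<And>n. N \<le> n \<Longrightarrow> var_le (avg n ?u) e" by (auto simp: eventually_sequentially)
  have "dist (circle_deriv F x) 1 \<le> exp e - 1 \<and> dist (F x) (x + circ r) \<le> exp e - 1 \<and>
      circle_var (\<lambda>x. ln (circle_deriv F x)) \<le> ennreal e"
    if n: "N + 1 \<le> n" and F: "F = h n \<circ> g \<circ> inv_into UNIV (h n)" for n F x
  proof -
    \<comment> \<open>The map h n is built from the box of index n - 1, hence the bound
      \<open>N + 1\<close>.\<close>
    have n1: "1 \<le> n" "N \<le> n - 1" using n by auto
    note hn = h(1)[OF n1(1)]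
    obtain H where H: "is_lift H (h n)" using circle_diffeo_lift[OF hn] by blast
    obtain K where K: "is_lift K (inv_into UNIV (h n))" "\<And>t. H (K t) = t" "\<And>t. K (H t) = t"
      using inverse_lift[OF hn H] by metis
    have Kd: "circle_diffeo (inv_into UNIV (h n))" by (rule circle_diffeo_inverse(2)[OF hn])
    have degs: "deg 1 H" "mono H" "deg 1 K" "mono K" "deg 1 ?G" "mono ?G"
      using deg_lift[OF hn H] lift_mono[OF hn H] deg_lift[OF Kd K(1)] lift_mono[OF Kd K(1)] deg_lft[OF g] mono_lft[OF g]
      by blast+
    define \<Phi> where "\<Phi> = H \<circ> ?G \<circ> K"
    have lift\<Phi>: "is_lift \<Phi> F" unfolding \<Phi>_def F by (intro is_lift_comp H K lft g)
    have circK: "circ (K t) = inv_into UNIV (h n) (circ t)" for t using K(1) by (simp add: is_lift_def)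
    define D where "D t = circle_deriv (h n) (g (circ (K t))) * circle_deriv g (circ (K t)) / circle_deriv (h n) (circ (K t))" for t
    have der: "(\<Phi> has_real_derivative D t) (at t)" for t
    proof -
      have "(H \<circ> ?G \<circ> K has_real_derivative (circle_deriv (h n) (circ (?G (K t))) * circle_deriv g (circ (K t)))
          * circle_deriv (inv_into UNIV (h n)) (circ t)) (at t)"
        by (intro DERIV_chain circle_diffeo_deriv hn Kd diffeo g H K lft)
      moreover have "circ (?G (K t)) = g (circ (K t))" using lft[OF g] by (simp add: is_lift_def)
      ultimately show ?thesis
        using circle_diffeo_inverse(1)[OF hn, of "circ t"] by (simp add: \<Phi>_def D_def circK)
    qed
    have D: "circle_deriv F (circ t) = D t" for t by (rule circle_deriv_eq[OF lift\<Phi> der])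
    have Dpos: "0 < circle_deriv F x" for x
    proof -
      obtain t where "circ t = x" using circ_surj by blast
      moreover have "0 < D t"
        unfolding D_def by (intro divide_pos_pos mult_pos_pos circle_diffeo_deriv_pos hn diffeo g)
      ultimately show ?thesis using D[of t] by simp
    qed
    have "ln (circle_deriv F (circ t)) = avg (n - 1) ?u (K t)" for t
      by (rule ln_deriv_conjugate[OF g hn h(2)[OF n1(1)] K(1)]) (simp add: D D_def)
    moreover have "var_le (\<lambda>t. avg (n - 1) ?u (K t)) e"
      by (rule var_le_compose[OF N[OF n1(2)] degs(4,3)])
    ultimately have var: "var_le (\<lambda>t. ln (circle_deriv F (circ t))) e" by simp
    have deg\<Phi>: "deg 1 \<Phi>" using degs by (simp add: \<Phi>_def deg_def)
    have lim: "(\<lambda>n. ((\<Phi> ^^ n) 0 - 0) / real n) \<longlonglongrightarrow> r"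
      unfolding \<Phi>_def by (rule translation_number_conjugate[OF degs(1,2) K(2,3) r])
    have der': "(\<Phi> has_real_derivative circle_deriv F (circ t)) (at t)" for t using der D by simp
    note near = small_distortion_near_rotation[OF lift\<Phi> deg\<Phi> der' Dpos var lim, of x]
    show ?thesis using near var circle_var_le_iff[of e "\<lambda>x. ln (circle_deriv F x)"] e by simp
  qed
  then show "\<forall>\<^sub>F n in sequentially. \<forall>x. dist (circle_deriv (h n \<circ> g \<circ> inv_into UNIV (h n)) x) 1 \<le> exp e - 1 \<and>
      dist ((h n \<circ> g \<circ> inv_into UNIV (h n)) x) (x + rotation_number g) \<le> exp e - 1 \<and>
      circle_var (\<lambda>x. ln (circle_deriv (h n \<circ> g \<circ> inv_into UNIV (h n)) x)) \<le> ennreal e"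
    unfolding eventually_sequentially rot by blast
qed

end

theorem mainTheorem2:
  fixes \<Gamma> :: "(circle \<Rightarrow> circle) set"
    and k :: nat
    and f :: "nat \<Rightarrow> circle \<Rightarrow> circle"
    and h :: "nat \<Rightarrow> circle \<Rightarrow> circle"
  assumes diffeo: "\<And>g. g \<in> \<Gamma> \<Longrightarrow> circle_C1bv_diffeo g"
    and grp: "group (comp_group \<Gamma>)"
    and iso: "comp_group \<Gamma> \<cong> Zk k"
    and free: "free_action \<Gamma>"
    and ac: "\<And>g. g \<in> \<Gamma> \<Longrightarrow> circle_abs_cont (circle_deriv g)"
    and gens: "f ` {1..k} \<subseteq> \<Gamma>"
    and gen: "generate (comp_group \<Gamma>) (f ` {1..k}) = \<Gamma>"
    and h_diffeo: "\<And>n. n \<ge> 1 \<Longrightarrow> circle_diffeo (h n)"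
    and h_deriv: "\<And>n x. n \<ge> 1 \<Longrightarrow>
      circle_deriv (h n) x =
        geom_mean_deriv (word_box k f (n - 1)) x /
        circle_integral (geom_mean_deriv (word_box k f (n - 1)))"
  shows "\<forall>g\<in>\<Gamma>. converges_C1bv_to_rotation
           (\<lambda>n. h n \<circ> g \<circ> inv_into UNIV (h n)) (rotation_number g)"
proof -
  obtain c where "zk_circle_group \<Gamma> k f c"
    using zk_circle_group_exists[OF grp iso gens gen] by blast
  then interpret Z: zk_circle_group \<Gamma> k f c .
  interpret folner_circle_group \<Gamma> "word_box k f"
  proof
    show "g x \<noteq> x" if "g \<in> \<Gamma>" "g \<noteq> id" for g x using free that by (simp add: free_action_def)
    show "(\<lambda>n. real (card ((\<circ>) g ` word_box k f n - word_box k f n)) / real (card (word_box k f n))) \<longlonglongrightarrow> 0"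
      if "g \<in> \<Gamma>" for g
      using Z.folner_ratio_tendsto[OF that] unfolding Z.folner_ratio_def[abs_def] .
  qed (use diffeo ac Z.comp_mem Z.comp_commute Z.funpow_neq_id Z.finite_word_box Z.word_box_nonempty Z.word_box_subset in blast)+
  show ?thesis using conjugates_converge[OF _ h_diffeo h_deriv] by blast
qed

end
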